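(* Let $T>0$, $I=[-T,T]$, $|I|=2T\ge 1$, $N\ge 1$, and let $G\colon\mathbb{R}^N\to[0,\infty)$ be a continuously differentiable G-function satisfying the $\Delta_2$ and $\nabla_2$ conditions at infinity. Let $F\colon I\times\mathbb{R}^N\times\mathbb{R}^N\to\mathbb{R}$ be of class $C^1$, $V\in C^1(I\times\mathbb{R}^N,\mathbb{R})$ and $f\in \mathbf{L}^{G^\ast}(I,\mathbb{R}^N)$ with $f\not\equiv0$. Assume the following. Assumptions on $F$: (F1) $F(t,x,\cdot)$ is convex for all $(t,x)\in I\times\mathbb{R}^N$. (F2) There exist $a\in C(\mathbb{R}_+,\mathbb{R}_+)$ and $\beta\in L^1(I,\mathbb{R}_+)$ such that for all $(t,x,v)\in I\times\mathbb{R}^N\times\mathbb{R}^N$: $|F(t,x,v)|\le a(|x|)(\beta(t)+G(v))$, $|F_x(t,x,v)|\le a(|x|)(\beta(t)+G(v))$, and $G^\ast(F_v(t,x,v))\le a(|x|)\big(\beta(t)+G^\ast(\nabla G(v))\big)$. (F3) There exists $\theta_F>0$ such that $\langle F_x(t,x,v),x\rangle+\langle F_v(t,x,v),v\rangle\le\theta_F F(t,x,v)$ for all $(t,x,v)\in I\times\mathbb{R}^N\times\mathbb{R}^N$. (F4) There exists $\Lambda>0$ such that $F(t,x,v)\ge\Lambda G(v)$ for all $(t,x,v)\in I\times\mathbb{R}^N\times\mathbb{R}^N$. (F5) $F(t,x,0)=0$ and $F_v(t,x,0)=0$ for all $(t,x)\in I\times\mathbb{R}^N$. Assumptions on $V$: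 (V1) $V(t,x)=K(t,x)-W(t,x)$ for $x\in\mathbb{R}^N$, $t\in I$, where $K,W\colon I\times\mathbb{R}^N\to\mathbb{R}$. (V2) There exist $M>0$, $\varepsilon_V>0$, $\theta_V>\theta_F$ and $1<p_K\le\theta_V-\varepsilon_V$ such that for $|x|>M$, $t\in I$: $\langle V_x(t,x),x\rangle\le(\theta_V-\varepsilon_V)K(t,x)-\theta_V W(t,x)$ and $W(t,x)>K(t,x)>|x|^{p_K}$. (V3) There exist $\rho>0$, $b>1$ and $g\in L^1(I,\mathbb{R})$ such that $V(t,x)\ge b\,G(x)-g(t)$ for all $t\in I$ and all $x\in\mathbb{R}^N$ with $G\left(\frac{x}{2|I|}\right)\le\frac{\rho}{2}$. (V4) $\int_I V(t,0)\,dt=0$. Assumption on $f$ (with $\Lambda$ from (F4) and $\rho,b,g$ from (V3)): (f) $\int_I \big(G^\ast(f(t))+g(t)\big)\,dt<\min\{\Lambda,b-1\}\,\rho$. Let $\mathcal{L}(t,x,v)=F(t,x,v)+V(t,x)+\langle f(t),x\rangle$. Then the problem $$\frac{d}{dt}\mathcal{L}_v(t,u(t),\dot u(t))=\mathcal{L}_x(t,u(t),\dot u(t))\ \text{ for a.e. } t\in I,\qquad u(-T)=u(T),$$ has at least two periodic solutions.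
   Context: $\langle\cdot,\cdot\rangle$ and $|\cdot|$ are the Euclidean inner product and norm on $\mathbb{R}^N$; $\mathbb{R}_+=[0,\infty)$; subscripts $x,v$ denote gradients in these variables. A G-function is a function $G\colon\mathbb{R}^N\to[0,\infty)$ that is convex, even, with $G(0)=0$ and $G(x)/|x|\to\infty$ as $|x|\to\infty$. $\Delta_2$ at infinity: there are $C>0$, $R>0$ with $G(2x)\le C\,G(x)$ for $|x|\ge R$. $\nabla_2$ at infinity: there are $C>1$, $R>0$ with $G(x)\le\frac{1}{2C}G(Cx)$ for $|x|\ge R$. The Fenchel conjugate is $G^\ast(y)=\sup_{x\in\mathbb{R}^N}\{\langle x,y\rangle-G(x)\}$. The Orlicz space is $\mathbf{L}^G=\mathbf{L}^G(I,\mathbb{R}^N)=\{u\colon I\to\mathbb{R}^N \text{ measurable}:\int_I G(u)\,dt<\infty\}$ with the Luxemburg norm $\|u\|_{\mathbf{L}^G}=\inf\{\lambda>0:\int_I G(u/\lambda)\,dt\le1\}$; $\mathbf{L}^{G^\ast}$ is defined in the same way with $G^\ast$. The anisotropic Orlicz-Sobolev space is $\mathbf{W}^1\mathbf{L}^G=\{u\in\mathbf{L}^G:\dot u\in\mathbf{L}^G\}$ with norm $\|u\|_{\mathbf{L}^G}+\|\dot u\|_{\mathbf{L}^G}$ (its elements are absolutely continuous), and $\mathbf{W}^1_T\mathbf{L}^G=\{u\in\mathbf{W}^1\mathbf{L}^G:u(-T)=u(T)\}$. A periodic solution of the problem is a function $u\in\mathbf{W}^1_T\mathbf{L}^G$ satisfying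 the equation for a.e. $t\in I$ (where $t\mapsto\mathcal{L}_v(t,u(t),\dot u(t))$, defined a.e., is understood to have an absolutely continuous representative). *)

theory Defs
  imports "HOL-Analysis.Analysis"
begin

definition gradient :: "('a::real_inner \<Rightarrow> real) \<Rightarrow> 'a \<Rightarrow> 'a" where
  "gradient f x = (THE D. GDERIV f x :> D)"

lemma gradient_eqI:
  assumes "GDERIV f x :> D"
  shows "gradient f x = D"
  unfolding gradient_def
proof (rule the_equality)
  fix E assume "GDERIV f x :> E"
  then have "(\<lambda>h. h \<bullet> E) = (\<lambda>h. h \<bullet> D)"
    using assms unfolding gderiv_def by (rule has_derivative_unique)
  then show "E = D"
    by (metis vector_eq_rdot inner_commute)
qed (fact assms)

text \<open>The derivative is taken within \<open>S\<close>: on a set like \<open>{-T..T} \<times> UNIV\<close> with \<open>T > 0\<close> it is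
  unique, and one-sided in the first variable at the endpoints.\<close>
definition C1_on :: "'a::real_normed_vector set \<Rightarrow> ('a \<Rightarrow> 'b::real_normed_vector) \<Rightarrow> bool" where
  "C1_on S f \<longleftrightarrow>
    (\<exists>f'. (\<forall>x\<in>S. (f has_derivative blinfun_apply (f' x)) (at x within S)) \<and> continuous_on S f')"

definition G_function :: "('a::euclidean_space \<Rightarrow> real) \<Rightarrow> bool" where
  "G_function G \<longleftrightarrow>
    (\<forall>x. 0 \<le> G x) \<and> convex_on UNIV G \<and> (\<forall>x. G (- x) = G x) \<and> G 0 = 0 \<and>
    filterlim (\<lambda>x. G x / norm x) at_top at_infinity"

definition Delta2_at_infinity :: "('a::euclidean_space \<Rightarrow> real) \<Rightarrow> bool" where
  "Delta2_at_infinity G \<longleftrightarrow>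
    (\<exists>C>0. \<exists>R>0. \<forall>x. norm x \<ge> R \<longrightarrow> G (2 *\<^sub>R x) \<le> C * G x)"

definition Nabla2_at_infinity :: "('a::euclidean_space \<Rightarrow> real) \<Rightarrow> bool" where
  "Nabla2_at_infinity G \<longleftrightarrow>
    (\<exists>C>1. \<exists>R>0. \<forall>x. norm x \<ge> R \<longrightarrow> G x \<le> 1 / (2 * C) * G (C *\<^sub>R x))"

text \<open>For a G-function the supremum is finite by superlinear growth, so the real-valued
  supremum is the Fenchel conjugate.\<close>
definition fenchel_conjugate :: "('a::euclidean_space \<Rightarrow> real) \<Rightarrow> 'a \<Rightarrow> real" where
  "fenchel_conjugate G y = (SUP x. x \<bullet> y - G x)"

text \<open>Functions on an interval \<open>I\<close> are total functions of which only the values on \<open>I\<close> matter.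
  \<open>G\<close> is meant to be nonnegative, so that integrability of \<open>G \<circ> u\<close> expresses a finite integral.\<close>
definition orlicz_space :: "('a::euclidean_space \<Rightarrow> real) \<Rightarrow> real set \<Rightarrow> (real \<Rightarrow> 'a) set" where
  "orlicz_space G I =
    {u. u \<in> borel_measurable (lebesgue_on I) \<and> integrable (lebesgue_on I) (\<lambda>t. G (u t))}"

text \<open>The finite set \<open>D\<close> of pairs \<open>(s, t)\<close> lists the endpoints of non-overlapping
  subintervals of the interval \<open>I\<close>.\<close>
definition absolutely_continuous_on :: "real set \<Rightarrow> (real \<Rightarrow> 'a::real_normed_vector) \<Rightarrow> bool" where
  "absolutely_continuous_on I u \<longleftrightarrow>
    (\<forall>\<epsilon>>0. \<exists>\<delta>>0. \<forall>D :: (real \<times> real) set.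
      finite D \<and> (\<forall>(s, t)\<in>D. s \<le> t \<and> {s..t} \<subseteq> I) \<and>
      pairwise (\<lambda>(s, t) (s', t'). {s<..<t} \<inter> {s'<..<t'} = {}) D \<and>
      (\<Sum>(s, t)\<in>D. t - s) < \<delta>
      \<longrightarrow> (\<Sum>(s, t)\<in>D. norm (u t - u s)) < \<epsilon>)"

abbreviation time_derivative :: "real set \<Rightarrow> (real \<Rightarrow> 'a::real_normed_vector) \<Rightarrow> real \<Rightarrow> 'a" where
  "time_derivative I u t \<equiv> vector_derivative u (at t within I)"

text \<open>Sobolev functions are represented by their absolutely continuous representatives; their
  weak derivative is then the almost everywhere existing classical derivative.\<close>
definition orlicz_sobolev_space :: "('a::euclidean_space \<Rightarrow> real) \<Rightarrow> real set \<Rightarrow> (real \<Rightarrow> 'a) set" where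
  "orlicz_sobolev_space G I =
    {u. absolutely_continuous_on I u \<and> u \<in> orlicz_space G I \<and> time_derivative I u \<in> orlicz_space G I}"

definition periodic_orlicz_sobolev_space ::
  "('a::euclidean_space \<Rightarrow> real) \<Rightarrow> real \<Rightarrow> (real \<Rightarrow> 'a) set" where
  "periodic_orlicz_sobolev_space G T =
    {u \<in> orlicz_sobolev_space G {-T..T}. u (- T) = u T}"

text \<open>\<open>w\<close> is the absolutely continuous representative of \<open>t \<mapsto> L\<^sub>v(t, u(t), u'(t))\<close>.\<close>
definition periodic_solution ::
  "('a::euclidean_space \<Rightarrow> real) \<Rightarrow> real \<Rightarrow> (real \<Rightarrow> 'a \<Rightarrow> 'a \<Rightarrow> real) \<Rightarrow> (real \<Rightarrow> 'a) \<Rightarrow> bool" where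
  "periodic_solution G T L u \<longleftrightarrow>
    u \<in> periodic_orlicz_sobolev_space G T \<and>
    (\<exists>w. absolutely_continuous_on {-T..T} w \<and>
      (AE t in lebesgue_on {-T..T}. w t = gradient (\<lambda>v. L t (u t) v) (time_derivative {-T..T} u t)) \<and>
      (AE t in lebesgue_on {-T..T}.
        (w has_vector_derivative gradient (\<lambda>x. L t x (time_derivative {-T..T} u t)) (u t))
          (at t within {-T..T})))"

end

theory Submission
  imports Defs "HOL-Complex_Analysis.Great_Picard"
begin

text \<open>
  Periodic solutions are critical points of the action
  \<open>\<integral>\<^sub>I F(t, u, u') + V(t, u) + f \<bullet> u dt\<close> on periodic functions, and two of them are forced by the
  shape of its graph. The action is at least a positive constant \<open>\<alpha>\<close> wherever the modular
  \<open>\<integral>\<^sub>I G(u) + G(u') dt\<close> equals \<open>\<rho>\<close>, it vanishes at \<open>0\<close>, which lies inside this barrier, and it is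
  negative at some large constant, which lies outside. Hence there is a minimum inside the barrier at
  a level \<open>\<le> 0\<close>, and a critical point of mountain pass type at a positive level.

  Instead of a critical point theory in the Sobolev space, the proof uses a discretised action: \<open>I\<close> is
  cut into \<open>m\<close> equal cells, the unknowns are the values at the nodes, and velocities are periodic
  difference quotients. This is a continuously differentiable function of finitely many variables, for
  which minimisation and the mountain pass argument are elementary (\<open>critical_point_below\<close>,
  \<open>mountain_pass\<close>). The barrier survives the discretisation (\<open>J_barrier\<close>): by a discrete Sobolev
  inequality (\<open>sobolev\<close>) modular \<open>\<rho>\<close> keeps all nodes in the region where \<open>V\<close> is bounded below by
  \<open>b * G - g\<close>, and the Fenchel-Young inequality absorbs \<open>f\<close>.

  The passage to the limit rests on bounds for discrete critical points that do not depend on \<open>m\<close>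
  (\<open>critical_bounds\<close>). Since \<open>V\<close> is superquadratic relative to \<open>F\<close>, the combination
  \<open>\<theta>\<^sub>V J(x) - J'(x) x\<close> dominates the size of \<open>x\<close>, so that critical points are bounded in terms of their
  level (\<open>energy_estimate\<close>). The discrete Euler-Lagrange equation says that the momentum
  \<open>w\<^sub>i = F\<^sub>v\<close> changes from one cell to the next by \<open>h (F\<^sub>x + V\<^sub>x) + \<integral> f\<close>. These changes are summable, so
  the momenta are bounded by some \<open>W\<close>; convexity and \<open>F(t, x, 0) = 0\<close> then give
  \<open>\<Lambda> G(v\<^sub>i) \<le> F \<le> w\<^sub>i \<bullet> v\<^sub>i \<le> W |v\<^sub>i|\<close>, and superlinear growth of \<open>G\<close> bounds the velocities. All discrete
  critical points below a fixed level are thus Lipschitz with one constant.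

  By the Arzela-Ascoli theorem, positions and momenta converge uniformly along a subsequence, whereas
  the velocities \<open>v\<^sub>n\<close> converge only weakly to the derivative \<open>u'\<close> of the limit. Convexity compensates
  for this: the product of the convergent momenta with the weakly convergent velocities passes to the
  limit, so the excess
  \<open>F(t, u, u') - F(t, u, v\<^sub>n) - F\<^sub>v(t, u, v\<^sub>n) \<bullet> (u' - v\<^sub>n)\<close>, which is nonnegative, tends to \<open>0\<close> in \<open>L\<^sup>1\<close>.
  Therefore the limit of the momenta is a subgradient of \<open>F(t, u, \<cdot>)\<close> at \<open>u'\<close>, that is,
  \<open>F\<^sub>v(t, u, u')\<close> (\<open>momentum_identified\<close>), and the energies converge (\<open>energy_limit\<close>). The forces
  \<open>F\<^sub>x(t, u, v\<^sub>n)\<close> converge weakly because \<open>F\<^sub>x \<bullet> e\<close> is, uniformly in the velocity, a difference quotient of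
  convex functions of the velocity to which the same reasoning applies (\<open>force_limit\<close>). So limits of
  discrete critical points are solutions, and their actions are the limits of the discrete levels:
  at most \<open>0\<close> for the minima, at least \<open>\<alpha> / 2\<close> for the mountain pass points. The two solutions are
  therefore different.
\<close>

section \<open>Lebesgue differentiation and absolute continuity\<close>

lemma AE_lebesgue_on_if_negligible:
  assumes "negligible N" "\<And>t. t \<in> S \<Longrightarrow> t \<notin> N \<Longrightarrow> P t" "S \<in> sets lebesgue"
  shows "AE t in lebesgue_on S. P t"
proof -
  have "AE t in lebesgue. t \<notin> N"
    using assms(1) by (simp add: AE_not_in negligible_iff_null_sets)
  then have "AE t in lebesgue. t \<in> S \<longrightarrow> P t"
    using assms(2) by auto
  then show ?thesis using assms(3) by (simp add: AE_restrict_space_iff)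
qed

text \<open>Averages over small cubes with lower corner \<open>x\<close> converge to \<open>f x\<close> for almost every \<open>x\<close>; on the
  line these averages are the right difference quotients of the indefinite integral.\<close>
lemma lebesgue_differentiation_right:
  fixes f :: "real \<Rightarrow> 'b::euclidean_space"
  assumes "\<And>a b. f integrable_on {a..b}"
  obtains N where "negligible N"
    "\<And>x e. x \<notin> N \<Longrightarrow> 0 < e \<Longrightarrow> \<exists>d>0. \<forall>h. 0 < h \<and> h < d \<longrightarrow>
       norm (integral {x..x + h} f - h *\<^sub>R f x) \<le> e * h"
proof -
  obtain N where N: "negligible N" "\<And>x e. \<lbrakk>x \<notin> N; 0 < e\<rbrakk> \<Longrightarrow>
               \<exists>d>0. \<forall>h. 0 < h \<and> h < d \<longrightarrow>
                         norm(integral (cbox x (x + h *\<^sub>R One)) f /\<^sub>R h ^ DIM(real) - f x) < e"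
    using integrable_ccontinuous_explicit[of f] assms by auto
  have "\<exists>d>0. \<forall>h. 0 < h \<and> h < d \<longrightarrow> norm (integral {x..x + h} f - h *\<^sub>R f x) \<le> e * h"
    if xe: "x \<notin> N" "0 < e" for x e
  proof -
    obtain d where d: "d > 0" "\<And>h. 0 < h \<and> h < d \<Longrightarrow>
        norm(integral (cbox x (x + h *\<^sub>R One)) f /\<^sub>R h ^ DIM(real) - f x) < e"
      using N(2)[OF xe] by blast
    have "norm (integral {x..x + h} f - h *\<^sub>R f x) \<le> e * h" if h: "0 < h" "h < d" for h :: real
    proof -
      have "integral {x..x + h} f - h *\<^sub>R f x = h *\<^sub>R (integral {x..x + h} f /\<^sub>R h - f x)"
        using h by (simp add: algebra_simps)
      then have "norm (integral {x..x + h} f - h *\<^sub>R f x)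
          = h * norm (integral {x..x + h} f /\<^sub>R h - f x)"
        using h by simp
      also have "\<dots> \<le> h * e"
        using d(2)[of h] h by (intro mult_left_mono) (simp_all add: less_imp_le)
      finally show ?thesis by (simp add: mult.commute)
    qed
    then show ?thesis using d(1) by blast
  qed
  then show ?thesis using that N(1) by blast
qed

text \<open>Left difference quotients of the integral of \<open>f\<close> at \<open>t\<close> are right difference quotients of the
  integral of \<open>\<lambda>x. f (- x)\<close> at \<open>- t\<close>.\<close>
lemma lebesgue_differentiation:
  fixes f :: "real \<Rightarrow> 'b::euclidean_space"
  assumes f: "f integrable_on {a..b}"
  shows "AE t in lebesgue_on {a..b}.
    ((\<lambda>s. integral {a..s} f) has_vector_derivative f t) (at t within {a..b})"
proof -
  \<comment> \<open>Extension by 0 makes the function integrable around every point of the line.\<close>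
  define F where "F = (\<lambda>x. if x \<in> {a..b} then f x else 0)"
  have FU: "F integrable_on UNIV"
    using f unfolding F_def by (subst integrable_restrict_UNIV)
  have Fi: "F integrable_on {c..d}" for c d
    using integrable_on_subcbox[OF FU, of c d] by simp
  have Gi: "(\<lambda>x. F (-x)) integrable_on {c..d}" for c d
    using Fi[of "-d" "-c"] Henstock_Kurzweil_Integration.integrable_reflect_real[where f=F and a="-d" and b="-c"] unfolding minus_minus by blast
  obtain N1 where N1: "negligible N1" "\<And>x e. x \<notin> N1 \<Longrightarrow> 0 < e \<Longrightarrow> \<exists>d>0. \<forall>h. 0 < h \<and> h < d \<longrightarrow>
       norm (integral {x..x + h} F - h *\<^sub>R F x) \<le> e * h"
    using lebesgue_differentiation_right[OF Fi] by blast
  obtain N2 where N2: "negligible N2" "\<And>x e. x \<notin> N2 \<Longrightarrow> 0 < e \<Longrightarrow> \<exists>d>0. \<forall>h. 0 < h \<and> h < d \<longrightarrow>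
       norm (integral {x..x + h} (\<lambda>x. F (-x)) - h *\<^sub>R F (-x)) \<le> e * h"
    using lebesgue_differentiation_right[OF Gi] by blast
  have neg: "negligible (N1 \<union> uminus ` N2)"
  proof (rule negligible_Un[OF N1(1)])
    have "(uminus :: real \<Rightarrow> real) differentiable_on N2"
      by (intro derivative_intros)
    then show "negligible (uminus ` N2)"
      using negligible_differentiable_image_negligible[OF order_refl N2(1)] by blast
  qed
  show ?thesis
  proof (rule AE_lebesgue_on_if_negligible[OF neg])
    fix t assume t: "t \<in> {a..b}" and tN: "t \<notin> N1 \<union> uminus ` N2"
    then have "t \<notin> N1" "- t \<notin> N2" by (auto simp: image_iff)
    have diff: "integral {a..y} f - integral {a..x} f = integral {x..y} F"
      if "a \<le> x" "x \<le> y" "y \<le> b" for x y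
    proof -
      have "integral {a..x} f + integral {x..y} f = integral {a..y} f"
        using that f by (intro Henstock_Kurzweil_Integration.integral_combine)
          (auto intro: integrable_on_subinterval)
      moreover have "integral {x..y} f = integral {x..y} F"
        using that by (intro integral_cong) (auto simp: F_def)
      ultimately show ?thesis by (simp add: algebra_simps)
    qed
    have Ft: "F t = f t" using t by (simp add: F_def)
    show "((\<lambda>s. integral {a..s} f) has_vector_derivative f t) (at t within {a..b})"
      unfolding has_vector_derivative_def has_derivative_within_alt
    proof (intro conjI allI impI bounded_linear_scaleR_left)
      fix e :: real assume e: "0 < e"
      obtain d1 where d1: "d1 > 0" "\<And>h. 0 < h \<and> h < d1 \<Longrightarrow>
         norm (integral {t..t + h} F - h *\<^sub>R F t) \<le> e * h"
        using N1(2)[OF \<open>t \<notin> N1\<close> e] by blast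
      obtain d2 where d2: "d2 > 0" "\<And>h. 0 < h \<and> h < d2 \<Longrightarrow>
         norm (integral {-t..-t + h} (\<lambda>x. F (-x)) - h *\<^sub>R F (-(-t))) \<le> e * h"
        using N2(2)[OF \<open>- t \<notin> N2\<close> e] by blast
      have "norm (integral {a..y} f - integral {a..t} f - (y - t) *\<^sub>R f t) \<le> e * norm (y - t)"
        if y: "y \<in> {a..b}" "norm (y - t) < min d1 d2" for y
      proof -
        consider "y = t" | "y > t" | "y < t" by linarith
        then show ?thesis
        proof cases
          case 2
          have "norm (integral {t..t + (y - t)} F - (y - t) *\<^sub>R F t) \<le> e * (y - t)"
            by (rule d1(2)) (use 2 y in auto)
          then show ?thesis using diff[of t y] t y 2 Ft by simp
        next
          case 3
          have "norm (integral {-t..-t + (t - y)} (\<lambda>x. F (-x)) - (t - y) *\<^sub>R F (-(-t))) \<le> e * (t - y)"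
            by (rule d2(2)) (use 3 y in auto)
          moreover have "integral {-t..-t + (t - y)} (\<lambda>x. F (-x)) = integral {y..t} F"
            using Henstock_Kurzweil_Integration.integral_reflect_real[where f=F and a=y and b=t] by (simp add: algebra_simps)
          moreover have "integral {a..t} f - integral {a..y} f = integral {y..t} F"
            using diff[of y t] t y 3 by simp
          ultimately have "norm ((integral {a..t} f - integral {a..y} f) - (t - y) *\<^sub>R f t) \<le> e * (t - y)"
            using Ft by simp
          moreover have "integral {a..y} f - integral {a..t} f - (y - t) *\<^sub>R f t
              = - ((integral {a..t} f - integral {a..y} f) - (t - y) *\<^sub>R f t)"
            by (simp add: algebra_simps)
          ultimately show ?thesis using 3 by (simp only: norm_minus_cancel) simp
        qed simp
      qed
      then show "\<exists>d>0. \<forall>y\<in>{a..b}. norm (y - t) < d \<longrightarrow>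
          norm (integral {a..y} f - integral {a..t} f - (y - t) *\<^sub>R f t) \<le> e * norm (y - t)"
        using d1(1) d2(1) by (intro exI[of _ "min d1 d2"]) auto
    qed
  qed simp
qed

lemma integrable_indicator_mult:
  fixes f :: "'a \<Rightarrow> real"
  assumes "integrable M f" "A \<in> sets M"
  shows "integrable M (\<lambda>x. indicator A x * f x)"
  using integrable_mult_indicator[OF assms(2,1)] by simp

lemma open_interval_in_sets_lebesgue_on:
  assumes "(a::real) \<le> s" "t \<le> b"
  shows "{s<..<t} \<in> sets (lebesgue_on {a..b})"
    "emeasure (lebesgue_on {a..b}) {s<..<t} = emeasure lebesgue {s<..<t}"
proof -
  have "{s<..<t} \<subseteq> {a..b}" using assms by auto
  then show "{s<..<t} \<in> sets (lebesgue_on {a..b})"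
    "emeasure (lebesgue_on {a..b}) {s<..<t} = emeasure lebesgue {s<..<t}"
    by (auto simp: sets_restrict_space_iff emeasure_restrict_space)
qed

text \<open>The function \<open>norm f\<close> is split into its truncation at height \<open>n\<close> and a remainder. The remainder has
  a small integral over all of \<open>{a..b}\<close> if \<open>n\<close> is large, and then the truncation contributes at most
  \<open>n\<close> times the total length of the intervals.\<close>
lemma indefinite_integral_absolutely_continuous:
  fixes f :: "real \<Rightarrow> 'b::euclidean_space"
  assumes f: "f absolutely_integrable_on {a..b}"
    and u: "\<And>t. t \<in> {a..b} \<Longrightarrow> u t = c + integral {a..t} f"
  shows "absolutely_continuous_on {a..b} u"
  unfolding absolutely_continuous_on_def
proof (intro allI impI)
  fix e :: real assume e: "0 < e"
  let ?M = "lebesgue_on {a..b}"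
  have nf: "integrable ?M (\<lambda>t. norm (f t))"
    using f by (simp add: integrable_restrict_space set_integrable_def absolutely_integrable_on_def set_integrable_norm)
  have fm: "(\<lambda>t. norm (f t)) \<in> borel_measurable ?M" using nf by auto
  \<comment> \<open>the part of \<open>norm f\<close> above height \<open>n\<close>\<close>
  define p where "p n t = norm (f t) - min (norm (f t)) (real n)" for n t
  have p0: "p n t \<ge> 0" for n t by (simp add: p_def)
  have pn: "p n t \<le> norm (f t)" for n t by (simp add: p_def)
  have pint: "integrable ?M (p n)" for n
    by (rule Bochner_Integration.integrable_bound[OF nf]) (use nf p0 pn in \<open>auto simp: p_def[abs_def]\<close>)
  have "(\<lambda>n. integral\<^sup>L ?M (p n)) \<longlonglongrightarrow> integral\<^sup>L ?M (\<lambda>t. 0)"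
  proof (rule integral_dominated_convergence[OF _ _ nf])
    show "AE t in ?M. (\<lambda>n. p n t) \<longlonglongrightarrow> 0"
    proof (rule AE_I2)
      fix t
      have "eventually (\<lambda>n. real n \<ge> norm (f t)) sequentially"
        by (meson eventually_sequentiallyI nat_ceiling_le_eq)
      then have "eventually (\<lambda>n. p n t = 0) sequentially"
        by eventually_elim (simp add: p_def)
      then show "(\<lambda>n. p n t) \<longlonglongrightarrow> 0" by (rule tendsto_eventually)
    qed
  qed (use fm p0 pn pint in auto)
  then have "(\<lambda>n. integral\<^sup>L ?M (p n)) \<longlonglongrightarrow> 0" by simp
  then obtain n where n: "integral\<^sup>L ?M (p n) < e / 2"
    using order_tendstoD(2)[of _ 0 sequentially "e/2"] e by (auto simp: eventually_sequentially)
  define \<delta> where "\<delta> = e / (2 * (real n + 1))"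
  have \<delta>: "\<delta> > 0" using e by (simp add: \<delta>_def)
  show "\<exists>\<delta>>0. \<forall>D. finite D \<and> (\<forall>(s, t)\<in>D. s \<le> t \<and> {s..t} \<subseteq> {a..b}) \<and>
      pairwise (\<lambda>(s, t) (s', t'). {s<..<t} \<inter> {s'<..<t'} = {}) D \<and> (\<Sum>(s, t)\<in>D. t - s) < \<delta> \<longrightarrow>
      (\<Sum>(s, t)\<in>D. norm (u t - u s)) < e"
  proof (intro exI[of _ \<delta>] conjI allI impI, rule \<delta>)
    fix D :: "(real \<times> real) set"
    assume D: "finite D \<and> (\<forall>(s, t)\<in>D. s \<le> t \<and> {s..t} \<subseteq> {a..b}) \<and>
      pairwise (\<lambda>(s, t) (s', t'). {s<..<t} \<inter> {s'<..<t'} = {}) D \<and> (\<Sum>(s, t)\<in>D. t - s) < \<delta>"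
    let ?J = "\<lambda>q::real\<times>real. {fst q<..<snd q}"
    have "\<forall>(s, t)\<in>D. s \<le> t \<and> {s..t} \<subseteq> {a..b}" using D by blast
    then have "fst q \<le> snd q \<and> {fst q..snd q} \<subseteq> {a..b}" if "q \<in> D" for q
      using that by (simp add: case_prod_beta)
    then have Dq: "fst q \<le> snd q" "a \<le> fst q" "snd q \<le> b" if "q \<in> D" for q
      using that by auto
    have bound: "norm (u (snd q) - u (fst q)) \<le> real n * (snd q - fst q) + (LINT x|?M. indicator (?J q) x * p n x)"
      if q: "q \<in> D" for q
    proof -
      obtain s t where st: "q = (s, t)" by (cases q)
      have st': "s \<le> t" "a \<le> s" "t \<le> b" using Dq[OF q] st by auto
      have ind: "integrable ?M (indicator {s<..<t} :: real \<Rightarrow> real)"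
        using open_interval_in_sets_lebesgue_on[OF st'(2,3)]
        by (intro integrable_real_indicator) (use st' in \<open>auto simp: emeasure_lborel_Ioo\<close>)
      have fi: "f integrable_on {a..b}" using f set_lebesgue_integral_eq_integral(1) by blast
      have fst_ai: "f absolutely_integrable_on {s..t}"
        using f st' by (intro absolutely_integrable_on_subinterval[OF f]) auto
      have "u t - u s = integral {s..t} f"
      proof -
        have "integral {a..s} f + integral {s..t} f = integral {a..t} f"
          using st' fi by (intro Henstock_Kurzweil_Integration.integral_combine)
            (auto intro: integrable_on_subinterval)
        then show ?thesis using u[of s] u[of t] st' by (simp add: algebra_simps)
      qed
      then have "norm (u t - u s) \<le> integral {s..t} (\<lambda>x. norm (f x))"
        using integral_norm_bound_integral[of f "{s..t}" "\<lambda>x. norm (f x)"] fst_ai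
        by (simp add: absolutely_integrable_on_def)
      also have "\<dots> = integral {s<..<t} (\<lambda>x. norm (f x))"
        using integral_open_interval_real[of s t "\<lambda>x. norm (f x)"] by simp
      also have "\<dots> = (LINT x|lebesgue_on {s<..<t}. norm (f x))"
      proof (rule lebesgue_integral_eq_integral[symmetric])
        show "integrable (lebesgue_on {s<..<t}) (\<lambda>x. norm (f x))"
          using set_integrable_norm[OF set_integrable_subset[OF fst_ai, of "{s<..<t}"]]
          by (simp add: integrable_restrict_space set_integrable_def subset_iff)
      qed simp
      also have "\<dots> = (LINT x|?M. indicator {s<..<t} x * norm (f x))"
        using st' by (simp add: integral_restrict_space indicator_def) 
          (intro Bochner_Integration.integral_cong; auto)
      also have "\<dots> \<le> (LINT x|?M. real n * indicator {s<..<t} x + indicator {s<..<t} x * p n x)"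
      proof (rule integral_mono)
        show "integrable ?M (\<lambda>x. indicator {s<..<t} x * norm (f x))"
          by (intro integrable_indicator_mult nf open_interval_in_sets_lebesgue_on st')
        show "integrable ?M (\<lambda>x. real n * indicator {s<..<t} x + indicator {s<..<t} x * p n x)"
          by (intro Bochner_Integration.integrable_add integrable_mult_right ind
            integrable_indicator_mult pint open_interval_in_sets_lebesgue_on st')
      qed (auto simp: indicator_def p_def)
      also have "\<dots> = real n * (LINT x|?M. indicator {s<..<t} x) + (LINT x|?M. indicator {s<..<t} x * p n x)"
        using ind by (subst Bochner_Integration.integral_add)
          (auto intro!: integrable_indicator_mult pint open_interval_in_sets_lebesgue_on st')
      also have "(LINT x|?M. indicator {s<..<t} x) = t - s"
      proof -
        have "(LINT x|?M. indicator {s<..<t} x) = measure ?M ({s<..<t} \<inter> space ?M)" by simp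
        also have "{s<..<t} \<inter> space ?M = {s<..<t}" using st' by auto
        also have "measure ?M {s<..<t} = t - s"
          unfolding measure_def open_interval_in_sets_lebesgue_on(2)[OF st'(2,3)] using st' by simp
        finally show ?thesis .
      qed
      finally show ?thesis using st by simp
    qed
    have "(\<Sum>q\<in>D. norm (u (snd q) - u (fst q)))
        \<le> (\<Sum>q\<in>D. real n * (snd q - fst q) + (LINT x|?M. indicator (?J q) x * p n x))"
      by (rule sum_mono) (use bound in auto)
    also have "\<dots> = real n * (\<Sum>q\<in>D. snd q - fst q) + (\<Sum>q\<in>D. (LINT x|?M. indicator (?J q) x * p n x))"
      by (simp add: sum.distrib sum_distrib_left)
    also have "(\<Sum>q\<in>D. (LINT x|?M. indicator (?J q) x * p n x)) = (LINT x|?M. (\<Sum>q\<in>D. indicator (?J q) x * p n x))"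
    proof (rule Bochner_Integration.integral_sum[symmetric])
      fix q assume q: "q \<in> D"
      show "integrable ?M (\<lambda>x. indicator (?J q) x * p n x)"
        by (intro integrable_indicator_mult pint open_interval_in_sets_lebesgue_on Dq[OF q])
    qed
    also have "\<dots> \<le> (LINT x|?M. p n x)"
    proof (rule integral_mono[OF _ pint])
      show "integrable ?M (\<lambda>x. (\<Sum>q\<in>D. indicator (?J q) x * p n x))"
      proof (rule Bochner_Integration.integrable_sum)
        fix q assume q: "q \<in> D"
        show "integrable ?M (\<lambda>x. indicator (?J q) x * p n x)"
          by (intro integrable_indicator_mult pint open_interval_in_sets_lebesgue_on Dq[OF q])
      qed
      fix x
      \<comment> \<open>Only the open intervals are disjoint; the shared endpoints do not contribute to the integral.\<close>
      have "(\<Sum>q\<in>D. indicator (?J q) x) \<le> (1::real)"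
      proof (cases "\<exists>q\<in>D. x \<in> ?J q")
        case True
        then obtain q where q: "q \<in> D" "x \<in> ?J q" by blast
        have "x \<notin> ?J q'" if "q' \<in> D - {q}" for q'
        proof -
          have "pairwise (\<lambda>(s, t) (s', t'). {s<..<t} \<inter> {s'<..<t'} = {}) D" using D by blast
          then have "?J q \<inter> ?J q' = {}"
            using that q(1) unfolding pairwise_def case_prod_beta by blast
          then show ?thesis using q by blast
        qed
        then have "(\<Sum>q'\<in>D - {q}. indicator (?J q') x) = (0::real)"
          by (intro sum.neutral) (auto simp: indicator_def)
        then show ?thesis using q D by (simp add: sum.remove)
      next
        case False
        then have "(\<Sum>q\<in>D. indicator (?J q) x) = (0::real)"
          by (intro sum.neutral) (auto simp: indicator_def)
        then show ?thesis by simp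
      qed
      then show "(\<Sum>q\<in>D. indicator (?J q) x * p n x) \<le> p n x"
        using p0[of n x] mult_right_mono[of _ 1 "p n x"] by (simp flip: sum_distrib_right)
    qed
    also have "real n * (\<Sum>q\<in>D. snd q - fst q) + (LINT x|?M. p n x) < e"
    proof -
      have "real n * (\<Sum>q\<in>D. snd q - fst q) \<le> real n * \<delta>"
        using D by (intro mult_left_mono) (auto simp: case_prod_beta)
      also have "\<dots> \<le> e / 2" using e by (simp add: \<delta>_def field_simps)
      finally show ?thesis using n by simp
    qed
    finally show "(\<Sum>(s, t)\<in>D. norm (u t - u s)) < e" by (simp add: case_prod_beta)
  qed
qed

section \<open>Lipschitz functions are indefinite integrals\<close>

text \<open>Both sides are measures in \<open>A\<close> that agree on half-open intervals. Cutting down to \<open>{-k<..k}\<close> keeps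
  them finite, so that the equation passes to complements.\<close>
lemma interval_measure_add:
  fixes U W :: "real \<Rightarrow> real"
  assumes mU: "\<And>x y. x \<le> y \<Longrightarrow> U x \<le> U y" and mW: "\<And>x y. x \<le> y \<Longrightarrow> W x \<le> W y"
    and cU: "continuous_on UNIV U" and cW: "continuous_on UNIV W"
    and sum: "\<And>x. U x + W x = C * x" and C: "C \<ge> 0"
    and A: "A \<in> sets borel"
  shows "emeasure (interval_measure U) (A \<inter> {-k<..k}) + emeasure (interval_measure W) (A \<inter> {-k<..k})
    = ennreal C * emeasure lborel (A \<inter> {-k<..k})"
proof -
  let ?G = "range (\<lambda>(a, b). {a<..b::real})"
  let ?K = "{-k<..k}"
  have rU: "continuous (at_right a) U" and rW: "continuous (at_right a) W" for a
    using cU cW by (auto simp: continuous_on_eq_continuous_at intro: continuous_at_imp_continuous_at_within)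
  have iU: "emeasure (interval_measure U) {a<..b} = ennreal (U b - U a)" if "a \<le> b" for a b
    using that by (intro emeasure_interval_measure_Ioc mU rU)
  have iW: "emeasure (interval_measure W) {a<..b} = ennreal (W b - W a)" if "a \<le> b" for a b
    using that by (intro emeasure_interval_measure_Ioc mW rW)
  have Ioc: "emeasure (interval_measure U) {a<..b} + emeasure (interval_measure W) {a<..b}
      = ennreal C * emeasure lborel {a<..b}" for a b
  proof (cases "a \<le> b")
    case True
    have "U b - U a + (W b - W a) = C * (b - a)" using sum[of a] sum[of b] by (simp add: algebra_simps)
    then show ?thesis using True iU[OF True] iW[OF True] mU[OF True] mW[OF True] C
      by (simp add: ennreal_plus[symmetric] ennreal_mult[symmetric] del: ennreal_plus)
  qed simp
  have int: "{a<..b} \<inter> {c<..d} = {max a c<..min b d}" for a b c d :: real by auto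
  have "Int_stable ?G"
    by (auto simp: Int_stable_def int)
  moreover have "?G \<subseteq> Pow UNIV" by simp
  moreover have "A \<in> sigma_sets UNIV ?G"
    using A unfolding borel_sigma_sets_Ioc by simp
  ultimately show ?thesis
  proof (induction rule: sigma_sets_induct_disjoint)
    case (basic A)
    then show ?case by (auto simp: int Ioc)
  next
    case (compl A)
    have A: "A \<in> sets borel" using compl(1) unfolding borel_sigma_sets_Ioc by simp
    have spl: "emeasure M ?K = emeasure M (A \<inter> ?K) + emeasure M ((UNIV - A) \<inter> ?K)"
      if "sets M = sets borel" for M
    proof -
      have "?K = (A \<inter> ?K) \<union> ((UNIV - A) \<inter> ?K)" by auto
      then show ?thesis using A that
        by (subst plus_emeasure) auto
    qed
    have fin: "ennreal C * emeasure lborel (A \<inter> ?K) < top"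
      by (intro ennreal_mult_less_top[THEN iffD2] disjI2 conjI) 
        (auto intro: le_less_trans[OF emeasure_mono[of _ "{-\<bar>k\<bar>..\<bar>k\<bar>}"]])
    have "ennreal C * emeasure lborel (A \<inter> ?K)
       + (emeasure (interval_measure U) ((UNIV - A) \<inter> ?K) + emeasure (interval_measure W) ((UNIV - A) \<inter> ?K))
      = emeasure (interval_measure U) ?K + emeasure (interval_measure W) ?K"
      using spl[of "interval_measure U"] spl[of "interval_measure W"] compl(2)[symmetric]
      by (simp add: ac_simps)
    also have "\<dots> = ennreal C * emeasure lborel (A \<inter> ?K) + ennreal C * emeasure lborel ((UNIV - A) \<inter> ?K)"
      using spl[of lborel] by (simp add: Ioc distrib_left)
    finally show ?case using fin unfolding ennreal_add_left_cancel infinity_ennreal_def by (metis less_irrefl)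
  next
    case (union A)
    have Ai: "A i \<in> sets borel" for i using union(2) unfolding borel_sigma_sets_Ioc by auto
    have sm: "emeasure M ((\<Union>i. A i) \<inter> ?K) = (\<Sum>i. emeasure M (A i \<inter> ?K))" if "sets M = sets borel" for M
    proof -
      have "disjoint_family (\<lambda>i. A i \<inter> ?K)" using union(1) by (auto simp: disjoint_family_on_def)
      then have "(\<Sum>i. emeasure M (A i \<inter> ?K)) = emeasure M (\<Union>i. A i \<inter> ?K)"
        using Ai that by (intro suminf_emeasure) auto
      then show ?thesis by simp
    qed
    show ?case by (simp only: sm sets_interval_measure sets_lborel suminf_add[OF summableI summableI]
      ennreal_suminf_cmult[symmetric] union)
  qed auto
qed

text \<open>Not only \<open>U\<close> but also \<open>C * x - U x\<close> is increasing. The interval measures of these two functions add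
  up to \<open>C\<close> times Lebesgue measure; hence that of \<open>U\<close> is absolutely continuous and has a
  Radon-Nikodym density.\<close>
lemma lipschitz_mono_density:
  fixes U :: "real \<Rightarrow> real"
  assumes mU: "\<And>x y. x \<le> y \<Longrightarrow> U x \<le> U y" and lip: "\<And>x y. \<bar>U x - U y\<bar> \<le> C * \<bar>x - y\<bar>" and C: "C \<ge> 0"
  obtains d :: "real \<Rightarrow> real" where "d \<in> borel_measurable borel"
    "\<And>a b. a \<le> b \<Longrightarrow> d absolutely_integrable_on {a..b}"
    "\<And>a b. a \<le> b \<Longrightarrow> integral {a..b} d = U b - U a"
proof -
  define W where "W x = C * x - U x" for x
  let ?M = "interval_measure U"
  have mW: "W x \<le> W y" if "x \<le> y" for x y
    using lip[of y x] that mU[OF that] by (simp add: W_def algebra_simps)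
  have "C-lipschitz_on UNIV U"
    using lip C by (auto intro!: lipschitz_onI simp: dist_real_def)
  then have cU: "continuous_on UNIV U" by (rule lipschitz_on_continuous_on)
  then have cW: "continuous_on UNIV W" unfolding W_def by (intro continuous_intros)
  have ac: "absolutely_continuous lborel ?M"
    unfolding absolutely_continuous_def
  proof
    fix N :: "real set" assume "N \<in> null_sets lborel"
    then have N: "N \<in> sets borel" "emeasure lborel N = 0" by auto
    have z: "emeasure ?M (N \<inter> {- real k<..real k}) = 0" for k
    proof -
      have "emeasure lborel (N \<inter> {- real k<..real k}) = 0"
        using emeasure_mono[of "N \<inter> {- real k<..real k}" N lborel] N by auto
      then show ?thesis
        using interval_measure_add[OF mU mW cU cW _ C N(1), of "real k"] by (simp add: W_def)
    qed
    have "N = (\<Union>k. N \<inter> {- real k<..real k})"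
    proof (intro equalityI subsetI)
      fix x assume "x \<in> N"
      obtain k where "\<bar>x\<bar> < real k" using reals_Archimedean2 by blast
      then show "x \<in> (\<Union>k. N \<inter> {- real k<..real k})" using \<open>x \<in> N\<close> by (intro UN_I[of k]) auto
    qed auto
    moreover have "(\<Union>k. N \<inter> {- real k<..real k}) \<in> null_sets ?M"
      using N z by (intro null_sets_UN) auto
    ultimately show "N \<in> null_sets ?M" by simp
  qed
  interpret sigma_finite_measure ?M
    using cU by (intro sigma_finite_interval_measure mU)
      (auto simp: continuous_on_eq_continuous_at intro: continuous_at_imp_continuous_at_within)
  let ?r = "RN_deriv lborel ?M"
  define d where "d x = enn2real (?r x)" for x
  have dens: "density lborel ?r = ?M" by (rule sigma_finite_measure.density_RN_deriv[OF sigma_finite_lborel ac]) simp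
  have fin: "AE x in lborel. ?r x \<noteq> \<infinity>"
    by (rule sigma_finite_measure.RN_deriv_finite[OF sigma_finite_lborel _ ac]) (auto intro: sigma_finite_measure_axioms)
  have db: "d \<in> borel_measurable borel" unfolding d_def by measurable
  have hb: "has_bochner_integral lborel (\<lambda>x. indicator {a..b} x *\<^sub>R d x) (U b - U a)" if ab: "a \<le> b" for a b
  proof (rule has_bochner_integral_nn_integral)
    show "(\<lambda>x. indicator {a..b} x *\<^sub>R d x) \<in> borel_measurable lborel" using db by measurable
    show "AE x in lborel. 0 \<le> indicator {a..b} x *\<^sub>R d x" by (simp add: d_def)
    show "0 \<le> U b - U a" using mU[OF ab] by simp
    have "(\<integral>\<^sup>+x. ennreal (indicator {a..b} x *\<^sub>R d x) \<partial>lborel) = (\<integral>\<^sup>+x. ?r x * indicator {a..b} x \<partial>lborel)"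
      using fin by (intro nn_integral_cong_AE) (auto elim!: eventually_mono simp: d_def indicator_def less_top)
    also have "\<dots> = emeasure (density lborel ?r) {a..b}"
      by (subst emeasure_density) auto
    also have "\<dots> = ennreal (U b - U a)"
      unfolding dens using ab by (intro emeasure_interval_measure_Icc mU cU)
    finally show "(\<integral>\<^sup>+x. ennreal (indicator {a..b} x *\<^sub>R d x) \<partial>lborel) = ennreal (U b - U a)" .
  qed
  have ai: "d absolutely_integrable_on {a..b}" and ii: "integral {a..b} d = U b - U a" if ab: "a \<le> b" for a b
  proof -
    have m: "(\<lambda>x. indicator {a..b} x *\<^sub>R d x) \<in> borel_measurable lborel" using db by measurable
    have "integrable lborel (\<lambda>x. indicator {a..b} x *\<^sub>R d x)"
      "integral\<^sup>L lborel (\<lambda>x. indicator {a..b} x *\<^sub>R d x) = U b - U a"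
      using hb[OF ab] by (auto simp: has_bochner_integral_iff)
    then show 1: "d absolutely_integrable_on {a..b}"
      using m by (simp add: set_integrable_def integrable_completion)
    have "(LINT x:{a..b}|lebesgue. d x) = U b - U a"
      using hb[OF ab] m by (simp add: set_lebesgue_integral_def integral_completion has_bochner_integral_iff)
    then show "integral {a..b} d = U b - U a"
      using set_lebesgue_integral_eq_integral(2)[OF 1] by simp
  qed
  show ?thesis using that[OF db ai ii] by blast
qed

text \<open>Adding the slope \<open>L\<close> to a coordinate of \<open>u\<close> makes it increasing. The resulting density is the
  derivative of \<open>u\<close> almost everywhere, so it is bounded by \<open>L\<close> almost everywhere and may be set to \<open>0\<close>
  at the other points.\<close>
lemma lipschitz_density:
  fixes u :: "real \<Rightarrow> 'a::euclidean_space"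
  assumes ab': "a < b" and L: "L \<ge> 0"
    and lip: "\<And>s t. s \<in> {a..b} \<Longrightarrow> t \<in> {a..b} \<Longrightarrow> norm (u s - u t) \<le> L * \<bar>s - t\<bar>"
  obtains d :: "real \<Rightarrow> 'a" where "d \<in> borel_measurable borel" "\<And>t. norm (d t) \<le> L"
    "\<And>t. t \<in> {a..b} \<Longrightarrow> integral {a..t} d = u t - u a"
    "AE t in lebesgue_on {a..b}. (u has_vector_derivative d t) (at t within {a..b})"
proof -
  have ab: "a \<le> b" using ab' by simp
  \<comment> \<open>\<open>u \<circ> c\<close> extends \<open>u\<close> to the whole line with the same Lipschitz constant.\<close>
  define c where "c t = max a (min b t)" for t :: real
  have c: "c t \<in> {a..b}" "t \<in> {a..b} \<Longrightarrow> c t = t" "\<bar>c s - c t\<bar> \<le> \<bar>s - t\<bar>" for s t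
    using ab by (auto simp: c_def)
  have "\<exists>d. d \<in> borel_measurable borel \<and> d absolutely_integrable_on {a..b} \<and>
      (\<forall>t\<in>{a..b}. integral {a..t} d = (u t - u a) \<bullet> i)" if i: "i \<in> Basis" for i
  proof -
    define U where "U t = u (c t) \<bullet> i + L * t" for t
    have l: "\<bar>u (c s) \<bullet> i - u (c t) \<bullet> i\<bar> \<le> L * \<bar>s - t\<bar>" for s t
    proof -
      have "\<bar>u (c s) \<bullet> i - u (c t) \<bullet> i\<bar> \<le> norm (u (c s) - u (c t))"
        using Basis_le_norm[OF i, of "u (c s) - u (c t)"] by (simp add: inner_diff_left)
      also have "\<dots> \<le> L * \<bar>c s - c t\<bar>" by (intro lip c)
      also have "\<dots> \<le> L * \<bar>s - t\<bar>" using c(3)[of s t] L by (intro mult_left_mono) auto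
      finally show ?thesis .
    qed
    obtain d where d: "d \<in> borel_measurable borel" "\<And>a b. a \<le> b \<Longrightarrow> d absolutely_integrable_on {a..b}"
      "\<And>a b. a \<le> b \<Longrightarrow> integral {a..b} d = U b - U a"
    proof (rule lipschitz_mono_density[of U "2 * L"])
      show "U x \<le> U y" if "x \<le> y" for x y
        using l[of y x] that by (simp add: U_def algebra_simps abs_if split: if_splits)
      show "\<bar>U x - U y\<bar> \<le> 2 * L * \<bar>x - y\<bar>" for x y
      proof -
        have "\<bar>U x - U y\<bar> \<le> \<bar>u (c x) \<bullet> i - u (c y) \<bullet> i\<bar> + \<bar>L * (x - y)\<bar>"
          unfolding U_def by (simp add: algebra_simps abs_if)
        also have "\<bar>L * (x - y)\<bar> = L * \<bar>x - y\<bar>" using L by (simp add: abs_mult)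
        finally show ?thesis using l[of x y] by simp
      qed
    qed (use L in auto)
    show ?thesis
    proof (intro exI conjI ballI)
      show "(\<lambda>t. d t - L) \<in> borel_measurable borel" using d(1) by measurable
      show "(\<lambda>t. d t - L) absolutely_integrable_on {a..b}"
        using d(2)[OF ab] by (intro set_integral_diff(1)) (auto intro: absolutely_integrable_on_const)
      fix t assume t: "t \<in> {a..b}"
      have "integral {a..t} (\<lambda>t. d t - L) = integral {a..t} d - integral {a..t} (\<lambda>t. L)"
        using d(2)[of a t] t by (intro Henstock_Kurzweil_Integration.integral_diff)
          (auto dest: set_lebesgue_integral_eq_integral(1))
      also have "\<dots> = (u t - u a) \<bullet> i"
        using d(3)[of a t] t ab c(2)[of t] c(2)[of a] by (simp add: U_def algebra_simps inner_diff_left)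
      finally show "integral {a..t} (\<lambda>t. d t - L) = (u t - u a) \<bullet> i" .
    qed
  qed
  then obtain di where di: "\<And>i. i \<in> Basis \<Longrightarrow> di i \<in> borel_measurable borel"
    "\<And>i. i \<in> Basis \<Longrightarrow> di i absolutely_integrable_on {a..b}"
    "\<And>i t. i \<in> Basis \<Longrightarrow> t \<in> {a..b} \<Longrightarrow> integral {a..t} (di i) = (u t - u a) \<bullet> i"
    by metis
  define D where "D t = (\<Sum>i\<in>Basis. di i t *\<^sub>R i)" for t
  have Db: "D \<in> borel_measurable borel" unfolding D_def using di(1) by measurable
  have Dai: "D absolutely_integrable_on {a..b}"
    unfolding D_def using di(2) 
    by (intro absolutely_integrable_sum set_integrable_scaleR_left) auto
  have Dhi: "integral {a..t} D = u t - u a" if t: "t \<in> {a..b}" for t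
  proof -
    have ii: "di i integrable_on {a..t}" if "i \<in> Basis" for i
      using set_lebesgue_integral_eq_integral(1)[OF di(2)[OF that]] t
      by (auto intro: integrable_on_subinterval)
    have "integral {a..t} D = (\<Sum>i\<in>Basis. integral {a..t} (\<lambda>s. di i s *\<^sub>R i))"
      unfolding D_def using ii by (intro integral_sum) (auto intro: integrable_on_scaleR_left)
    also have "\<dots> = (\<Sum>i\<in>Basis. ((u t - u a) \<bullet> i) *\<^sub>R i)"
    proof (rule sum.cong[OF refl])
      fix i :: 'a assume i: "i \<in> Basis"
      have "((\<lambda>s. di i s *\<^sub>R i) has_integral (integral {a..t} (di i)) *\<^sub>R i) {a..t}"
        using ii[OF i] by (intro has_integral_scaleR_left) (simp add: integrable_integral)
      then show "integral {a..t} (\<lambda>s. di i s *\<^sub>R i) = ((u t - u a) \<bullet> i) *\<^sub>R i"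
        using di(3)[OF i t] by (simp add: integral_unique)
    qed
    also have "\<dots> = u t - u a" by (rule euclidean_representation)
    finally show ?thesis .
  qed
  have AE1: "AE t in lebesgue_on {a..b}. (u has_vector_derivative D t) (at t within {a..b})"
  proof -
    have "AE t in lebesgue_on {a..b}.
      ((\<lambda>s. integral {a..s} D) has_vector_derivative D t) (at t within {a..b})"
      using Dai by (intro lebesgue_differentiation set_lebesgue_integral_eq_integral(1))
    moreover have "AE t in lebesgue_on {a..b}. t \<in> {a..b}"
      using AE_space[of "lebesgue_on {a..b}"] by simp
    ultimately show ?thesis
    proof eventually_elim
      case (elim t)
      have "((\<lambda>s. u a + integral {a..s} D) has_vector_derivative (0 + D t)) (at t within {a..b})"
        by (intro has_vector_derivative_add elim(1)) (rule has_vector_derivative_const)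
      then show ?case
        using elim(2) by (intro has_vector_derivative_transform[of t "{a..b}" u]) (auto simp: Dhi)
    qed
  qed
  have AE2: "AE t in lebesgue_on {a..b}. norm (D t) \<le> L"
  proof -
    have "AE t in lebesgue_on {a..b}. t \<in> {a..b}"
      using AE_space[of "lebesgue_on {a..b}"] by simp
    with AE1 show ?thesis
    proof eventually_elim
      case (elim t)
      show "norm (D t) \<le> L"
      proof (rule field_le_epsilon)
        fix e :: real assume e: "0 < e"
        from elim(1) obtain \<delta> where \<delta>: "\<delta> > 0"
          "\<And>y. y \<in> {a..b} \<Longrightarrow> norm (y - t) < \<delta> \<Longrightarrow> norm (u y - u t - (y - t) *\<^sub>R D t) \<le> e * norm (y - t)"
          unfolding has_vector_derivative_def has_derivative_within_alt using e by blast
        obtain y where y: "y \<in> {a..b}" "\<bar>y - t\<bar> < \<delta>" "y \<noteq> t"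
        proof (cases "t < b")
          case True
          then show ?thesis using \<delta>(1) elim(2) by (intro that[of "min b (t + \<delta> / 2)"]) auto
        next
          case False
          then show ?thesis using \<delta>(1) elim(2) ab' by (intro that[of "max a (t - \<delta> / 2)"]) auto
        qed
        have "norm ((y - t) *\<^sub>R D t) \<le> norm (u y - u t) + norm (u y - u t - (y - t) *\<^sub>R D t)"
          using norm_triangle_ineq4[of "u y - u t" "u y - u t - (y - t) *\<^sub>R D t"] by simp
        also have "\<dots> \<le> L * \<bar>y - t\<bar> + e * \<bar>y - t\<bar>"
          using \<delta>(2)[OF y(1)] y(2) lip[OF y(1) elim(2)] by (intro add_mono) auto
        finally have "\<bar>y - t\<bar> * norm (D t) \<le> \<bar>y - t\<bar> * (L + e)" unfolding norm_scaleR by (simp add: algebra_simps)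
        then show "norm (D t) \<le> L + e" using y(3) by simp
      qed
    qed
  qed
  define N where "N = {t \<in> {a..b}. norm (D t) > L}"
  have "N \<in> sets borel" unfolding N_def using Db by measurable
  then have Ns: "N \<in> sets lebesgue" by simp
  have "AE t in lebesgue. t \<notin> N"
    using AE2 by (simp add: AE_restrict_space_iff) (auto elim!: eventually_mono simp: N_def)
  then have neg: "negligible N"
    using AE_iff_null_sets[OF Ns] by (simp add: negligible_iff_null_sets)
  define d where "d t = (if norm (D t) \<le> L then D t else 0)" for t
  show ?thesis
  proof (rule that)
    show "d \<in> borel_measurable borel" unfolding d_def using Db by measurable
    show "norm (d t) \<le> L" for t using L by (simp add: d_def)
    show "integral {a..t} d = u t - u a" if t: "t \<in> {a..b}" for t
    proof -
      have "integral {a..t} d = integral {a..t} D"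
        by (rule integral_spike[OF neg]) (use t in \<open>auto simp: d_def N_def\<close>)
      then show ?thesis using Dhi[OF t] by simp
    qed
    show "AE t in lebesgue_on {a..b}. (u has_vector_derivative d t) (at t within {a..b})"
      using AE1 AE2 by eventually_elim (simp add: d_def)
  qed
qed

section \<open>Weak convergence of bounded functions\<close>

lemma abs_inner_le_mult:
  fixes x y :: "'a::real_inner"
  assumes "norm x \<le> A" "norm y \<le> L"
  shows "\<bar>x \<bullet> y\<bar> \<le> A * L"
proof -
  have "\<bar>x \<bullet> y\<bar> \<le> norm x * norm y" by (rule Cauchy_Schwarz_ineq2)
  also have "\<dots> \<le> A * L"
    using assms by (intro mult_mono) (auto intro: order_trans[OF norm_ge_zero])
  finally show ?thesis .
qed

lemma integrable_lebesgue_on_bounded: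
  fixes f :: "real \<Rightarrow> 'b::euclidean_space"
  assumes "f \<in> borel_measurable (lebesgue_on {a..b})" "\<And>t. t \<in> {a..b} \<Longrightarrow> norm (f t) \<le> B"
  shows "integrable (lebesgue_on {a..b}) f"
proof -
  interpret finite_measure "lebesgue_on {a..b}"
    by (rule finite_measure_lebesgue_on) simp
  show ?thesis
    using assms by (intro integrable_const_bound[of _ B]) auto
qed

lemma absolutely_integrable_iff_lebesgue_on:
  fixes f :: "real \<Rightarrow> 'b::euclidean_space"
  shows "f absolutely_integrable_on {a..b} \<longleftrightarrow> integrable (lebesgue_on {a..b}) f"
  by (simp add: integrable_restrict_space set_integrable_def)

lemma LINT_eq_integral:
  fixes f :: "real \<Rightarrow> 'b::euclidean_space"
  assumes "integrable (lebesgue_on {a..b}) f"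
  shows "(LINT t|lebesgue_on {a..b}. f t) = integral {a..b} f"
  by (rule lebesgue_integral_eq_integral[OF assms]) simp

lemma integrable_lebesgue_on_subinterval:
  fixes f :: "real \<Rightarrow> 'b::euclidean_space"
  assumes "integrable (lebesgue_on {a..b}) f" "a \<le> c" "d \<le> b"
  shows "integrable (lebesgue_on {c..d}) f"
  using absolutely_integrable_on_subinterval[where f=f and S="{a..b}" and a=c and b=d] assms
  by (simp add: absolutely_integrable_iff_lebesgue_on)

lemma integrable_on_if_integrable_lebesgue_on:
  fixes f :: "real \<Rightarrow> 'b::euclidean_space"
  assumes "integrable (lebesgue_on {a..b}) f" "a \<le> c" "d \<le> b"
  shows "f integrable_on {c..d}"
  using integrable_lebesgue_on_subinterval[OF assms]
  by (simp add: absolutely_integrable_iff_lebesgue_on[symmetric] set_lebesgue_integral_eq_integral(1))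

text \<open>On the cells of a fine partition \<open>\<zeta>\<close> is nearly constant, and there the integral of \<open>h n\<close> is a
  difference of two values of its indefinite integral, which tends to \<open>0\<close>.\<close>
lemma weak_convergence_continuous:
  fixes h :: "nat \<Rightarrow> real \<Rightarrow> 'a::euclidean_space"
  assumes ab: "a \<le> b"
    and hm: "\<And>n. h n \<in> borel_measurable (lebesgue_on {a..b})"
    and hL: "\<And>n t. t \<in> {a..b} \<Longrightarrow> norm (h n t) \<le> L"
    and prim: "\<And>t. t \<in> {a..b} \<Longrightarrow> (\<lambda>n. integral {a..t} (h n)) \<longlonglongrightarrow> 0"
    and \<zeta>: "continuous_on {a..b} \<zeta>"
  shows "(\<lambda>n. integral {a..b} (\<lambda>t. \<zeta> t \<bullet> h n t)) \<longlonglongrightarrow> 0"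
proof -
  have L: "L \<ge> 0" using hL[of a 0] ab by (meson atLeastAtMost_iff norm_ge_zero order_refl order_trans)
  obtain B where "\<forall>y\<in>\<zeta> ` {a..b}. norm y \<le> B"
    using compact_imp_bounded[OF compact_continuous_image[OF \<zeta> compact_Icc]] unfolding bounded_iff by blast
  then have B: "norm (\<zeta> t) \<le> B" if "t \<in> {a..b}" for t using that by blast
  have \<zeta>m: "\<zeta> \<in> borel_measurable (lebesgue_on {a..b})"
    using \<zeta> by (intro continuous_imp_measurable_on_sets_lebesgue) auto
  have \<zeta>h: "integrable (lebesgue_on {a..b}) (\<lambda>t. \<zeta> t \<bullet> h n t)" for n
  proof (rule integrable_lebesgue_on_bounded[where B="B * L"])
    fix t assume t: "t \<in> {a..b}"
    show "norm (\<zeta> t \<bullet> h n t) \<le> B * L"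
      using abs_inner_le_mult[OF B[OF t] hL[OF t]] by simp
  qed (use \<zeta>m hm in measurable)
  have \<zeta>hi: "(\<lambda>t. \<zeta> t \<bullet> h n t) integrable_on {c..d}" if "a \<le> c" "d \<le> b" for n c d
    by (rule integrable_on_if_integrable_lebesgue_on[OF \<zeta>h that])
  have hI: "integrable (lebesgue_on {a..b}) (h n)" for n
    using hm hL by (rule integrable_lebesgue_on_bounded)
  have hi: "h n integrable_on {c..d}" if "a \<le> c" "d \<le> b" for n c d
    by (rule integrable_on_if_integrable_lebesgue_on[OF hI that])
  have uc: "uniformly_continuous_on {a..b} \<zeta>"
    using \<zeta> by (intro compact_uniformly_continuous) auto
  have main: "\<forall>\<^sub>F n in sequentially. \<bar>integral {a..b} (\<lambda>t. \<zeta> t \<bullet> h n t)\<bar> \<le> e * (L * (b - a) + 1)"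
    if e: "e > 0" for e
  proof -
    obtain d where d: "d > 0" "\<And>s t. s \<in> {a..b} \<Longrightarrow> t \<in> {a..b} \<Longrightarrow> \<bar>s - t\<bar> < d \<Longrightarrow> norm (\<zeta> s - \<zeta> t) < e"
      using uc e unfolding uniformly_continuous_on_def dist_norm real_norm_def by metis
    obtain K :: nat where K: "(b - a) / d < real K" using reals_Archimedean2 by blast
    have K0: "K > 0" using K d(1) ab by (metis divide_nonneg_pos diff_ge_0_iff_ge gr0I not_less of_nat_0)
    define \<eta> where "\<eta> = (b - a) / real K"
    have \<eta>: "0 \<le> \<eta>" "\<eta> < d" "real K * \<eta> = b - a"
      using K K0 d(1) ab by (auto simp: \<eta>_def field_simps)
    \<comment> \<open>the error allowed per cell: variation of \<open>\<zeta>\<close> against \<open>h n\<close>, and \<open>\<zeta> p\<close> against the integral of \<open>h n\<close>\<close>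
    define c where "c = e * L * \<eta> + e / real K"
    have step: "k \<le> K \<Longrightarrow> \<forall>\<^sub>F n in sequentially.
        \<bar>integral {a..a + real k * \<eta>} (\<lambda>t. \<zeta> t \<bullet> h n t)\<bar> \<le> real k * c" for k
    proof (induction k)
      case (Suc k)
      define p q where "p = a + real k * \<eta>" and "q = a + real (Suc k) * \<eta>"
      have le: "real (Suc k) * \<eta> \<le> real K * \<eta>" using Suc.prems \<eta>(1) by (intro mult_right_mono) auto
      have pq: "a \<le> p" "p \<le> q" "q \<le> b" "q - p = \<eta>"
        using \<eta>(1,3) le by (auto simp: p_def q_def algebra_simps)
      have lim: "(\<lambda>n. \<zeta> p \<bullet> (integral {a..q} (h n) - integral {a..p} (h n))) \<longlonglongrightarrow> \<zeta> p \<bullet> (0 - 0)"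
        using pq by (intro tendsto_intros prim) auto
      then have ev: "\<forall>\<^sub>F n in sequentially. \<bar>\<zeta> p \<bullet> (integral {a..q} (h n) - integral {a..p} (h n))\<bar> < e / real K"
        using tendstoD[OF lim, of "e / real K"] e K0 by (simp add: dist_real_def)
      have IH: "\<forall>\<^sub>F n in sequentially. \<bar>integral {a..p} (\<lambda>t. \<zeta> t \<bullet> h n t)\<bar> \<le> real k * c"
        using Suc unfolding p_def by simp
      show ?case
        using ev IH
      proof eventually_elim
        case (elim n)
        have 1: "integral {a..q} (\<lambda>t. \<zeta> t \<bullet> h n t) = integral {a..p} (\<lambda>t. \<zeta> t \<bullet> h n t) + integral {p..q} (\<lambda>t. \<zeta> t \<bullet> h n t)"
          using pq \<zeta>hi by (intro Henstock_Kurzweil_Integration.integral_combine[symmetric]) auto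
        have 2: "integral {a..q} (h n) = integral {a..p} (h n) + integral {p..q} (h n)"
          using pq hi by (intro Henstock_Kurzweil_Integration.integral_combine[symmetric]) auto
        have hip: "(\<lambda>t. \<zeta> p \<bullet> h n t) integrable_on {p..q}"
          using hi[OF pq(1,3)] by (simp add: integrable_linear[OF _ bounded_linear_inner_right, unfolded o_def])
        have 3: "integral {p..q} (\<lambda>t. \<zeta> t \<bullet> h n t)
            = \<zeta> p \<bullet> integral {p..q} (h n) + integral {p..q} (\<lambda>t. \<zeta> t \<bullet> h n t - \<zeta> p \<bullet> h n t)"
          using \<zeta>hi[OF pq(1,3)] hip hi[OF pq(1,3)]
          by (subst Henstock_Kurzweil_Integration.integral_diff)
            (auto simp: integral_linear[OF _ bounded_linear_inner_right, unfolded o_def])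
        have 4: "\<bar>integral {p..q} (\<lambda>t. \<zeta> t \<bullet> h n t - \<zeta> p \<bullet> h n t)\<bar> \<le> e * L * \<eta>"
        proof -
          have "norm (integral (cbox p q) (\<lambda>t. \<zeta> t \<bullet> h n t - \<zeta> p \<bullet> h n t)) \<le> (e * L) * Henstock_Kurzweil_Integration.content (cbox p q)"
          proof (rule has_integral_bound)
            show "0 \<le> e * L" using e L by simp
            show "((\<lambda>t. \<zeta> t \<bullet> h n t - \<zeta> p \<bullet> h n t) has_integral
               integral (cbox p q) (\<lambda>t. \<zeta> t \<bullet> h n t - \<zeta> p \<bullet> h n t)) (cbox p q)"
              using \<zeta>hi[OF pq(1,3)] hip by (intro integrable_integral integrable_diff) auto
            fix t assume t: "t \<in> cbox p q"
            then have t': "t \<in> {a..b}" "p \<in> {a..b}" "\<bar>t - p\<bar> < d" using pq \<eta> by auto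
            show "norm (\<zeta> t \<bullet> h n t - \<zeta> p \<bullet> h n t) \<le> e * L"
              using abs_inner_le_mult[OF less_imp_le[OF d(2)[OF t']] hL[OF t'(1)]] by (simp add: inner_diff_left)
          qed
          then show ?thesis using pq by simp
        qed
        have "\<bar>integral {a..q} (\<lambda>t. \<zeta> t \<bullet> h n t)\<bar> \<le> real k * c + (e / real K + e * L * \<eta>)"
          using elim 1 2 3 4 by (simp add: inner_add_right)
        then show ?case unfolding q_def[symmetric] by (simp add: c_def algebra_simps add_divide_distrib)
      qed
    qed simp
    have "real K * c = e * (L * (real K * \<eta>) + 1)"
      using K0 by (simp add: c_def algebra_simps)
    then have "real K * c = e * (L * (b - a) + 1)" unfolding \<eta>(3) .
    then show ?thesis using step[of K] \<eta>(3) by (simp add: mult.commute)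
  qed
  show ?thesis
  proof (rule tendstoI)
    fix e :: real assume e: "0 < e"
    let ?c = "L * (b - a) + 1"
    have c: "?c > 0" using L ab by (simp add: add_nonneg_pos)
    have "\<forall>\<^sub>F n in sequentially. \<bar>integral {a..b} (\<lambda>t. \<zeta> t \<bullet> h n t)\<bar> \<le> e / 2 / ?c * ?c"
      using e c by (intro main) simp
    moreover have "e / 2 / ?c * ?c = e / 2" by (rule nonzero_eq_divide_eq[THEN iffD1]) (use c in auto)
    ultimately have "\<forall>\<^sub>F n in sequentially. \<bar>integral {a..b} (\<lambda>t. \<zeta> t \<bullet> h n t)\<bar> \<le> e / 2" by metis
    then show "\<forall>\<^sub>F n in sequentially. dist (integral {a..b} (\<lambda>t. \<zeta> t \<bullet> h n t)) 0 < e"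
      by eventually_elim (use e in auto)
  qed
qed

text \<open>A bounded measurable \<open>\<zeta>\<close> is the limit in \<open>L\<^sup>1\<close> of continuous functions: it is the limit almost
  everywhere of continuous functions, which the nearest point projection \<open>P\<close> onto the ball of radius
  \<open>B\<close> turns into a dominated sequence.\<close>
lemma weak_convergence_bounded:
  fixes h :: "nat \<Rightarrow> real \<Rightarrow> 'a::euclidean_space"
  assumes ab: "a \<le> b"
    and hm: "\<And>n. h n \<in> borel_measurable (lebesgue_on {a..b})"
    and hL: "\<And>n t. t \<in> {a..b} \<Longrightarrow> norm (h n t) \<le> L"
    and prim: "\<And>t. t \<in> {a..b} \<Longrightarrow> (\<lambda>n. integral {a..t} (h n)) \<longlonglongrightarrow> 0"
    and \<zeta>m: "\<zeta> \<in> borel_measurable (lebesgue_on {a..b})"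
    and \<zeta>B: "\<And>t. t \<in> {a..b} \<Longrightarrow> norm (\<zeta> t) \<le> B"
  shows "(\<lambda>n. LINT t|lebesgue_on {a..b}. \<zeta> t \<bullet> h n t) \<longlonglongrightarrow> 0"
proof -
  let ?M = "lebesgue_on {a..b}"
  have L: "L \<ge> 0" using hL[of a 0] ab by (meson atLeastAtMost_iff norm_ge_zero order_refl order_trans)
  have B: "B \<ge> 0" using \<zeta>B[of a] ab by (meson atLeastAtMost_iff norm_ge_zero order_refl order_trans)
  have "\<zeta> measurable_on {a..b}"
    using \<zeta>m by (simp add: measurable_on_iff_borel_measurable)
  then obtain N g where N: "negligible N" and g: "\<And>n. continuous_on UNIV (g n)"
    and gl: "\<And>x. x \<notin> N \<Longrightarrow> (\<lambda>n. g n x) \<longlonglongrightarrow> (if x \<in> {a..b} then \<zeta> x else 0)"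
    unfolding measurable_on_def by blast
  define P where "P = closest_point (cball (0::'a) B)"
  have Pc: "continuous_on UNIV P" unfolding P_def
    using B by (intro continuous_on_closest_point) auto
  have PB: "norm (P y) \<le> B" for y
    using closest_point_in_set[of "cball (0::'a) B" y] B by (simp add: P_def)
  define g' where "g' n t = P (g n t)" for n t
  have g'c: "continuous_on {a..b} (g' n)" for n
    unfolding g'_def using continuous_on_compose2[OF Pc g] by (auto intro: continuous_on_subset)
  have g'm: "g' n \<in> borel_measurable ?M" for n
    using g'c by (intro continuous_imp_measurable_on_sets_lebesgue) auto
  have g'l: "AE t in ?M. (\<lambda>n. g' n t) \<longlonglongrightarrow> \<zeta> t"
  proof (rule AE_lebesgue_on_if_negligible[OF N])
    fix t assume t: "t \<in> {a..b}" "t \<notin> N"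
    have "(\<lambda>n. P (g n t)) \<longlonglongrightarrow> P (\<zeta> t)"
      using gl[OF t(2)] t(1) Pc by (intro continuous_on_tendsto_compose[of UNIV P]) auto
    moreover have "P (\<zeta> t) = \<zeta> t" unfolding P_def
      using \<zeta>B[OF t(1)] by (intro closest_point_self) simp
    ultimately show "(\<lambda>n. g' n t) \<longlonglongrightarrow> \<zeta> t" by (simp add: g'_def)
  qed simp
  have "(\<lambda>k. LINT t|?M. norm (\<zeta> t - g' k t)) \<longlonglongrightarrow> (LINT t|?M. (0::real))"
  proof (rule integral_dominated_convergence[where w="\<lambda>_. 2 * B"])
    show "integrable ?M (\<lambda>_. 2 * B)" by (rule integrable_lebesgue_on_bounded[of _ _ _ "2 * B"]) (use B in auto)
    show "AE t in ?M. (\<lambda>k. norm (\<zeta> t - g' k t)) \<longlonglongrightarrow> 0"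
      using g'l by eventually_elim (auto intro!: tendsto_eq_intros)
    show "AE t in ?M. norm (norm (\<zeta> t - g' k t)) \<le> 2 * B" for k
    proof (rule AE_I2)
      fix t assume "t \<in> space ?M"
      then have "norm (\<zeta> t) \<le> B" using \<zeta>B by simp
      moreover have "norm (g' k t) \<le> B" using PB by (simp add: g'_def)
      ultimately show "norm (norm (\<zeta> t - g' k t)) \<le> 2 * B"
        using norm_triangle_ineq4[of "\<zeta> t" "g' k t"] by simp
    qed
  qed (use \<zeta>m g'm in measurable)
  then have lim0: "(\<lambda>k. LINT t|?M. norm (\<zeta> t - g' k t)) \<longlonglongrightarrow> 0" by simp
  show ?thesis
  proof (rule tendstoI)
    fix e :: real assume e: "0 < e"
    have "\<forall>\<^sub>F k in sequentially. dist (LINT t|?M. norm (\<zeta> t - g' k t)) 0 < e / (2 * (L + 1))"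
      using tendstoD[OF lim0] e L by simp
    then obtain k where k0: "\<bar>LINT t|?M. norm (\<zeta> t - g' k t)\<bar> < e / (2 * (L + 1))"
      by (auto simp: eventually_sequentially)
    then have k: "L * (LINT t|?M. norm (\<zeta> t - g' k t)) \<le> e / 2"
    proof -
      have "L * (LINT t|?M. norm (\<zeta> t - g' k t)) \<le> L * (e / (2 * (L + 1)))"
        using k0 L by (intro mult_left_mono) auto
      also have "\<dots> \<le> e / 2" using e L by (simp add: field_simps)
      finally show ?thesis .
    qed
    have ib: "integrable ?M (\<lambda>t. p t \<bullet> h n t)" if "p \<in> borel_measurable ?M" "\<And>t. t \<in> {a..b} \<Longrightarrow> norm (p t) \<le> C" for p n C
    proof (rule integrable_lebesgue_on_bounded[where B="C * L"])
      fix t assume t: "t \<in> {a..b}"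
      show "norm (p t \<bullet> h n t) \<le> C * L"
        using abs_inner_le_mult[OF that(2)[OF t] hL[OF t]] by simp
    qed (use that hm in measurable)
    have g'i: "integrable ?M (\<lambda>t. g' k t \<bullet> h n t)" for n using PB by (intro ib g'm) (simp add: g'_def)
    have "(\<lambda>n. integral {a..b} (\<lambda>t. g' k t \<bullet> h n t)) \<longlonglongrightarrow> 0"
      by (rule weak_convergence_continuous[OF ab hm hL prim g'c])
    then have "\<forall>\<^sub>F n in sequentially. \<bar>integral {a..b} (\<lambda>t. g' k t \<bullet> h n t)\<bar> < e / 2"
      using e by (auto dest: tendstoD[of _ _ _ "e / 2"] simp: dist_real_def)
    then show "\<forall>\<^sub>F n in sequentially. dist (LINT t|?M. \<zeta> t \<bullet> h n t) 0 < e"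
    proof eventually_elim
      case (elim n)
      have zi: "integrable ?M (\<lambda>t. \<zeta> t \<bullet> h n t)" using \<zeta>m \<zeta>B by (rule ib)
      have ni: "integrable ?M (\<lambda>t. norm (\<zeta> t - g' k t))"
        by (intro integrable_norm Bochner_Integration.integrable_diff
            integrable_lebesgue_on_bounded[where B=B] \<zeta>m g'm \<zeta>B) (auto simp: g'_def PB)
      have "(LINT t|?M. \<zeta> t \<bullet> h n t) - (LINT t|?M. g' k t \<bullet> h n t) = (LINT t|?M. (\<zeta> t - g' k t) \<bullet> h n t)"
        unfolding inner_diff_left by (rule Bochner_Integration.integral_diff[OF zi g'i, symmetric])
      also have "\<bar>\<dots>\<bar> \<le> (LINT t|?M. L * norm (\<zeta> t - g' k t))"
      proof (rule integral_abs_bound_integral)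
        show "integrable ?M (\<lambda>t. (\<zeta> t - g' k t) \<bullet> h n t)" using zi g'i by (simp add: inner_diff_left)
        show "integrable ?M (\<lambda>t. L * norm (\<zeta> t - g' k t))" using ni by simp
        fix t assume "t \<in> space ?M"
        then have t: "t \<in> {a..b}" by simp
        have "\<bar>(\<zeta> t - g' k t) \<bullet> h n t\<bar> \<le> norm (\<zeta> t - g' k t) * norm (h n t)" by (rule Cauchy_Schwarz_ineq2)
        also have "\<dots> \<le> norm (\<zeta> t - g' k t) * L" by (intro mult_left_mono hL t) simp
        finally show "\<bar>(\<zeta> t - g' k t) \<bullet> h n t\<bar> \<le> L * norm (\<zeta> t - g' k t)" by (simp add: mult.commute)
      qed
      also have "\<dots> \<le> e / 2" using k by simp
      finally show ?case using elim LINT_eq_integral[OF g'i, of n] unfolding dist_real_def by linarith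
    qed
  qed
qed

section \<open>Critical points in finitely many variables\<close>

text \<open>The space of \<open>m\<close>-tuples, realised as sequences that vanish from index \<open>m\<close> on, because \<open>m\<close> is a number
  that will tend to infinity. The topology is that of pointwise convergence.\<close>
definition supported_below :: "nat \<Rightarrow> (nat \<Rightarrow> 'a::zero) set" where
  "supported_below m = {x. \<forall>i\<ge>m. x i = 0}"

lemma compact_supported_below_bounded:
  "compact {x \<in> supported_below m. \<forall>i<m. norm (x i :: 'a::euclidean_space) \<le> r}"
proof -
  let ?S = "\<lambda>i. if i < m then cball (0::'a) r else {0}"
  have "compactin (product_topology (\<lambda>i. euclidean) UNIV) (PiE UNIV ?S)"
    by (subst compactin_PiE) auto
  then have "compact (PiE UNIV ?S)"
    by (simp add: euclidean_product_topology compactin_euclidean_iff)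
  moreover have "PiE UNIV ?S = {x \<in> supported_below m. \<forall>i<m. norm (x i) \<le> r}"
  proof (rule set_eqI)
    fix x :: "nat \<Rightarrow> 'a"
    have "x \<in> PiE UNIV ?S \<longleftrightarrow> (\<forall>i. (i < m \<longrightarrow> norm (x i) \<le> r) \<and> (\<not> i < m \<longrightarrow> x i = 0))"
      unfolding PiE_UNIV_domain Pi_def by simp
    then show "x \<in> PiE UNIV ?S \<longleftrightarrow> x \<in> {x \<in> supported_below m. \<forall>i<m. norm (x i) \<le> r}"
      unfolding supported_below_def mem_Collect_eq not_less by blast
  qed
  ultimately show ?thesis by simp
qed

lemma continuous_on_line:
  fixes x d :: "nat \<Rightarrow> 'a::real_normed_vector"
  shows "continuous_on UNIV (\<lambda>s. (\<lambda>i. x i + s *\<^sub>R d i))"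
  by (intro continuous_on_coordinatewise_then_product continuous_intros)

text \<open>A continuously differentiable function of the coordinates below \<open>m\<close>. Differentiability is expressed
  by derivatives along lines, as the space of all sequences carries no norm.\<close>
locale gradient_system =
  fixes m :: nat and J :: "(nat \<Rightarrow> 'a::euclidean_space) \<Rightarrow> real" and g :: "(nat \<Rightarrow> 'a) \<Rightarrow> nat \<Rightarrow> 'a"
  assumes J_cont: "continuous_on UNIV J"
    and g_cont: "\<And>i. i < m \<Longrightarrow> continuous_on UNIV (\<lambda>x. g x i)"
    and J_deriv0: "\<And>x d. ((\<lambda>s. J (\<lambda>i. x i + s *\<^sub>R d i)) has_real_derivative (\<Sum>i<m. g x i \<bullet> d i)) (at 0)"
begin

lemma J_deriv:
  "((\<lambda>s. J (\<lambda>i. x i + s *\<^sub>R d i)) has_real_derivative (\<Sum>i<m. g (\<lambda>i. x i + s *\<^sub>R d i) i \<bullet> d i)) (at s)"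
proof -
  have "(\<lambda>h. J (\<lambda>i. (x i + s *\<^sub>R d i) + h *\<^sub>R d i)) = (\<lambda>h. J (\<lambda>i. x i + (h + s) *\<^sub>R d i))"
    by (simp add: algebra_simps)
  then have "((\<lambda>h. J (\<lambda>i. x i + (h + s) *\<^sub>R d i)) has_real_derivative
      (\<Sum>i<m. g (\<lambda>i. x i + s *\<^sub>R d i) i \<bullet> d i)) (at 0)"
    using J_deriv0[of "\<lambda>i. x i + s *\<^sub>R d i" d] by simp
  then show ?thesis
    using DERIV_shift[of "\<lambda>s. J (\<lambda>i. x i + s *\<^sub>R d i)" _ 0 s] by simp
qed

definition sq_grad :: "(nat \<Rightarrow> 'a) \<Rightarrow> real" where "sq_grad x = (\<Sum>i<m. (norm (g x i))\<^sup>2)"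

lemma sq_grad_cont: "continuous_on UNIV sq_grad"
  unfolding sq_grad_def using g_cont by (intro continuous_intros) auto

text \<open>A minimum point of \<open>J\<close> on the compact set \<open>R x \<le> \<rho>\<close> is not on its boundary \<open>R x = \<rho>\<close>, where \<open>J\<close> exceeds
  its value at \<open>0\<close>; so the derivative along the gradient vanishes there.\<close>
lemma critical_point_below:
  fixes R :: "(nat \<Rightarrow> 'a) \<Rightarrow> real"
  assumes R: "continuous_on UNIV R" "R (\<lambda>_. 0) < \<rho>"
    and bdd: "\<And>x i. x \<in> supported_below m \<Longrightarrow> R x \<le> \<rho> \<Longrightarrow> i < m \<Longrightarrow> norm (x i) \<le> r"
    and barrier: "\<And>x. x \<in> supported_below m \<Longrightarrow> R x = \<rho> \<Longrightarrow> J x \<ge> \<alpha>"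
    and low: "J (\<lambda>_. 0) < \<alpha>"
  obtains x where "x \<in> supported_below m" "\<And>i. i < m \<Longrightarrow> g x i = 0" "J x \<le> J (\<lambda>_. 0)"
proof -
  let ?X = "supported_below m :: (nat \<Rightarrow> 'a) set"
  define K where "K = {x \<in> ?X. R x \<le> \<rho>}"
  have "closed {x. R x \<le> \<rho>}" by (intro closed_Collect_le R continuous_on_const)
  then have "compact ({x \<in> ?X. \<forall>i<m. norm (x i) \<le> r} \<inter> {x. R x \<le> \<rho>})"
    by (intro compact_Int_closed compact_supported_below_bounded)
  moreover have "{x \<in> ?X. \<forall>i<m. norm (x i) \<le> r} \<inter> {x. R x \<le> \<rho>} = K"
    using bdd by (auto simp: K_def)
  ultimately have "compact K" by simp
  moreover have K0: "(\<lambda>_. 0) \<in> K" using R(2) by (simp add: K_def supported_below_def)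
  ultimately obtain x where x: "x \<in> K" "\<And>y. y \<in> K \<Longrightarrow> J x \<le> J y"
    using continuous_attains_inf[of K J] continuous_on_subset[OF J_cont, of K] by auto
  have J0: "J x \<le> J (\<lambda>_. 0)" using x(2) K0 by blast
  have xX: "x \<in> ?X" and Rx: "R x < \<rho>"
    using x(1) barrier[of x] J0 low by (auto simp: K_def intro!: le_neq_trans)
  define d where "d i = (if i < m then g x i else 0)" for i
  have dX: "(\<lambda>i. x i + s *\<^sub>R d i) \<in> ?X" for s
    using xX by (auto simp: supported_below_def d_def)
  have "continuous_on UNIV (\<lambda>s. R (\<lambda>i. x i + s *\<^sub>R d i))"
    using continuous_on_compose2[OF R(1) continuous_on_line] by auto
  then have "isCont (\<lambda>s. R (\<lambda>i. x i + s *\<^sub>R d i)) 0"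
    by (simp add: continuous_on_eq_continuous_at)
  then have "((\<lambda>s. R (\<lambda>i. x i + s *\<^sub>R d i)) \<longlongrightarrow> R x) (at 0)" by (simp add: isCont_def)
  then have "\<forall>\<^sub>F s in at 0. R (\<lambda>i. x i + s *\<^sub>R d i) < \<rho>"
    using Rx by (rule order_tendstoD(2))
  then obtain \<delta> where \<delta>: "\<delta> > 0" "\<And>s. s \<noteq> 0 \<Longrightarrow> \<bar>s\<bar> < \<delta> \<Longrightarrow> R (\<lambda>i. x i + s *\<^sub>R d i) < \<rho>"
    unfolding eventually_at by (auto simp: dist_real_def)
  have "(\<Sum>i<m. g x i \<bullet> d i) = 0"
  proof (rule DERIV_local_min[OF J_deriv0 \<delta>(1)])
    show "\<forall>s. \<bar>0 - s\<bar> < \<delta> \<longrightarrow> J (\<lambda>i. x i + 0 *\<^sub>R d i) \<le> J (\<lambda>i. x i + s *\<^sub>R d i)"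
    proof (intro allI impI)
      fix s :: real assume "\<bar>0 - s\<bar> < \<delta>"
      then have "R (\<lambda>i. x i + s *\<^sub>R d i) \<le> \<rho>" using \<delta>(2)[of s] Rx by (cases "s = 0") auto
      then show "J (\<lambda>i. x i + 0 *\<^sub>R d i) \<le> J (\<lambda>i. x i + s *\<^sub>R d i)"
        using x(2) dX by (simp add: K_def)
    qed
  qed
  then have "(\<Sum>i<m. (norm (g x i))\<^sup>2) = 0" by (simp add: d_def power2_norm_eq_inner)
  then have "g x i = 0" if "i < m" for i
    using that by (subst (asm) sum_nonneg_eq_0_iff) auto
  then show ?thesis using that xX J0 by blast
qed

text \<open>By the mean value theorem the decrease is \<open>s\<close> times the product of \<open>g x\<close> with the gradient at a
  point between. If that gradient differs from \<open>g x\<close> by at most half the length of \<open>g x\<close>, the product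
  is at least half of \<open>sq_grad x\<close>.\<close>
lemma descent_step:
  assumes near: "\<And>z. 0 \<le> z \<Longrightarrow> z \<le> s \<Longrightarrow>
      (\<Sum>i<m. (norm (g (\<lambda>i. x i - z *\<^sub>R (if i < m then g x i else 0)) i - g x i))\<^sup>2) \<le> sq_grad x / 4"
    and s: "0 \<le> s"
  shows "J (\<lambda>i. x i - s *\<^sub>R (if i < m then g x i else 0)) \<le> J x - s * sq_grad x / 2"
proof (cases "s = 0")
  case False
  then have s0: "0 < s" using s by simp
  define d where "d i = - (if i < m then g x i else 0)" for i
  have eq: "(\<lambda>i. x i - z *\<^sub>R (if i < m then g x i else 0)) = (\<lambda>i. x i + z *\<^sub>R d i)" for z
    by (auto simp: d_def)
  let ?f = "\<lambda>z. J (\<lambda>i. x i + z *\<^sub>R d i)"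
  obtain z where z: "0 < z" "z < s" "?f s - ?f 0 = (s - 0) * (\<Sum>i<m. g (\<lambda>i. x i + z *\<^sub>R d i) i \<bullet> d i)"
    using MVT2[OF s0, of ?f "\<lambda>z. (\<Sum>i<m. g (\<lambda>i. x i + z *\<^sub>R d i) i \<bullet> d i)"] J_deriv by blast
  let ?D = "\<lambda>i. g (\<lambda>i. x i + z *\<^sub>R d i) i - g x i"
  have "(\<Sum>i<m. g (\<lambda>i. x i + z *\<^sub>R d i) i \<bullet> d i) \<le> (\<Sum>i<m. (norm (?D i))\<^sup>2 + (norm (g x i))\<^sup>2 / 4 - (norm (g x i))\<^sup>2)"
  proof (rule sum_mono)
    fix i assume "i \<in> {..<m}"
    then have "g (\<lambda>i. x i + z *\<^sub>R d i) i \<bullet> d i = - (?D i \<bullet> g x i) - (norm (g x i))\<^sup>2"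
      by (simp add: d_def inner_diff_left power2_norm_eq_inner)
    moreover have "- (?D i \<bullet> g x i) \<le> norm (?D i) * norm (g x i)"
      using Cauchy_Schwarz_ineq2[of "?D i" "g x i"] by linarith
    moreover have "norm (?D i) * norm (g x i) \<le> (norm (?D i))\<^sup>2 + (norm (g x i))\<^sup>2 / 4"
      using zero_le_power2[of "norm (?D i) - norm (g x i) / 2"]
      by (simp add: power2_diff power_divide)
    ultimately show "g (\<lambda>i. x i + z *\<^sub>R d i) i \<bullet> d i \<le> (norm (?D i))\<^sup>2 + (norm (g x i))\<^sup>2 / 4 - (norm (g x i))\<^sup>2"
      by linarith
  qed
  also have "\<dots> = (\<Sum>i<m. (norm (?D i))\<^sup>2) + sq_grad x / 4 - sq_grad x"
    by (simp only: sq_grad_def sum.distrib sum_subtractf sum_divide_distrib)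
  also have "\<dots> \<le> - sq_grad x / 2"
    using near[of z] z unfolding eq by simp
  finally have "?f s - ?f 0 \<le> s * (- sq_grad x / 2)"
    unfolding z(3) using s by (simp only: diff_zero) (rule mult_left_mono)
  then show ?thesis unfolding eq by simp
qed simp

text \<open>Without a critical point between the levels \<open>c\<close> and \<open>B\<close>, the squared gradient has a positive lower
  bound \<open>\<mu>\<close> there: by \<open>PS\<close> the points with small gradient lie in a compact set. Let \<open>\<eta>\<close> make a gradient
  step of fixed length parameter, switched off continuously below the level \<open>\<alpha>\<close> so that points at level
  at most \<open>c\<close> stay fixed. A step that moves a coordinate by a distance \<open>l\<close> lowers \<open>J\<close> by at least \<open>l * sqrt \<mu> / 2\<close>;
  so iterating \<open>\<eta>\<close> never leaves a bounded set, and this is why one step length serves all iterations.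
  Finitely many iterations push the segment from \<open>0\<close> to \<open>e\<close> below the level \<open>\<alpha>\<close>, although its image
  still joins \<open>0\<close> to \<open>e\<close> and must cross the barrier \<open>R x = \<rho>\<close>.\<close>
lemma mountain_pass:
  fixes R :: "(nat \<Rightarrow> 'a) \<Rightarrow> real"
  assumes R: "continuous_on UNIV R" "R (\<lambda>_. 0) < \<rho>" "R e > \<rho>"
    and e: "e \<in> supported_below m"
    and barrier: "\<And>x. x \<in> supported_below m \<Longrightarrow> R x = \<rho> \<Longrightarrow> J x \<ge> \<alpha>"
    and low: "J (\<lambda>_. 0) \<le> c" "J e \<le> c" "c < \<alpha>"
    and seg: "\<And>s. 0 \<le> s \<Longrightarrow> s \<le> 1 \<Longrightarrow> J (\<lambda>i. s *\<^sub>R e i) \<le> B"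
    and PS: "\<And>x i. x \<in> supported_below m \<Longrightarrow> c \<le> J x \<Longrightarrow> J x \<le> B \<Longrightarrow>
       (\<And>i. i < m \<Longrightarrow> norm (g x i) \<le> \<mu>\<^sub>0) \<Longrightarrow> i < m \<Longrightarrow> norm (x i) \<le> r"
    and \<mu>\<^sub>0: "\<mu>\<^sub>0 > 0"
  obtains x where "x \<in> supported_below m" "\<And>i. i < m \<Longrightarrow> g x i = 0" "c \<le> J x" "J x \<le> B"
proof (rule ccontr)
  note found = that
  assume no: "\<not> thesis"
  have nc: "\<exists>i<m. g x i \<noteq> 0" if "x \<in> supported_below m" "c \<le> J x" "J x \<le> B" for x
  proof (rule ccontr)
    assume "\<not> (\<exists>i<m. g x i \<noteq> 0)"
    then have "g x i = 0" if "i < m" for i using that by blast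
    then show False using no found[OF \<open>x \<in> supported_below m\<close> _ \<open>c \<le> J x\<close> \<open>J x \<le> B\<close>] by blast
  qed
  let ?X = "supported_below m :: (nat \<Rightarrow> 'a) set"
  have sq_grad_pos: "sq_grad x > 0" if x: "x \<in> ?X" "c \<le> J x" "J x \<le> B" for x
  proof -
    obtain i where i: "i < m" "g x i \<noteq> 0" using nc[OF x] by blast
    have "(norm (g x i))\<^sup>2 \<le> sq_grad x" unfolding sq_grad_def using i(1) by (intro member_le_sum) auto
    moreover have "(norm (g x i))\<^sup>2 > 0" using i(2) by simp
    ultimately show ?thesis by linarith
  qed
  have "\<exists>\<mu>>0. \<forall>x\<in>?X. c \<le> J x \<longrightarrow> J x \<le> B \<longrightarrow> sq_grad x \<ge> \<mu>"
  proof -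
    define K0 where "K0 = {x \<in> ?X. \<forall>i<m. norm (x i) \<le> r} \<inter> {x. c \<le> J x} \<inter> {x. J x \<le> B}"
    have "compact K0" unfolding K0_def
      by (intro compact_Int_closed compact_supported_below_bounded closed_Collect_le J_cont continuous_on_const)
    have "\<exists>\<mu>1>0. \<forall>x\<in>K0. sq_grad x \<ge> \<mu>1"
    proof (cases "K0 = {}")
      case False
      then obtain y where y: "y \<in> K0" "\<And>x. x \<in> K0 \<Longrightarrow> sq_grad y \<le> sq_grad x"
        using continuous_attains_inf[OF \<open>compact K0\<close>, of sq_grad] continuous_on_subset[OF sq_grad_cont, of K0] by auto
      then show ?thesis using sq_grad_pos[of y] by (auto simp: K0_def)
    qed (auto intro: exI[of _ 1])
    then obtain \<mu>1 where \<mu>1: "\<mu>1 > 0" "\<And>x. x \<in> K0 \<Longrightarrow> sq_grad x \<ge> \<mu>1" by blast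
    have "sq_grad x \<ge> min \<mu>1 (\<mu>\<^sub>0\<^sup>2)" if x: "x \<in> ?X" "c \<le> J x" "J x \<le> B" for x
    proof (cases "\<forall>i<m. norm (g x i) \<le> \<mu>\<^sub>0")
      case True
      then have "x \<in> K0" using PS[OF x] x by (auto simp: K0_def)
      then show ?thesis using \<mu>1(2)[of x] by simp
    next
      case False
      then obtain i where i: "i < m" "norm (g x i) > \<mu>\<^sub>0" by auto
      have "(norm (g x i))\<^sup>2 \<le> sq_grad x" unfolding sq_grad_def using i(1) by (intro member_le_sum) auto
      moreover have "(norm (g x i))\<^sup>2 \<ge> \<mu>\<^sub>0\<^sup>2" using i(2) \<mu>\<^sub>0 by (intro power_mono) auto
      ultimately show ?thesis by simp
    qed
    then show ?thesis using \<mu>1(1) \<mu>\<^sub>0 by (intro exI[of _ "min \<mu>1 (\<mu>\<^sub>0\<^sup>2)"]) auto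
  qed
  then obtain \<mu> where \<mu>: "\<mu> > 0" "\<And>x. x \<in> ?X \<Longrightarrow> c \<le> J x \<Longrightarrow> J x \<le> B \<Longrightarrow> sq_grad x \<ge> \<mu>" by blast
  define r0 where "r0 = (\<Sum>i<m. norm (e i))"
  have r0: "norm (e i) \<le> r0" if "i < m" for i unfolding r0_def using that by (intro member_le_sum) auto
  \<comment> \<open>\<open>K\<close> contains every point that the iteration can reach above level \<open>c\<close>.\<close>
  define r1 where "r1 = r0 + 2 / sqrt \<mu> * (B - c)"
  define K where "K = {x \<in> ?X. \<forall>i<m. norm (x i) \<le> r1}"
  have "compact K" unfolding K_def by (rule compact_supported_below_bounded)
  let ?step = "\<lambda>x s i. x i - s *\<^sub>R (if i < m then g x i else 0)"
  \<comment> \<open>how much the gradient changes along a gradient step; continuity of \<open>\<Psi>\<close> yields the step length \<open>\<delta>\<close>\<close>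
  define \<Psi> where "\<Psi> p = (\<Sum>i<m. (norm (g (?step (snd p) (fst p)) i - g (snd p) i))\<^sup>2)" for p :: "real \<times> (nat \<Rightarrow> 'a)"
  have step_cont: "continuous_on UNIV (\<lambda>p::real \<times> (nat \<Rightarrow> 'a). ?step (snd p) (fst p))"
  proof (rule continuous_on_coordinatewise_then_product)
    fix i
    have coord: "continuous_on UNIV (\<lambda>p::real \<times> (nat \<Rightarrow> 'a). snd p i)"
      by (rule continuous_on_compose2[OF continuous_on_product_coordinates[of i]]) (auto intro: continuous_intros)
    show "continuous_on UNIV (\<lambda>p::real \<times> (nat \<Rightarrow> 'a). ?step (snd p) (fst p) i)"
    proof (cases "i < m")
      case True
      have "continuous_on UNIV (\<lambda>p::real \<times> (nat \<Rightarrow> 'a). g (snd p) i)"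
        by (rule continuous_on_compose2[OF g_cont[OF True]]) (auto intro: continuous_intros)
      then show ?thesis using True coord by (auto intro!: continuous_intros)
    qed (use coord in simp)
  qed
  have "continuous_on UNIV \<Psi>"
  proof -
    have "continuous_on UNIV (\<lambda>p::real \<times> (nat \<Rightarrow> 'a). g (?step (snd p) (fst p)) i)" if "i < m" for i
      by (rule continuous_on_compose2[OF g_cont[OF that] step_cont]) auto
    moreover have "continuous_on UNIV (\<lambda>p::real \<times> (nat \<Rightarrow> 'a). g (snd p) i)" if "i < m" for i
      by (rule continuous_on_compose2[OF g_cont[OF that]]) (auto intro: continuous_intros)
    ultimately show ?thesis unfolding \<Psi>_def by (intro continuous_intros) auto
  qed
  then have "uniformly_continuous_on ({0..1} \<times> K) \<Psi>"
    using \<open>compact K\<close> by (intro compact_uniformly_continuous compact_Times) (auto intro: continuous_on_subset)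
  then obtain \<delta>' where \<delta>': "\<delta>' > 0" "\<And>p q. p \<in> {0..1} \<times> K \<Longrightarrow> q \<in> {0..1} \<times> K \<Longrightarrow> dist q p < \<delta>' \<Longrightarrow> dist (\<Psi> q) (\<Psi> p) < \<mu> / 4"
    unfolding uniformly_continuous_on_def using \<mu>(1) by (metis zero_less_divide_iff zero_less_numeral)
  define \<delta> where "\<delta> = min 1 (\<delta>' / 2)"
  have \<delta>: "0 < \<delta>" "\<delta> \<le> 1" "\<delta> < \<delta>'" using \<delta>'(1) by (auto simp: \<delta>_def)
  have near: "\<Psi> (z, x) \<le> \<mu> / 4" if "x \<in> K" "0 \<le> z" "z \<le> \<delta>" for x z
  proof -
    have "dist (\<Psi> (z, x)) (\<Psi> (0, x)) < \<mu> / 4"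
      using that \<delta> by (intro \<delta>'(2)) (auto simp: dist_Pair_Pair)
    moreover have "\<Psi> (0, x) = 0" by (simp add: \<Psi>_def)
    ultimately show ?thesis by (simp add: dist_real_def)
  qed
  define cut where "cut j = max 0 (min 1 ((j - c) / (\<alpha> - c)))" for j
  have cut: "0 \<le> cut j" "cut j \<le> 1" "j \<le> c \<Longrightarrow> cut j = 0" "\<alpha> \<le> j \<Longrightarrow> cut j = 1" for j
    using low(3) by (auto simp: cut_def field_simps max_def min_def)
  define \<eta> where "\<eta> x = ?step x (\<delta> * cut (J x))" for x
  have cut_cont: "continuous_on UNIV cut"
    unfolding cut_def using low(3) by (intro continuous_intros) auto
  have \<eta>_cont: "continuous_on UNIV \<eta>"
  proof -
    have "continuous_on UNIV (\<lambda>x. (\<delta> * cut (J x), x))"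
      by (intro continuous_intros continuous_on_compose2[OF cut_cont J_cont]) auto
    from continuous_on_compose2[OF step_cont this] show ?thesis by (simp only: \<eta>_def[abs_def] fst_conv snd_conv subset_UNIV simp_thms)
  qed
  have \<eta>_fix: "\<eta> x = x" if "J x \<le> c" for x using cut(3)[OF that] by (simp add: \<eta>_def)
  \<comment> \<open>The invariant of the iteration: the distance travelled is paid for by the drop of \<open>J\<close>.\<close>
  define good where "good x \<longleftrightarrow> x \<in> ?X \<and> J x \<le> B \<and> (J x > c \<longrightarrow> (\<forall>i<m. norm (x i) \<le> r0 + 2 / sqrt \<mu> * (B - J x)))" for x
  have step: "good (\<eta> x) \<and> J (\<eta> x) \<le> J x \<and> (\<alpha> \<le> J x \<longrightarrow> J (\<eta> x) \<le> J x - \<delta> * \<mu> / 2)" if gx: "good x" for x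
  proof (cases "J x \<le> c")
    case True
    then show ?thesis using \<eta>_fix[OF True] gx low(3) by auto
  next
    case False
    then have Jx: "c < J x" "J x \<le> B" "x \<in> ?X" "\<And>i. i < m \<Longrightarrow> norm (x i) \<le> r0 + 2 / sqrt \<mu> * (B - J x)"
      using gx by (auto simp: good_def)
    have "r0 + 2 / sqrt \<mu> * (B - J x) \<le> r1"
      unfolding r1_def using Jx(1) \<mu>(1) by (intro add_left_mono mult_left_mono) auto
    then have xK: "x \<in> K" using Jx(3,4) by (fastforce simp: K_def)
    have g\<mu>: "sq_grad x \<ge> \<mu>" using Jx \<mu>(2) by simp
    define s where "s = \<delta> * cut (J x)"
    have s: "0 \<le> s" "s \<le> \<delta>" using cut(1,2)[of "J x"] \<delta> by (auto simp: s_def mult_left_le)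
    have dec: "J (\<eta> x) \<le> J x - s * sq_grad x / 2"
      unfolding \<eta>_def s_def[symmetric]
    proof (rule descent_step[OF _ s(1)])
      fix z assume z: "0 \<le> z" "z \<le> s"
      have "\<Psi> (z, x) \<le> sq_grad x / 4" using near[OF xK z(1)] z(2) s(2) g\<mu> by simp
      then show "(\<Sum>i<m. (norm (g (?step x z) i - g x i))\<^sup>2) \<le> sq_grad x / 4" unfolding \<Psi>_def fst_conv snd_conv .
    qed
    have "s * sq_grad x / 2 \<ge> 0" using s g\<mu> \<mu>(1) by simp
    then have le: "J (\<eta> x) \<le> J x" using dec by simp
    have X: "\<eta> x \<in> ?X" using Jx(3) by (auto simp: supported_below_def \<eta>_def)
    have move: "norm (\<eta> x i) \<le> r0 + 2 / sqrt \<mu> * (B - J (\<eta> x))" if i: "i < m" for i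
    proof -
      have sq: "sqrt \<mu> > 0" using \<mu>(1) by simp
      have "(norm (g x i))\<^sup>2 \<le> sq_grad x" unfolding sq_grad_def using i by (intro member_le_sum) auto
      then have "norm (g x i) \<le> sqrt (sq_grad x)" by (simp add: real_le_rsqrt)
      moreover have "sqrt \<mu> * sqrt (sq_grad x) \<le> sqrt (sq_grad x) * sqrt (sq_grad x)"
        using g\<mu> \<mu>(1) by (intro mult_right_mono) auto
      moreover have "sqrt (sq_grad x) * sqrt (sq_grad x) = sq_grad x" using g\<mu> \<mu>(1) by simp
      ultimately have "sqrt \<mu> * norm (g x i) \<le> sq_grad x"
        using mult_left_mono[of "norm (g x i)" "sqrt (sq_grad x)" "sqrt \<mu>"] sq by linarith
      from mult_left_mono[OF this s(1)] have "s * (sqrt \<mu> * norm (g x i)) \<le> 2 * (J x - J (\<eta> x))"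
        using dec by argo
      then have "s * norm (g x i) \<le> 2 / sqrt \<mu> * (J x - J (\<eta> x))"
        using sq by (simp add: field_simps)
      moreover have "norm (\<eta> x i) \<le> norm (x i) + s * norm (g x i)"
        using norm_triangle_ineq4[of "x i" "s *\<^sub>R g x i"] i s(1) by (simp add: \<eta>_def s_def)
      moreover have "2 / sqrt \<mu> * (B - J x) + 2 / sqrt \<mu> * (J x - J (\<eta> x)) = 2 / sqrt \<mu> * (B - J (\<eta> x))"
        by (simp only: distrib_left[symmetric]) simp
      ultimately show ?thesis using Jx(4)[OF i] by linarith
    qed
    have "J (\<eta> x) \<le> J x - \<delta> * \<mu> / 2" if "\<alpha> \<le> J x"
    proof -
      have "s = \<delta>" using cut(4)[OF that] by (simp add: s_def)
      moreover have "\<delta> * \<mu> \<le> \<delta> * sq_grad x" using g\<mu> \<delta>(1) by (intro mult_left_mono) auto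
      ultimately show ?thesis using dec by simp
    qed
    then show ?thesis using X le Jx(2) move by (auto simp: good_def)
  qed
  define \<gamma> where "\<gamma> s = (\<lambda>i. s *\<^sub>R e i)" for s :: real
  have iter: "good ((\<eta> ^^ k) (\<gamma> s)) \<and> (J ((\<eta> ^^ k) (\<gamma> s)) < \<alpha> \<or> J ((\<eta> ^^ k) (\<gamma> s)) \<le> B - real k * (\<delta> * \<mu> / 2))"
    if s: "0 \<le> s" "s \<le> 1" for k s
  proof (induction k)
    case 0
    have "norm (\<gamma> s i) \<le> r0 + 2 / sqrt \<mu> * (B - J (\<gamma> s))" if "i < m" for i
    proof -
      have "norm (\<gamma> s i) \<le> norm (e i)" using s by (simp add: \<gamma>_def mult_left_le_one_le)
      moreover have "0 \<le> 2 / sqrt \<mu> * (B - J (\<gamma> s))" using seg[OF s] \<mu>(1) by (simp add: \<gamma>_def)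
      ultimately show ?thesis using r0[OF that] by linarith
    qed
    moreover have "\<gamma> s \<in> ?X" using e by (auto simp: supported_below_def \<gamma>_def)
    ultimately show ?case using seg[OF s] by (auto simp: good_def \<gamma>_def)
  next
    case (Suc k)
    let ?y = "(\<eta> ^^ k) (\<gamma> s)"
    have st: "good (\<eta> ?y)" "J (\<eta> ?y) \<le> J ?y" "\<alpha> \<le> J ?y \<longrightarrow> J (\<eta> ?y) \<le> J ?y - \<delta> * \<mu> / 2"
      using step[of ?y] Suc by blast+
    have "B - real (Suc k) * (\<delta> * \<mu> / 2) = B - real k * (\<delta> * \<mu> / 2) - \<delta> * \<mu> / 2"
      by (simp add: algebra_simps add_divide_distrib)
    then have "J (\<eta> ?y) < \<alpha> \<or> J (\<eta> ?y) \<le> B - real (Suc k) * (\<delta> * \<mu> / 2)"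
      using st(2,3) Suc by linarith
    then show ?case using st(1) by simp
  qed
  \<comment> \<open>Above level \<open>\<alpha>\<close> each step lowers \<open>J\<close> by \<open>\<delta> * \<mu> / 2\<close>, so \<open>k\<close> steps bring the whole segment below it.\<close>
  obtain k :: nat where "(B - \<alpha>) / (\<delta> * \<mu> / 2) < real k" using reals_Archimedean2 by blast
  then have k: "B - real k * (\<delta> * \<mu> / 2) < \<alpha>" using \<delta>(1) \<mu>(1) by (simp add: field_simps)
  have \<eta>k_cont: "continuous_on UNIV (\<eta> ^^ k)"
    by (induction k) (auto intro: continuous_on_compose2[OF \<eta>_cont] simp: id_def comp_def)
  have \<gamma>_cont: "continuous_on UNIV \<gamma>" unfolding \<gamma>_def
    by (intro continuous_on_coordinatewise_then_product continuous_intros)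
  have cont: "continuous_on {0..1} (\<lambda>s. R ((\<eta> ^^ k) (\<gamma> s)))"
    by (rule continuous_on_subset[of UNIV], intro continuous_on_compose2[OF R(1)] continuous_on_compose2[OF \<eta>k_cont] \<gamma>_cont) auto
  have fix0: "(\<eta> ^^ k) x = x" if "J x \<le> c" for x using \<eta>_fix[OF that] by (induction k) auto
  have "\<gamma> 0 = (\<lambda>_. 0)" "\<gamma> 1 = e" by (auto simp: \<gamma>_def)
  then have "R ((\<eta> ^^ k) (\<gamma> 0)) < \<rho>" "R ((\<eta> ^^ k) (\<gamma> 1)) > \<rho>"
    using fix0 low R by auto
  then obtain s where s: "0 \<le> s" "s \<le> 1" "R ((\<eta> ^^ k) (\<gamma> s)) = \<rho>"
    using IVT'[OF _ _ _ cont, of \<rho>] by auto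
  have "(\<eta> ^^ k) (\<gamma> s) \<in> ?X" using iter[OF s(1,2), of k] by (simp add: good_def)
  from barrier[OF this s(3)] have "\<alpha> \<le> J ((\<eta> ^^ k) (\<gamma> s))" .
  then show False using iter[OF s(1,2), of k] k by linarith
qed

end

section \<open>Convex Lagrangians and weakly convergent velocities\<close>

lemma GDERIV_line:
  fixes \<phi> :: "'a::real_inner \<Rightarrow> real"
  assumes "GDERIV \<phi> (x + s *\<^sub>R e) :> D"
  shows "((\<lambda>z. \<phi> (x + z *\<^sub>R e)) has_real_derivative D \<bullet> e) (at s)"
proof -
  have "((\<lambda>z. x + z *\<^sub>R e) has_derivative (\<lambda>h. h *\<^sub>R e)) (at s)"
    by (auto intro!: derivative_eq_intros)
  from diff_chain_at[OF this assms[unfolded gderiv_def]]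
  have "((\<lambda>z. \<phi> (x + z *\<^sub>R e)) has_derivative (\<lambda>h. (h *\<^sub>R e) \<bullet> D)) (at s)"
    unfolding o_def .
  moreover have "(\<lambda>h. (h *\<^sub>R e) \<bullet> D) = (*) (D \<bullet> e)" by (auto simp: inner_commute)
  ultimately show ?thesis by (simp add: has_field_derivative_def)
qed

lemma convex_above_tangent_GDERIV:
  fixes \<phi> :: "'a::real_inner \<Rightarrow> real"
  assumes conv: "convex_on UNIV \<phi>" and D: "GDERIV \<phi> v :> D"
  shows "\<phi> w \<ge> \<phi> v + D \<bullet> (w - v)"
proof -
  let ?g = "\<lambda>s. \<phi> (v + s *\<^sub>R (w - v))"
  have "convex_on UNIV ?g"
  proof (rule convex_onI)
    fix t x y :: real assume t: "0 < t" "t < 1"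
    have "v + ((1 - t) *\<^sub>R x + t *\<^sub>R y) *\<^sub>R (w - v)
        = (1 - t) *\<^sub>R (v + x *\<^sub>R (w - v)) + t *\<^sub>R (v + y *\<^sub>R (w - v))"
      by (simp add: algebra_simps)
    then show "?g ((1 - t) *\<^sub>R x + t *\<^sub>R y) \<le> (1 - t) * ?g x + t * ?g y"
      using convex_onD[OF conv, of t] t by simp
  qed simp
  moreover have "(?g has_real_derivative D \<bullet> (w - v)) (at 0)"
    using D by (intro GDERIV_line) simp
  ultimately have "?g 1 - ?g 0 \<ge> D \<bullet> (w - v) * (1 - 0)"
    by (intro convex_on_imp_above_tangent[where A=UNIV]) auto
  then show ?thesis by simp
qed

lemma subgradient_eq_GDERIV:
  fixes \<phi> :: "'a::euclidean_space \<Rightarrow> real"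
  assumes D: "GDERIV \<phi> v :> D" and sub: "\<And>\<xi>. \<phi> \<xi> \<ge> \<phi> v + w \<bullet> (\<xi> - v)"
  shows "w = D"
proof (rule euclidean_eqI)
  fix e :: 'a assume "e \<in> Basis"
  have "((\<lambda>s. \<phi> (v + s *\<^sub>R e) - s * (w \<bullet> e)) has_real_derivative D \<bullet> e - w \<bullet> e) (at 0)"
    using D by (auto intro!: derivative_eq_intros GDERIV_line)
  moreover have "\<forall>y. \<bar>0 - y\<bar> < 1 \<longrightarrow> \<phi> (v + 0 *\<^sub>R e) - 0 * (w \<bullet> e) \<le> \<phi> (v + y *\<^sub>R e) - y * (w \<bullet> e)"
  proof (intro allI impI)
    fix y :: real
    show "\<phi> (v + 0 *\<^sub>R e) - 0 * (w \<bullet> e) \<le> \<phi> (v + y *\<^sub>R e) - y * (w \<bullet> e)"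
      using sub[of "v + y *\<^sub>R e"] by simp
  qed
  ultimately have "D \<bullet> e - w \<bullet> e = 0"
    by (rule DERIV_local_min[OF _ zero_less_one])
  then show "w \<bullet> e = D \<bullet> e" by simp
qed

lemma bounded_convergence_lebesgue_on:
  fixes h :: "nat \<Rightarrow> real \<Rightarrow> 'b::euclidean_space"
  assumes "\<And>n. h n \<in> borel_measurable (lebesgue_on {a..b})" "h' \<in> borel_measurable (lebesgue_on {a..b})"
    and B: "\<And>n t. t \<in> {a..b} \<Longrightarrow> norm (h n t) \<le> B"
    and lim: "AE t in lebesgue_on {a..b}. (\<lambda>n. h n t) \<longlonglongrightarrow> h' t"
  shows "(\<lambda>n. LINT t|lebesgue_on {a..b}. h n t) \<longlonglongrightarrow> (LINT t|lebesgue_on {a..b}. h' t)"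
proof (rule integral_dominated_convergence[where w="\<lambda>_. \<bar>B\<bar>"])
  show "integrable (lebesgue_on {a..b}) (\<lambda>_. \<bar>B\<bar>)"
    by (rule integrable_lebesgue_on_bounded[where B="\<bar>B\<bar>"]) auto
  show "AE t in lebesgue_on {a..b}. norm (h n t) \<le> \<bar>B\<bar>" for n
    using B[of _ n] by (intro AE_I2) (fastforce intro: order_trans)
qed (use assms in auto)

text \<open>The functions are defined for all times, so that continuity and differentiability at the ends of
  \<open>{-T..T}\<close> need no separate treatment. The forcing term \<open>f\<close> is kept apart from \<open>V\<close> because it is
  only integrable in time.\<close>
locale lagrangian =
  fixes T :: real and F :: "real \<Rightarrow> 'a::euclidean_space \<Rightarrow> 'a \<Rightarrow> real"
    and Fx Fv :: "real \<Rightarrow> 'a \<Rightarrow> 'a \<Rightarrow> 'a"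
    and V :: "real \<Rightarrow> 'a \<Rightarrow> real" and Vx :: "real \<Rightarrow> 'a \<Rightarrow> 'a" and f :: "real \<Rightarrow> 'a"
  assumes T_pos: "T > 0"
    and F_cont: "continuous_on UNIV (\<lambda>(t, x, v). F t x v)"
    and Fx_cont: "continuous_on UNIV (\<lambda>(t, x, v). Fx t x v)"
    and Fv_cont: "continuous_on UNIV (\<lambda>(t, x, v). Fv t x v)"
    and V_cont: "continuous_on UNIV (\<lambda>(t, x). V t x)"
    and Vx_cont: "continuous_on UNIV (\<lambda>(t, x). Vx t x)"
    and Fx: "GDERIV (\<lambda>y. F t y v) x :> Fx t x v"
    and Fv: "GDERIV (F t x) v :> Fv t x v"
    and Vx: "GDERIV (V t) x :> Vx t x"
    and F_convex: "convex_on UNIV (F t x)"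
    and f_int: "integrable (lebesgue_on {-T..T}) f"
begin

abbreviation "M \<equiv> lebesgue_on {-T..T}"

lemma id_meas: "(\<lambda>t. t) \<in> borel_measurable M"
  by (intro measurable_restrict_space1 measurable_completion) simp

lemma F_tangent: "F t x w \<ge> F t x v + Fv t x v \<bullet> (w - v)"
  by (rule convex_above_tangent_GDERIV[OF F_convex Fv])

lemma bounded_on_box:
  fixes \<phi> :: "real \<Rightarrow> 'a \<Rightarrow> 'a \<Rightarrow> 'b::real_normed_vector"
  assumes "continuous_on UNIV (\<lambda>(t, x, v). \<phi> t x v)"
  obtains B where "B \<ge> 0" "\<And>t x v. \<bar>t\<bar> \<le> T \<Longrightarrow> norm x \<le> r \<Longrightarrow> norm v \<le> L \<Longrightarrow> norm (\<phi> t x v) \<le> B"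
proof -
  let ?K = "{-T..T} \<times> cball (0::'a) r \<times> cball (0::'a) L"
  have "compact ((\<lambda>(t, x, v). \<phi> t x v) ` ?K)"
    using assms by (intro compact_continuous_image compact_Times) (auto intro: continuous_on_subset)
  then have "bounded ((\<lambda>(t, x, v). \<phi> t x v) ` ?K)" by (rule compact_imp_bounded)
  then obtain B where B: "\<forall>y\<in>(\<lambda>(t, x, v). \<phi> t x v) ` ?K. norm y \<le> B" unfolding bounded_iff by blast
  have "norm (\<phi> t x v) \<le> \<bar>B\<bar>" if "\<bar>t\<bar> \<le> T" "norm x \<le> r" "norm v \<le> L" for t x v
  proof -
    have "(t, x, v) \<in> ?K" using that by auto
    then have "norm (\<phi> t x v) \<le> B" using B by force
    then show ?thesis by linarith
  qed
  then show ?thesis using that[of "\<bar>B\<bar>"] by auto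
qed

lemma uniformly_continuous_on_box:
  fixes \<phi> :: "real \<Rightarrow> 'a \<Rightarrow> 'a \<Rightarrow> 'b::real_normed_vector"
  assumes "continuous_on UNIV (\<lambda>(t, x, v). \<phi> t x v)"
  shows "uniformly_continuous_on ({-T..T} \<times> cball 0 r \<times> cball 0 L) (\<lambda>(t, x, v). \<phi> t x v)"
  using assms by (intro compact_uniformly_continuous compact_Times) (auto intro: continuous_on_subset)

text \<open>By uniform continuity on a compact box the convergence is uniform in the last argument; therefore \<open>v\<close>
  may oscillate.\<close>
lemma tendsto_diff_joint:
  fixes \<phi> :: "real \<Rightarrow> 'a \<Rightarrow> 'a \<Rightarrow> 'b::real_normed_vector"
  assumes \<phi>: "continuous_on UNIV (\<lambda>(t, x, v). \<phi> t x v)"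
    and b: "\<And>n. \<bar>s n\<bar> \<le> T" "\<And>n. norm (x n) \<le> r" "\<And>n. norm (v n) \<le> L"
    and lim: "s \<longlonglongrightarrow> t" "x \<longlonglongrightarrow> y"
  shows "(\<lambda>n. \<phi> (s n) (x n) (v n) - \<phi> t y (v n)) \<longlonglongrightarrow> 0"
proof -
  let ?K = "{-T..T} \<times> cball (0::'a) r \<times> cball (0::'a) L"
  have t: "\<bar>t\<bar> \<le> T" using b(1) tendsto_rabs[OF lim(1)] by (intro LIMSEQ_le_const2) auto
  have y: "norm y \<le> r" using b(2) tendsto_norm[OF lim(2)] by (intro LIMSEQ_le_const2) auto
  have "(\<lambda>n. dist (s n, x n, v n) (t, y, v n)) \<longlonglongrightarrow> 0"
  proof -
    have "(\<lambda>n. dist (s n, x n, v n) (t, y, v n)) = (\<lambda>n. sqrt ((dist (s n) t)\<^sup>2 + (dist (x n) y)\<^sup>2))"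
      by (simp add: dist_Pair_Pair)
    moreover have "(\<lambda>n. sqrt ((dist (s n) t)\<^sup>2 + (dist (x n) y)\<^sup>2)) \<longlonglongrightarrow> sqrt ((dist t t)\<^sup>2 + (dist y y)\<^sup>2)"
      by (intro tendsto_intros lim)
    ultimately show ?thesis by simp
  qed
  then have "(\<lambda>n. dist (\<phi> (s n) (x n) (v n)) (\<phi> t y (v n))) \<longlonglongrightarrow> 0"
  proof -
    have "(s n, x n, v n) \<in> ?K" "(t, y, v n) \<in> ?K" for n
      using b(1,2,3)[of n] t y by auto
    with \<open>(\<lambda>n. dist (s n, x n, v n) (t, y, v n)) \<longlonglongrightarrow> 0\<close> show ?thesis
      using uniformly_continuous_on_box[OF \<phi>, of r L, unfolded uniformly_continuous_on_sequentially,
        rule_format, of "\<lambda>n. (s n, x n, v n)" "\<lambda>n. (t, y, v n)"] by simp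
  qed
  then show ?thesis by (simp add: dist_norm tendsto_norm_zero_iff)
qed

lemma measurable_joint:
  fixes \<phi> :: "real \<Rightarrow> 'a \<Rightarrow> 'a \<Rightarrow> 'b::topological_space"
  assumes \<phi>: "continuous_on UNIV (\<lambda>(t, x, v). \<phi> t x v)"
    and "s \<in> borel_measurable N" "x \<in> borel_measurable N" "v \<in> borel_measurable N"
  shows "(\<lambda>t. \<phi> (s t) (x t) (v t)) \<in> borel_measurable N"
proof -
  have "(\<lambda>t. (s t, x t, v t)) \<in> borel_measurable N"
    using assms(2-4) by (intro borel_measurable_Pair)
  from borel_measurable_continuous_on[OF \<phi> this] show ?thesis by simp
qed

lemma V_cont3: "continuous_on UNIV (\<lambda>(t, x, v::'a). V t x)"
  using continuous_on_compose2[OF V_cont, of UNIV "\<lambda>p::real \<times> 'a \<times> 'a. (fst p, fst (snd p))"]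
  by (simp add: case_prod_beta' continuous_intros)

lemma Vx_cont3: "continuous_on UNIV (\<lambda>(t, x, v::'a). Vx t x)"
  using continuous_on_compose2[OF Vx_cont, of UNIV "\<lambda>p::real \<times> 'a \<times> 'a. (fst p, fst (snd p))"]
  by (simp add: case_prod_beta' continuous_intros)

end

text \<open>Here \<open>\<sigma> n t\<close> is a sample time near \<open>t\<close>, and \<open>X n\<close>, \<open>v n\<close> are approximate positions and velocities,
  possibly discontinuous. The velocities converge to \<open>d\<close> only weakly, through their indefinite
  integrals, but the momenta converge almost everywhere to some \<open>w\<close>.\<close>
locale converging_approximation = lagrangian T F Fx Fv V Vx f
  for T F Fx Fv V Vx and f :: "real \<Rightarrow> 'a::euclidean_space" +
  fixes \<sigma> :: "nat \<Rightarrow> real \<Rightarrow> real" and X v :: "nat \<Rightarrow> real \<Rightarrow> 'a" and u d w :: "real \<Rightarrow> 'a" and r L :: real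
  assumes \<sigma>_meas: "\<And>n. \<sigma> n \<in> borel_measurable M"
    and X_meas: "\<And>n. X n \<in> borel_measurable M"
    and v_meas: "\<And>n. v n \<in> borel_measurable M"
    and u_meas: "u \<in> borel_measurable M" and d_meas: "d \<in> borel_measurable M" and w_meas: "w \<in> borel_measurable M"
    and \<sigma>_bound: "\<And>n t. t \<in> {-T..T} \<Longrightarrow> \<bar>\<sigma> n t\<bar> \<le> T"
    and X_bound: "\<And>n t. t \<in> {-T..T} \<Longrightarrow> norm (X n t) \<le> r"
    and v_bound: "\<And>n t. t \<in> {-T..T} \<Longrightarrow> norm (v n t) \<le> L"
    and d_bound: "\<And>t. t \<in> {-T..T} \<Longrightarrow> norm (d t) \<le> L"
    and \<sigma>_lim: "\<And>t. t \<in> {-T..T} \<Longrightarrow> (\<lambda>n. \<sigma> n t) \<longlonglongrightarrow> t"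
    and X_lim: "\<And>t. t \<in> {-T..T} \<Longrightarrow> (\<lambda>n. X n t) \<longlonglongrightarrow> u t"
    and v_lim: "\<And>t. t \<in> {-T..T} \<Longrightarrow> (\<lambda>n. integral {-T..t} (\<lambda>s. v n s - d s)) \<longlonglongrightarrow> 0"
    and w_bounded: "\<exists>B. \<forall>t\<in>{-T..T}. norm (w t) \<le> B"
    and w_lim: "AE t in M. (\<lambda>n. Fv (\<sigma> n t) (X n t) (v n t)) \<longlonglongrightarrow> w t"
begin

lemma u_bound: "t \<in> {-T..T} \<Longrightarrow> norm (u t) \<le> r"
  using X_lim[of t] X_bound[of t] by (intro LIMSEQ_le_const2[OF tendsto_norm]) auto

lemma joint_replace:
  fixes \<phi> :: "real \<Rightarrow> 'a \<Rightarrow> 'a \<Rightarrow> 'b::euclidean_space"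
  assumes \<phi>: "continuous_on UNIV (\<lambda>(t, x, v). \<phi> t x v)" and t: "t \<in> {-T..T}"
  shows "(\<lambda>n. \<phi> (\<sigma> n t) (X n t) (v n t) - \<phi> t (u t) (v n t)) \<longlonglongrightarrow> 0"
  using \<sigma>_bound[OF t] X_bound[OF t] v_bound[OF t] \<sigma>_lim[OF t] X_lim[OF t]
  by (intro tendsto_diff_joint[OF \<phi>])

lemma joint_replace_integral:
  fixes \<phi> :: "real \<Rightarrow> 'a \<Rightarrow> 'a \<Rightarrow> 'b::euclidean_space"
  assumes \<phi>: "continuous_on UNIV (\<lambda>(t, x, v). \<phi> t x v)"
    and A: "A \<in> sets M"
  shows "(\<lambda>n. LINT t|M. indicator A t *\<^sub>R (\<phi> (\<sigma> n t) (X n t) (v n t) - \<phi> t (u t) (v n t))) \<longlonglongrightarrow> 0"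
proof -
  obtain B where B: "B \<ge> 0" "\<And>t x v. \<bar>t\<bar> \<le> T \<Longrightarrow> norm x \<le> r \<Longrightarrow> norm v \<le> L \<Longrightarrow> norm (\<phi> t x v) \<le> B"
    using bounded_on_box[OF \<phi>] by blast
  have "(\<lambda>n. LINT t|M. indicator A t *\<^sub>R (\<phi> (\<sigma> n t) (X n t) (v n t) - \<phi> t (u t) (v n t))) \<longlonglongrightarrow> (LINT t|M. (0::'b))"
  proof (rule bounded_convergence_lebesgue_on[where B="B + B"])
    fix n
    have "(\<lambda>t. \<phi> (\<sigma> n t) (X n t) (v n t)) \<in> borel_measurable M" "(\<lambda>t. \<phi> t (u t) (v n t)) \<in> borel_measurable M"
      using \<sigma>_meas X_meas v_meas u_meas id_meas by (auto intro!: measurable_joint[OF \<phi>])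
    then show "(\<lambda>t. indicator A t *\<^sub>R (\<phi> (\<sigma> n t) (X n t) (v n t) - \<phi> t (u t) (v n t))) \<in> borel_measurable M"
      using A by measurable
    fix t assume t: "t \<in> {-T..T}"
    have "norm (\<phi> (\<sigma> n t) (X n t) (v n t)) \<le> B" using \<sigma>_bound[OF t] X_bound[OF t] v_bound[OF t] by (intro B)
    moreover have "norm (\<phi> t (u t) (v n t)) \<le> B" using t u_bound[OF t] v_bound[OF t] by (intro B) auto
    ultimately have "norm (\<phi> (\<sigma> n t) (X n t) (v n t) - \<phi> t (u t) (v n t)) \<le> B + B"
      using norm_triangle_ineq4[of "\<phi> (\<sigma> n t) (X n t) (v n t)" "\<phi> t (u t) (v n t)"] by linarith
    then show "norm (indicator A t *\<^sub>R (\<phi> (\<sigma> n t) (X n t) (v n t) - \<phi> t (u t) (v n t))) \<le> B + B"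
      using B(1) by (auto simp: indicator_def)
  next
    show "AE t in M. (\<lambda>n. indicator A t *\<^sub>R (\<phi> (\<sigma> n t) (X n t) (v n t) - \<phi> t (u t) (v n t))) \<longlonglongrightarrow> 0"
      using tendsto_scaleR[OF tendsto_const joint_replace[OF \<phi>]] by (intro AE_I2) auto
  qed simp
  then show ?thesis by simp
qed

lemma momentum_at_limit_position: "AE t in M. (\<lambda>n. Fv t (u t) (v n t)) \<longlonglongrightarrow> w t"
proof -
  have "AE t in M. t \<in> {-T..T}" using AE_space[of M] by simp
  with w_lim show ?thesis
  proof eventually_elim
    case (elim t)
    from tendsto_diff[OF elim(1) joint_replace[OF Fv_cont elim(2)]] show ?case by simp
  qed
qed

lemma velocity_weak_limit:
  assumes "\<zeta> \<in> borel_measurable M" "\<And>t. t \<in> {-T..T} \<Longrightarrow> norm (\<zeta> t) \<le> B"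
  shows "(\<lambda>n. LINT t|M. \<zeta> t \<bullet> (v n t - d t)) \<longlonglongrightarrow> 0"
proof (rule weak_convergence_bounded[where L="L + L"])
  show "norm (v n t - d t) \<le> L + L" if "t \<in> {-T..T}" for n t
    using norm_triangle_ineq4[of "v n t" "d t"] v_bound[OF that, of n] d_bound[OF that] by linarith
qed (use assms v_meas d_meas v_lim T_pos in auto)

lemma integrable_box:
  fixes \<phi> :: "real \<Rightarrow> 'a \<Rightarrow> 'a \<Rightarrow> 'b::euclidean_space"
  assumes \<phi>: "continuous_on UNIV (\<lambda>(t, x, v). \<phi> t x v)"
    and "s \<in> borel_measurable M" "x \<in> borel_measurable M" "y \<in> borel_measurable M"
    and "\<And>t. t \<in> {-T..T} \<Longrightarrow> \<bar>s t\<bar> \<le> T" "\<And>t. t \<in> {-T..T} \<Longrightarrow> norm (x t) \<le> r'" "\<And>t. t \<in> {-T..T} \<Longrightarrow> norm (y t) \<le> L"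
  shows "integrable M (\<lambda>t. \<phi> (s t) (x t) (y t))"
proof -
  obtain B where B: "B \<ge> 0" "\<And>t x v. \<bar>t\<bar> \<le> T \<Longrightarrow> norm x \<le> r' \<Longrightarrow> norm v \<le> L \<Longrightarrow> norm (\<phi> t x v) \<le> B"
    using bounded_on_box[OF \<phi>] by blast
  show ?thesis
  proof (rule integrable_lebesgue_on_bounded[where B=B])
    show "(\<lambda>t. \<phi> (s t) (x t) (y t)) \<in> borel_measurable M" by (rule measurable_joint[OF assms(1-4)])
  qed (rule B(2)[OF assms(5-7)])
qed

text \<open>The gap in the tangent inequality for \<open>F t (u t)\<close> between \<open>v n t\<close> and \<open>d t\<close>.\<close>
definition excess where "excess n t = F t (u t) (d t) - F t (u t) (v n t) - Fv t (u t) (v n t) \<bullet> (d t - v n t)"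

lemma excess_nonneg: "excess n t \<ge> 0"
  using F_tangent[of t "u t" "v n t" "d t"] by (simp add: excess_def)

lemma F_integrable: "integrable M (\<lambda>t. F t (u t) (v n t))" "integrable M (\<lambda>t. F t (u t) (d t))"
proof -
  have "\<bar>t\<bar> \<le> T" if "t \<in> {-T..T}" for t using that by auto
  then show "integrable M (\<lambda>t. F t (u t) (v n t))" "integrable M (\<lambda>t. F t (u t) (d t))"
    using integrable_box[OF F_cont id_meas u_meas v_meas _ u_bound v_bound]
      integrable_box[OF F_cont id_meas u_meas d_meas _ u_bound d_bound] by auto
qed

text \<open>The momenta converge almost everywhere and boundedly, the velocities weakly; so the product of the
  limit \<open>w\<close> with \<open>d - v n\<close> vanishes in the limit, and replacing \<open>w\<close> by the momenta costs nothing.\<close>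
lemma momentum_pairing_limit:
  assumes A: "A \<in> sets M"
  shows "(\<lambda>n. LINT t|M. indicator A t * (Fv t (u t) (v n t) \<bullet> (d t - v n t))) \<longlonglongrightarrow> 0"
    and "integrable M (\<lambda>t. Fv t (u t) (v n t) \<bullet> (d t - v n t))"
proof -
  obtain B where B: "B \<ge> 0" "\<And>t x v. \<bar>t\<bar> \<le> T \<Longrightarrow> norm x \<le> r \<Longrightarrow> norm v \<le> L \<Longrightarrow> norm (Fv t x v) \<le> B"
    using bounded_on_box[OF Fv_cont] by blast
  obtain W where W: "\<And>t. t \<in> {-T..T} \<Longrightarrow> norm (w t) \<le> W" using w_bounded by blast
  have W0: "W \<ge> 0" using order_trans[OF norm_ge_zero W[of 0]] T_pos by simp
  have L0: "L \<ge> 0" using order_trans[OF norm_ge_zero d_bound[of 0]] T_pos by simp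
  have m: "(\<lambda>t. Fv t (u t) (v n t)) \<in> borel_measurable M" for n
    using u_meas v_meas id_meas by (intro measurable_joint[OF Fv_cont])
  have dv: "norm (d t - v n t) \<le> 2 * L" if "t \<in> {-T..T}" for n t
    using norm_triangle_ineq4[of "d t" "v n t"] v_bound[OF that, of n] d_bound[OF that] by linarith
  have b1: "\<bar>(Fv t (u t) (v n t) - w t) \<bullet> (d t - v n t)\<bar> \<le> (B + W) * (2 * L)"
    "norm (Fv t (u t) (v n t) \<bullet> (d t - v n t)) \<le> B * (2 * L)" if t: "t \<in> {-T..T}" for n t
  proof -
    have 1: "norm (Fv t (u t) (v n t)) \<le> B" using t u_bound[OF t] v_bound[OF t] by (intro B) auto
    then have "norm (Fv t (u t) (v n t) - w t) \<le> B + W"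
      using norm_triangle_ineq4[of "Fv t (u t) (v n t)" "w t"] W[OF t] by linarith
    then show "\<bar>(Fv t (u t) (v n t) - w t) \<bullet> (d t - v n t)\<bar> \<le> (B + W) * (2 * L)"
      using dv[OF t] by (rule abs_inner_le_mult)
    show "norm (Fv t (u t) (v n t) \<bullet> (d t - v n t)) \<le> B * (2 * L)"
      using abs_inner_le_mult[OF 1 dv[OF t]] by simp
  qed
  show int: "integrable M (\<lambda>t. Fv t (u t) (v n t) \<bullet> (d t - v n t))" for n
    by (intro integrable_lebesgue_on_bounded[where B="B * (2 * L)"] b1(2) borel_measurable_inner
      borel_measurable_diff m d_meas v_meas)
  have "(\<lambda>n. LINT t|M. indicator A t * ((Fv t (u t) (v n t) - w t) \<bullet> (d t - v n t))) \<longlonglongrightarrow> (LINT t|M. (0::real))"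
  proof (rule bounded_convergence_lebesgue_on[where B="(B + W) * (2 * L)"])
    show "(\<lambda>t. indicator A t * ((Fv t (u t) (v n t) - w t) \<bullet> (d t - v n t))) \<in> borel_measurable M" for n
      using A m[of n] w_meas d_meas v_meas by measurable
    show "norm (indicator A t * ((Fv t (u t) (v n t) - w t) \<bullet> (d t - v n t))) \<le> (B + W) * (2 * L)"
      if "t \<in> {-T..T}" for n t
      using b1(1)[OF that, of n] B(1) W0 L0 by (auto simp: indicator_def)
    have "AE t in M. t \<in> {-T..T}" using AE_space[of M] by simp
    with momentum_at_limit_position show "AE t in M. (\<lambda>n. indicator A t * ((Fv t (u t) (v n t) - w t) \<bullet> (d t - v n t))) \<longlonglongrightarrow> 0"
    proof eventually_elim
      case (elim t)
      have "(\<lambda>n. norm (Fv t (u t) (v n t) - w t) * (2 * L)) \<longlonglongrightarrow> norm (w t - w t) * (2 * L)"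
        by (intro tendsto_intros elim(1))
      then have z: "(\<lambda>n. norm (Fv t (u t) (v n t) - w t) * (2 * L)) \<longlonglongrightarrow> 0" by simp
      have "(\<lambda>n. (Fv t (u t) (v n t) - w t) \<bullet> (d t - v n t)) \<longlonglongrightarrow> 0"
        by (rule Lim_null_comparison[OF _ z])
          (use abs_inner_le_mult[OF order_refl dv[OF elim(2)]] in auto)
      from tendsto_mult[OF tendsto_const this] show ?case by simp
    qed
  qed simp
  then have 1: "(\<lambda>n. LINT t|M. indicator A t * ((Fv t (u t) (v n t) - w t) \<bullet> (d t - v n t))) \<longlonglongrightarrow> 0" by simp
  have Wi: "integrable M (\<lambda>t. w t \<bullet> (d t - v n t))" for n
    using abs_inner_le_mult[OF W dv]
    by (intro integrable_lebesgue_on_bounded[where B="W * (2 * L)"] borel_measurable_inner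
      borel_measurable_diff w_meas d_meas v_meas) simp
  have "(\<lambda>n. LINT t|M. (indicator A t *\<^sub>R w t) \<bullet> (v n t - d t)) \<longlonglongrightarrow> 0"
    by (rule velocity_weak_limit[where B=W]) (use A w_meas W W0 in \<open>auto simp: indicator_def\<close>)
  from tendsto_minus[OF this] have 2: "(\<lambda>n. LINT t|M. indicator A t * (w t \<bullet> (d t - v n t))) \<longlonglongrightarrow> 0"
    by (simp add: inner_diff_right algebra_simps flip: Bochner_Integration.integral_minus)
  have "(LINT t|M. indicator A t * (Fv t (u t) (v n t) \<bullet> (d t - v n t)))
     = (LINT t|M. indicator A t * ((Fv t (u t) (v n t) - w t) \<bullet> (d t - v n t))) + (LINT t|M. indicator A t * (w t \<bullet> (d t - v n t)))" for n
  proof -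
    have "integrable M (\<lambda>t. (Fv t (u t) (v n t) - w t) \<bullet> (d t - v n t))"
      using Bochner_Integration.integrable_diff[OF int Wi, of n n] by (simp add: inner_diff_left)
    from Bochner_Integration.integral_add[OF integrable_indicator_mult[OF this A] integrable_indicator_mult[OF Wi A], symmetric]
    show ?thesis by (simp add: inner_diff_left algebra_simps)
  qed
  then show "(\<lambda>n. LINT t|M. indicator A t * (Fv t (u t) (v n t) \<bullet> (d t - v n t))) \<longlonglongrightarrow> 0"
    using tendsto_add[OF 1 2] by simp
qed

lemma sets_M: "{-T..T} \<in> sets M"
  by (auto simp: sets_restrict_space_iff)

lemma Fv_shifted_bounded:
  assumes e: "norm e \<le> 1" and s: "0 \<le> s" "s \<le> 1"
  obtains B where "\<And>t. t \<in> {-T..T} \<Longrightarrow> norm (Fv t (u t + s *\<^sub>R e) (d t)) \<le> B" "B \<ge> 0"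
    "(\<lambda>t. Fv t (u t + s *\<^sub>R e) (d t)) \<in> borel_measurable M"
proof -
  obtain B where B: "B \<ge> 0" "\<And>t x v. \<bar>t\<bar> \<le> T \<Longrightarrow> norm x \<le> r + 1 \<Longrightarrow> norm v \<le> L \<Longrightarrow> norm (Fv t x v) \<le> B"
    using bounded_on_box[OF Fv_cont] by blast
  have "norm (Fv t (u t + s *\<^sub>R e) (d t)) \<le> B" if t: "t \<in> {-T..T}" for t
  proof (rule B(2))
    have "norm (s *\<^sub>R e) \<le> 1" using e s by (simp add: mult_le_one)
    then show "norm (u t + s *\<^sub>R e) \<le> r + 1"
      using norm_triangle_ineq[of "u t" "s *\<^sub>R e"] u_bound[OF t] by linarith
  qed (use t d_bound in auto)
  moreover have "(\<lambda>t. Fv t (u t + s *\<^sub>R e) (d t)) \<in> borel_measurable M"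
    by (intro measurable_joint[OF Fv_cont] id_meas borel_measurable_add u_meas d_meas borel_measurable_const)
  ultimately show ?thesis using that B(1) by blast
qed

text \<open>Write \<open>a n\<close> for the integral of \<open>F t (u t) (d t) - F t (u t) (v n t)\<close>. The tangents at \<open>v n t\<close> and at
  \<open>d t\<close> bound it from below and above by the integrals of \<open>d - v n\<close> against the momenta and against
  \<open>Fv t (u t) (d t)\<close>. Both bounds tend to \<open>0\<close>, the second by weak convergence alone.\<close>
lemma excess_limits:
  shows "(\<lambda>n. LINT t|M. F t (u t) (v n t)) \<longlonglongrightarrow> (LINT t|M. F t (u t) (d t))"
    and "(\<lambda>n. LINT t|M. excess n t) \<longlonglongrightarrow> 0" and "integrable M (excess n)"
proof -
  define a where "a n = (LINT t|M. F t (u t) (d t) - F t (u t) (v n t))" for n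
  define b where "b n = (LINT t|M. Fv t (u t) (v n t) \<bullet> (d t - v n t))" for n
  define c where "c n = (LINT t|M. Fv t (u t) (d t) \<bullet> (d t - v n t))" for n
  have ai: "integrable M (\<lambda>t. F t (u t) (d t) - F t (u t) (v n t))" for n
    by (intro Bochner_Integration.integrable_diff F_integrable)
  have bi: "integrable M (\<lambda>t. Fv t (u t) (v n t) \<bullet> (d t - v n t))" for n
    by (rule momentum_pairing_limit(2)[OF sets_M])
  have "b n = (LINT t|M. indicator {-T..T} t * (Fv t (u t) (v n t) \<bullet> (d t - v n t)))" for n
    unfolding b_def by (rule Bochner_Integration.integral_cong) auto
  then have b0: "b \<longlonglongrightarrow> 0" using momentum_pairing_limit(1)[OF sets_M] by presburger
  obtain B where B: "\<And>t. t \<in> {-T..T} \<Longrightarrow> norm (Fv t (u t + 0 *\<^sub>R 0) (d t)) \<le> B"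
     "B \<ge> 0" "(\<lambda>t. Fv t (u t + 0 *\<^sub>R 0) (d t)) \<in> borel_measurable M"
    using Fv_shifted_bounded[of 0 0] by auto
  have "(\<lambda>n. - (LINT t|M. Fv t (u t) (d t) \<bullet> (v n t - d t))) \<longlonglongrightarrow> - 0"
    using B by (intro tendsto_minus velocity_weak_limit[where B=B]) auto
  moreover have "- (LINT t|M. Fv t (u t) (d t) \<bullet> (v n t - d t)) = c n" for n
    unfolding c_def by (simp add: inner_diff_right flip: Bochner_Integration.integral_minus)
  ultimately have c0: "c \<longlonglongrightarrow> 0" by simp
  have dv: "norm (d t - v n t) \<le> 2 * L" if "t \<in> {-T..T}" for n t
    using norm_triangle_ineq4[of "d t" "v n t"] v_bound[OF that, of n] d_bound[OF that] by linarith
  have ci: "integrable M (\<lambda>t. Fv t (u t) (d t) \<bullet> (d t - v n t))" for n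
    using abs_inner_le_mult[OF B(1) dv] B(3)
    by (intro integrable_lebesgue_on_bounded[where B="B * (2 * L)"] borel_measurable_inner
      borel_measurable_diff d_meas v_meas) auto
  have excess_eq: "excess n = (\<lambda>t. (F t (u t) (d t) - F t (u t) (v n t)) - Fv t (u t) (v n t) \<bullet> (d t - v n t))" for n
    by (auto simp: excess_def)
  show excess_int: "integrable M (excess n)" for n
    unfolding excess_eq by (rule Bochner_Integration.integrable_diff[OF ai bi])
  have excess_split: "(LINT t|M. excess n t) = a n - b n" for n
    unfolding excess_eq a_def b_def by (rule Bochner_Integration.integral_diff[OF ai bi])
  have "0 \<le> (LINT t|M. excess n t)" for n by (intro Bochner_Integration.integral_nonneg excess_nonneg)
  then have ba: "b n \<le> a n" for n unfolding excess_split by simp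
  have ac: "a n \<le> c n" for n
    unfolding a_def c_def
  proof (rule integral_mono[OF ai ci])
    fix t show "F t (u t) (d t) - F t (u t) (v n t) \<le> Fv t (u t) (d t) \<bullet> (d t - v n t)"
      using F_tangent[of t "u t" "d t" "v n t"] by (simp add: inner_diff_right)
  qed
  have a0: "a \<longlonglongrightarrow> 0"
    by (rule tendsto_sandwich[OF _ _ b0 c0]) (use ba ac in auto)
  show "(\<lambda>n. LINT t|M. excess n t) \<longlonglongrightarrow> 0"
    using tendsto_diff[OF a0 b0] by (simp add: excess_split)
  have "(LINT t|M. F t (u t) (v n t)) = (LINT t|M. F t (u t) (d t)) - a n" for n
    unfolding a_def by (subst Bochner_Integration.integral_diff[OF F_integrable(2,1)]) simp
  then show "(\<lambda>n. LINT t|M. F t (u t) (v n t)) \<longlonglongrightarrow> (LINT t|M. F t (u t) (d t))"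
    using tendsto_diff[OF tendsto_const a0, of "LINT t|M. F t (u t) (d t)"] by simp
qed

text \<open>Along a subsequence the excess tends to \<open>0\<close> almost everywhere. The tangent inequalities at \<open>v n t\<close>
  then turn into the statement that \<open>w t\<close> is a subgradient at \<open>d t\<close>.\<close>
lemma momentum_identified: "AE t in M. w t = Fv t (u t) (d t)"
proof -
  have "(\<lambda>n. LINT t|M. norm (excess n t)) \<longlonglongrightarrow> 0"
    using excess_limits(2) excess_nonneg by simp
  from tendsto_L1_AE_subseq[OF excess_limits(3) this]
  obtain k where k: "strict_mono k" "AE t in M. (\<lambda>n. excess (k n) t) \<longlonglongrightarrow> 0" by blast
  from k(2) momentum_at_limit_position have "AE t in M. t \<in> {-T..T} \<longrightarrow> w t = Fv t (u t) (d t)"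
  proof eventually_elim
    case (elim t)
    show ?case
    proof
      assume t: "t \<in> {-T..T}"
      let ?a = "\<lambda>n. Fv t (u t) (v (k n) t)"
      have a: "?a \<longlonglongrightarrow> w t"
        using LIMSEQ_subseq_LIMSEQ[OF elim(2) k(1)] by (simp add: o_def)
      have "F t (u t) \<xi> \<ge> F t (u t) (d t) + w t \<bullet> (\<xi> - d t)" for \<xi>
      proof (rule LIMSEQ_le_const2)
        have "(\<lambda>n. F t (u t) (d t) - excess (k n) t + ?a n \<bullet> (\<xi> - d t))
            \<longlonglongrightarrow> F t (u t) (d t) - 0 + w t \<bullet> (\<xi> - d t)"
          by (intro tendsto_intros elim(1) a)
        then show "(\<lambda>n. F t (u t) (d t) - excess (k n) t + ?a n \<bullet> (\<xi> - d t))
            \<longlonglongrightarrow> F t (u t) (d t) + w t \<bullet> (\<xi> - d t)" by simp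
        have "F t (u t) (d t) - excess (k n) t + ?a n \<bullet> (\<xi> - d t) \<le> F t (u t) \<xi>" for n
          using F_tangent[of t "u t" "v (k n) t" \<xi>] by (simp add: excess_def inner_diff_right)
        then show "\<exists>N. \<forall>n\<ge>N. F t (u t) (d t) - excess (k n) t + ?a n \<bullet> (\<xi> - d t) \<le> F t (u t) \<xi>"
          by blast
      qed
      then show "w t = Fv t (u t) (d t)" by (rule subgradient_eq_GDERIV[OF Fv])
    qed
  qed
  moreover have "AE t in M. t \<in> {-T..T}" using AE_space[of M] by simp
  ultimately show ?thesis by eventually_elim simp
qed

lemma energy_limit:
  "(\<lambda>n. LINT t|M. F (\<sigma> n t) (X n t) (v n t)) \<longlonglongrightarrow> (LINT t|M. F t (u t) (d t))"
proof -
  have "(\<lambda>n. LINT t|M. indicator {-T..T} t *\<^sub>R (F (\<sigma> n t) (X n t) (v n t) - F t (u t) (v n t))) \<longlonglongrightarrow> 0"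
    by (rule joint_replace_integral[OF F_cont sets_M])
  moreover have "(LINT t|M. indicator {-T..T} t *\<^sub>R (F (\<sigma> n t) (X n t) (v n t) - F t (u t) (v n t)))
      = (LINT t|M. F (\<sigma> n t) (X n t) (v n t)) - (LINT t|M. F t (u t) (v n t))" for n
  proof -
    have i: "integrable M (\<lambda>t. F (\<sigma> n t) (X n t) (v n t))"
      by (rule integrable_box[OF F_cont \<sigma>_meas X_meas v_meas \<sigma>_bound X_bound v_bound])
    have "(LINT t|M. indicator {-T..T} t *\<^sub>R (F (\<sigma> n t) (X n t) (v n t) - F t (u t) (v n t)))
      = (LINT t|M. F (\<sigma> n t) (X n t) (v n t) - F t (u t) (v n t))"
      by (rule Bochner_Integration.integral_cong) auto
    also have "\<dots> = (LINT t|M. F (\<sigma> n t) (X n t) (v n t)) - (LINT t|M. F t (u t) (v n t))"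
      by (rule Bochner_Integration.integral_diff[OF i F_integrable(1)])
    finally show ?thesis .
  qed
  ultimately have "(\<lambda>n. (LINT t|M. F (\<sigma> n t) (X n t) (v n t)) - (LINT t|M. F t (u t) (v n t))) \<longlonglongrightarrow> 0" by simp
  from tendsto_add[OF this excess_limits(1)] show ?thesis by simp
qed

text \<open>For small \<open>s\<close> the number \<open>s * (Fx t (u t) y \<bullet> e)\<close> is, up to \<open>s * \<eta>\<close> and uniformly in the velocity \<open>y\<close>, the
  difference \<open>F t (u t + s *\<^sub>R e) y - F t (u t) y\<close>. The growth of this difference from \<open>y = d t\<close> to
  \<open>y = v n t\<close> is bounded below by the tangents of \<open>F t (u t + s *\<^sub>R e)\<close> at \<open>d t\<close> and of \<open>F t (u t)\<close> at
  \<open>v n t\<close>, whose contributions vanish in the limit.\<close>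
lemma force_lower_bound:
  assumes A: "A \<in> sets M" and e: "norm e \<le> 1" and \<epsilon>: "\<epsilon> > 0"
  shows "\<forall>\<^sub>F n in sequentially. (LINT t|M. indicator A t * ((Fx t (u t) (v n t) - Fx t (u t) (d t)) \<bullet> e)) \<ge> - \<epsilon>"
proof -
  \<comment> \<open>Two difference quotients err by \<open>\<eta>\<close> each over the length \<open>2 * T\<close>, which uses up \<open>\<epsilon> / 2\<close>.\<close>
  define \<eta> where "\<eta> = \<epsilon> / (8 * T)"
  have \<eta>: "\<eta> > 0" using \<epsilon> T_pos by (simp add: \<eta>_def)
  obtain \<delta> where \<delta>: "\<delta> > 0" "\<And>p q. p \<in> {-T..T} \<times> cball 0 (r + 1) \<times> cball 0 L \<Longrightarrow>
      q \<in> {-T..T} \<times> cball 0 (r + 1) \<times> cball 0 L \<Longrightarrow> dist q p < \<delta> \<Longrightarrow>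
      dist ((\<lambda>(t, x, v). Fx t x v) q) ((\<lambda>(t, x, v). Fx t x v) p) < \<eta>"
    using uniformly_continuous_on_box[OF Fx_cont, of "r + 1" L] \<eta> unfolding uniformly_continuous_on_def by metis
  define s where "s = min 1 (\<delta> / 2)"
  have s: "0 < s" "s \<le> 1" "s < \<delta>" using \<delta>(1) by (auto simp: s_def)
  have quot: "\<bar>F t (u t + s *\<^sub>R e) y - F t (u t) y - s * (Fx t (u t) y \<bullet> e)\<bar> \<le> s * \<eta>"
    if t: "t \<in> {-T..T}" and y: "norm y \<le> L" for t y
  proof -
    obtain z where z: "0 < z" "z < s" and zF:
      "F t (u t + s *\<^sub>R e) y - F t (u t + 0 *\<^sub>R e) y = (s - 0) * (Fx t (u t + z *\<^sub>R e) y \<bullet> e)"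
      using MVT2[OF s(1), of "\<lambda>z. F t (u t + z *\<^sub>R e) y" "\<lambda>z. Fx t (u t + z *\<^sub>R e) y \<bullet> e"] GDERIV_line[OF Fx] by blast
    have ze: "norm (z *\<^sub>R e) \<le> z" using e z by (simp add: mult_left_le)
    have "dist ((\<lambda>(t, x, v). Fx t x v) (t, u t + z *\<^sub>R e, y)) ((\<lambda>(t, x, v). Fx t x v) (t, u t, y)) < \<eta>"
    proof (rule \<delta>(2))
      have "norm (u t + z *\<^sub>R e) \<le> r + 1"
        using norm_triangle_ineq[of "u t" "z *\<^sub>R e"] u_bound[OF t] ze z s by linarith
      then show "(t, u t + z *\<^sub>R e, y) \<in> {-T..T} \<times> cball 0 (r + 1) \<times> cball 0 L" using t y by simp
      show "(t, u t, y) \<in> {-T..T} \<times> cball 0 (r + 1) \<times> cball 0 L" using t y u_bound[OF t] by simp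
      show "dist (t, u t + z *\<^sub>R e, y) (t, u t, y) < \<delta>"
        using le_less_trans[OF ze] z s by (simp add: dist_Pair_Pair dist_norm)
    qed
    then have "norm (Fx t (u t + z *\<^sub>R e) y - Fx t (u t) y) \<le> \<eta>" by (simp add: dist_norm)
    from abs_inner_le_mult[OF this e] have "\<bar>(Fx t (u t + z *\<^sub>R e) y - Fx t (u t) y) \<bullet> e\<bar> \<le> \<eta>" by simp
    then have "s * \<bar>(Fx t (u t + z *\<^sub>R e) y - Fx t (u t) y) \<bullet> e\<bar> \<le> s * \<eta>"
      using s(1) by (intro mult_left_mono) auto
    moreover have "F t (u t + s *\<^sub>R e) y - F t (u t) y - s * (Fx t (u t) y \<bullet> e)
        = s * ((Fx t (u t + z *\<^sub>R e) y - Fx t (u t) y) \<bullet> e)"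
      using zF by (simp add: algebra_simps inner_diff_left)
    ultimately show ?thesis using s(1) by (simp add: abs_mult)
  qed
  let ?G = "\<lambda>t. Fv t (u t + s *\<^sub>R e) (d t)"
  let ?Q = "\<lambda>n t. (Fx t (u t) (v n t) - Fx t (u t) (d t)) \<bullet> e"
  let ?R = "\<lambda>n t. ?G t \<bullet> (v n t - d t) + Fv t (u t) (v n t) \<bullet> (d t - v n t)"
  have pt: "s * ?Q n t \<ge> ?R n t - 2 * (s * \<eta>)" if t: "t \<in> {-T..T}" for n t
  proof -
    have 1: "F t (u t + s *\<^sub>R e) (v n t) \<ge> F t (u t + s *\<^sub>R e) (d t) + ?G t \<bullet> (v n t - d t)"
      by (rule F_tangent)
    have 2: "F t (u t) (d t) \<ge> F t (u t) (v n t) + Fv t (u t) (v n t) \<bullet> (d t - v n t)"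
      by (rule F_tangent)
    show ?thesis
      using 1 2 quot[OF t v_bound[OF t, of n]] quot[OF t d_bound[OF t]]
      unfolding inner_diff_left right_diff_distrib abs_le_iff by linarith
  qed
  obtain B where B: "\<And>t. t \<in> {-T..T} \<Longrightarrow> norm (?G t) \<le> B" "B \<ge> 0" "?G \<in> borel_measurable M"
    using Fv_shifted_bounded[OF e, of s] s by auto
  have dv: "norm (v n t - d t) \<le> 2 * L" if "t \<in> {-T..T}" for n t
    using norm_triangle_ineq4[of "v n t" "d t"] v_bound[OF that, of n] d_bound[OF that] by linarith
  have Gi: "integrable M (\<lambda>t. ?G t \<bullet> (v n t - d t))" for n
    using abs_inner_le_mult[OF B(1) dv]
    by (intro integrable_lebesgue_on_bounded[where B="B * (2 * L)"] borel_measurable_inner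
      borel_measurable_diff d_meas v_meas B(3)) auto
  note wi = momentum_pairing_limit(2)[OF A]
  define \<rho> where "\<rho> n = (LINT t|M. indicator A t * (?G t \<bullet> (v n t - d t))) + (LINT t|M. indicator A t * (Fv t (u t) (v n t) \<bullet> (d t - v n t)))" for n
  have "(\<lambda>n. LINT t|M. (indicator A t *\<^sub>R ?G t) \<bullet> (v n t - d t)) \<longlonglongrightarrow> 0"
    by (rule velocity_weak_limit[where B=B]) (use A B in \<open>auto simp: indicator_def\<close>)
  then have "(\<lambda>n. LINT t|M. indicator A t * (?G t \<bullet> (v n t - d t))) \<longlonglongrightarrow> 0" by simp
  from tendsto_add[OF this momentum_pairing_limit(1)[OF A]] have \<rho>0: "\<rho> \<longlonglongrightarrow> 0" by (simp add: \<rho>_def[abs_def])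
  have \<rho>: "\<rho> n = (LINT t|M. indicator A t * ?R n t)" for n
    unfolding \<rho>_def distrib_left
    by (rule Bochner_Integration.integral_add[symmetric]) (intro integrable_indicator_mult Gi wi A)+
  have Qi: "integrable M (?Q n)" for n
  proof -
    have "integrable M (\<lambda>t. Fx t (u t) (v n t))"
      by (rule integrable_box[OF Fx_cont id_meas u_meas v_meas _ u_bound v_bound]) auto
    moreover have "integrable M (\<lambda>t. Fx t (u t) (d t))"
      by (rule integrable_box[OF Fx_cont id_meas u_meas d_meas _ u_bound d_bound]) auto
    ultimately show ?thesis by (intro integrable_inner_left Bochner_Integration.integrable_diff) auto
  qed
  have ci: "integrable M (\<lambda>t. 2 * (s * \<eta>))"
    by (rule integrable_lebesgue_on_bounded[where B="\<bar>2 * (s * \<eta>)\<bar>"]) auto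
  have lower: "\<rho> n - 2 * (s * \<eta>) * (2 * T) \<le> s * (LINT t|M. indicator A t * ?Q n t)" for n
  proof -
    have "\<rho> n - 2 * (s * \<eta>) * (2 * T) = (LINT t|M. indicator A t * ?R n t - 2 * (s * \<eta>))"
      unfolding \<rho> using T_pos
      by (subst Bochner_Integration.integral_diff[OF _ ci])
        (auto intro!: integrable_indicator_mult Bochner_Integration.integrable_add Gi wi A
          simp: measure_restrict_space)
    also have "\<dots> \<le> (LINT t|M. s * (indicator A t * ?Q n t))"
    proof (rule integral_mono)
      show "integrable M (\<lambda>t. indicator A t * ?R n t - 2 * (s * \<eta>))"
        by (intro Bochner_Integration.integrable_diff ci integrable_indicator_mult Bochner_Integration.integrable_add Gi wi A)
      show "integrable M (\<lambda>t. s * (indicator A t * ?Q n t))"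
        by (intro integrable_mult_right integrable_indicator_mult Qi A)
      fix t assume "t \<in> space M"
      then show "indicator A t * ?R n t - 2 * (s * \<eta>) \<le> s * (indicator A t * ?Q n t)"
        using pt[of t n] s(1) \<eta> by (auto simp: indicator_def)
    qed
    finally show ?thesis by simp
  qed
  have "\<forall>\<^sub>F n in sequentially. \<rho> n > - (s * (\<epsilon> / 2))"
    using order_tendstoD(1)[OF \<rho>0, of "- (s * (\<epsilon> / 2))"] s \<epsilon> by simp
  then have "\<forall>\<^sub>F n in sequentially. - (s * (\<epsilon> / 2)) - 2 * (s * \<eta>) * (2 * T) \<le> s * (LINT t|M. indicator A t * ?Q n t)"
  proof eventually_elim
    case (elim n)
    then show ?case using lower[of n] by linarith
  qed
  moreover have "- (s * (\<epsilon> / 2)) - 2 * (s * \<eta>) * (2 * T) = s * (- \<epsilon>)"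
    using T_pos by (simp add: \<eta>_def field_simps)
  ultimately have "\<forall>\<^sub>F n in sequentially. s * (- \<epsilon>) \<le> s * (LINT t|M. indicator A t * ?Q n t)" by simp
  then show ?thesis by eventually_elim (rule mult_left_le_imp_le[OF _ s(1)])
qed

text \<open>The lower bound applied to \<open>e\<close> and to \<open>- e\<close> encloses the limit.\<close>
lemma force_limit:
  assumes A: "A \<in> sets M" and e: "norm e \<le> 1"
  shows "(\<lambda>n. LINT t|M. indicator A t * (Fx (\<sigma> n t) (X n t) (v n t) \<bullet> e)) \<longlonglongrightarrow> (LINT t|M. indicator A t * (Fx t (u t) (d t) \<bullet> e))"
proof -
  have i1: "integrable M (\<lambda>t. Fx (\<sigma> n t) (X n t) (v n t))" for n
    by (rule integrable_box[OF Fx_cont \<sigma>_meas X_meas v_meas \<sigma>_bound X_bound v_bound])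
  have i2: "integrable M (\<lambda>t. Fx t (u t) (v n t))" for n
    by (rule integrable_box[OF Fx_cont id_meas u_meas v_meas _ u_bound v_bound]) auto
  have i3: "integrable M (\<lambda>t. Fx t (u t) (d t))"
    by (rule integrable_box[OF Fx_cont id_meas u_meas d_meas _ u_bound d_bound]) auto
  have ind: "integrable M (\<lambda>t. indicator A t * (h t \<bullet> e))" if "integrable M h" for h :: "real \<Rightarrow> 'a"
    by (intro integrable_indicator_mult integrable_inner_left A) (use that in auto)
  have split: "(LINT t|M. indicator A t * ((h t - k t) \<bullet> e)) = (LINT t|M. indicator A t * (h t \<bullet> e)) - (LINT t|M. indicator A t * (k t \<bullet> e))"
    if "integrable M h" "integrable M k" for h k :: "real \<Rightarrow> 'a"
    unfolding inner_diff_left right_diff_distrib by (rule Bochner_Integration.integral_diff[OF ind[OF that(1)] ind[OF that(2)]])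
  define D where "D n = (LINT t|M. indicator A t * ((Fx t (u t) (v n t) - Fx t (u t) (d t)) \<bullet> e))" for n
  have D0: "D \<longlonglongrightarrow> 0"
  proof (rule tendstoI)
    fix \<epsilon> :: real assume \<epsilon>: "0 < \<epsilon>"
    have "(LINT t|M. indicator A t * ((Fx t (u t) (v n t) - Fx t (u t) (d t)) \<bullet> (- e))) = - D n" for n
      unfolding D_def by simp
    then have "\<forall>\<^sub>F n in sequentially. - D n \<ge> - (\<epsilon> / 2)"
      using force_lower_bound[OF A, of "- e" "\<epsilon> / 2"] e \<epsilon> by simp
    moreover have "\<forall>\<^sub>F n in sequentially. D n \<ge> - (\<epsilon> / 2)"
      unfolding D_def using force_lower_bound[OF A e, of "\<epsilon> / 2"] \<epsilon> by simp
    ultimately show "\<forall>\<^sub>F n in sequentially. dist (D n) 0 < \<epsilon>"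
      by eventually_elim (use \<epsilon> in \<open>auto simp: dist_real_def\<close>)
  qed
  have "(\<lambda>n. LINT t|M. indicator A t *\<^sub>R (Fx (\<sigma> n t) (X n t) (v n t) - Fx t (u t) (v n t))) \<longlonglongrightarrow> 0"
    by (rule joint_replace_integral[OF Fx_cont A])
  from tendsto_inner[OF this tendsto_const[of e]]
  have "(\<lambda>n. (LINT t|M. indicator A t *\<^sub>R (Fx (\<sigma> n t) (X n t) (v n t) - Fx t (u t) (v n t))) \<bullet> e) \<longlonglongrightarrow> 0" by simp
  moreover have "(LINT t|M. indicator A t *\<^sub>R (Fx (\<sigma> n t) (X n t) (v n t) - Fx t (u t) (v n t))) \<bullet> e
      = (LINT t|M. indicator A t * ((Fx (\<sigma> n t) (X n t) (v n t) - Fx t (u t) (v n t)) \<bullet> e))" for n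
  proof -
    have "integrable M (\<lambda>t. indicator A t *\<^sub>R (Fx (\<sigma> n t) (X n t) (v n t) - Fx t (u t) (v n t)))"
      by (intro integrable_mult_indicator A Bochner_Integration.integrable_diff i1 i2)
    then show ?thesis by (subst integral_inner_left[symmetric]) auto
  qed
  ultimately have "(\<lambda>n. LINT t|M. indicator A t * ((Fx (\<sigma> n t) (X n t) (v n t) - Fx t (u t) (v n t)) \<bullet> e)) \<longlonglongrightarrow> 0" by simp
  from tendsto_add[OF this D0] have "(\<lambda>n. (LINT t|M. indicator A t * (Fx (\<sigma> n t) (X n t) (v n t) \<bullet> e)) - (LINT t|M. indicator A t * (Fx t (u t) (d t) \<bullet> e))) \<longlonglongrightarrow> 0"
    by (simp add: D_def split[OF i1 i2] split[OF i2 i3])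
  then show ?thesis by (rule LIM_zero_cancel)
qed

end

section \<open>Limits of approximate solutions\<close>

lemma indefinite_integral_lipschitz:
  fixes h :: "real \<Rightarrow> 'a::euclidean_space"
  assumes hm: "h \<in> borel_measurable (lebesgue_on {a..b})" and hL: "\<And>t. t \<in> {a..b} \<Longrightarrow> norm (h t) \<le> L"
    and s: "s \<in> {a..b}" and t: "t \<in> {a..b}"
  shows "norm (integral {a..s} h - integral {a..t} h) \<le> L * \<bar>s - t\<bar>"
proof -
  have hI: "integrable (lebesgue_on {a..b}) h"
    using hm hL by (rule integrable_lebesgue_on_bounded)
  have hi: "h integrable_on {c..d}" if "a \<le> c" "d \<le> b" for c d
    by (rule integrable_on_if_integrable_lebesgue_on[OF hI that])
  have main: "norm (integral {a..y} h - integral {a..x} h) \<le> L * (y - x)" if "a \<le> x" "x \<le> y" "y \<le> b" for x y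
  proof -
    have "integral {a..x} h + integral {x..y} h = integral {a..y} h"
      using that hi by (intro Henstock_Kurzweil_Integration.integral_combine) auto
    then have "integral {a..y} h - integral {a..x} h = integral {x..y} h" by (simp add: algebra_simps)
    moreover have "norm (integral {x..y} h) \<le> integral {x..y} (\<lambda>_. L)"
      using that hi hL by (intro integral_norm_bound_integral) auto
    ultimately show ?thesis using that by (simp add: mult.commute)
  qed
  show ?thesis
  proof (cases "s \<le> t")
    case True
    then show ?thesis using main[of s t] s t by (simp add: norm_minus_commute)
  next
    case False
    then show ?thesis using main[of t s] s t by simp
  qed
qed

lemma inner_integral_eq_LINT_indicator:
  fixes h :: "real \<Rightarrow> 'a::euclidean_space"
  assumes h: "integrable (lebesgue_on {a..b}) h" and t: "t \<le> b"
  shows "integral {a..t} h \<bullet> e = (LINT s|lebesgue_on {a..b}. indicator {a..t} s * (h s \<bullet> e))"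
proof -
  have hi: "integrable (lebesgue_on {a..t}) h"
    using integrable_lebesgue_on_subinterval[OF h] t by simp
  have "integral {a..t} h \<bullet> e = (LINT s|lebesgue_on {a..t}. h s \<bullet> e)"
    using hi by (simp add: LINT_eq_integral[symmetric])
  also have "\<dots> = (LINT s|lebesgue_on {a..b}. indicator {a..t} s * (h s \<bullet> e))"
    using t by (simp add: integral_restrict_space) (intro Bochner_Integration.integral_cong; auto simp: indicator_def)
  finally show ?thesis .
qed

context lagrangian
begin

definition action :: "(real \<Rightarrow> 'a) \<Rightarrow> (real \<Rightarrow> 'a) \<Rightarrow> real" where
  "action u d = (LINT t|M. F t (u t) (d t) + V t (u t) + f t \<bullet> u t)"

text \<open>\<open>d\<close> represents the derivative of \<open>u\<close> and \<open>w\<close> the momentum. Velocities are required to be bounded,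
  which makes all integrals in the definition of the action finite.\<close>
definition weak_solution :: "(real \<Rightarrow> 'a) \<Rightarrow> (real \<Rightarrow> 'a) \<Rightarrow> bool" where
  "weak_solution u d \<longleftrightarrow> absolutely_continuous_on {-T..T} u \<and> continuous_on {-T..T} u \<and> u (-T) = u T \<and>
    d \<in> borel_measurable M \<and> (\<exists>L. \<forall>t. norm (d t) \<le> L) \<and>
    (AE t in M. (u has_vector_derivative d t) (at t within {-T..T})) \<and>
    (\<exists>w. absolutely_continuous_on {-T..T} w \<and> (AE t in M. w t = Fv t (u t) (d t)) \<and>
      (AE t in M. (w has_vector_derivative Fx t (u t) (d t) + Vx t (u t) + f t) (at t within {-T..T})))"

text \<open>The assumption \<open>momentum\<close> is the Euler-Lagrange equation in integrated form, up to an error. Positions and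
  momenta without the contribution of \<open>f\<close> are indefinite integrals of bounded functions, so they are
  equi-Lipschitz and the Arzela-Ascoli theorem applies to the pair of them.\<close>
lemma approximate_solutions_converge:
  fixes \<sigma> :: "nat \<Rightarrow> real \<Rightarrow> real" and X v :: "nat \<Rightarrow> real \<Rightarrow> 'a" and c x0 :: "nat \<Rightarrow> 'a"
  assumes \<sigma>_meas: "\<And>n. \<sigma> n \<in> borel_measurable M"
    and X_meas: "\<And>n. X n \<in> borel_measurable M"
    and v_meas: "\<And>n. v n \<in> borel_measurable M"
    and \<sigma>_bound: "\<And>n t. t \<in> {-T..T} \<Longrightarrow> \<bar>\<sigma> n t\<bar> \<le> T"
    and X_bound: "\<And>n t. t \<in> {-T..T} \<Longrightarrow> norm (X n t) \<le> r"
    and v_bound: "\<And>n t. t \<in> {-T..T} \<Longrightarrow> norm (v n t) \<le> L"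
    and x0_bound: "\<And>n. norm (x0 n) \<le> r" and c_bound: "\<And>n. norm (c n) \<le> C"
    and \<sigma>_lim: "\<And>t. t \<in> {-T..T} \<Longrightarrow> (\<lambda>n. \<sigma> n t) \<longlonglongrightarrow> t"
    and X_lim: "\<And>t. t \<in> {-T..T} \<Longrightarrow> (\<lambda>n. X n t - (x0 n + integral {-T..t} (v n))) \<longlonglongrightarrow> 0"
    and per: "\<And>n. integral {-T..T} (v n) = 0"
    and momentum: "AE t in M. (\<lambda>n. Fv (\<sigma> n t) (X n t) (v n t) - (c n + integral {-T..t}
        (\<lambda>s. Fx (\<sigma> n s) (X n s) (v n s) + Vx (\<sigma> n s) (X n s) + f s))) \<longlonglongrightarrow> 0"
  obtains k u d where "strict_mono (k :: nat \<Rightarrow> nat)" "weak_solution u d"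
    "(\<lambda>n. LINT t|M. F (\<sigma> (k n) t) (X (k n) t) (v (k n) t) + V (\<sigma> (k n) t) (X (k n) t) + f t \<bullet> X (k n) t)
        \<longlonglongrightarrow> action u d"
proof -
  let ?I = "{-T..T}"
  have TI: "-T \<in> ?I" "T \<in> ?I" "0 \<in> ?I" using T_pos by auto
  have L0: "L \<ge> 0" using order_trans[OF norm_ge_zero v_bound[OF TI(3)]] .
  obtain B1 where B1: "B1 \<ge> 0" "\<And>t x v. \<bar>t\<bar> \<le> T \<Longrightarrow> norm x \<le> r \<Longrightarrow> norm v \<le> L \<Longrightarrow> norm (Fx t x v) \<le> B1"
    using bounded_on_box[OF Fx_cont] by blast
  obtain B2 where B2: "B2 \<ge> 0" "\<And>t x v. \<bar>t\<bar> \<le> T \<Longrightarrow> norm x \<le> r \<Longrightarrow> norm (v::'a) \<le> L \<Longrightarrow> norm (Vx t x) \<le> B2"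
    using bounded_on_box[OF Vx_cont3] by blast
  obtain B3 where B3: "B3 \<ge> 0" "\<And>t x v. \<bar>t\<bar> \<le> T \<Longrightarrow> norm x \<le> r \<Longrightarrow> norm (v::'a) \<le> L \<Longrightarrow> norm (V t x) \<le> B3"
    using bounded_on_box[OF V_cont3] by blast
  define q where "q n t = Fx (\<sigma> n t) (X n t) (v n t) + Vx (\<sigma> n t) (X n t)" for n t
  have Fxm: "(\<lambda>t. Fx (\<sigma> n t) (X n t) (v n t)) \<in> borel_measurable M" for n
    by (rule measurable_joint[OF Fx_cont \<sigma>_meas X_meas v_meas])
  have Vxm: "(\<lambda>t. Vx (\<sigma> n t) (X n t)) \<in> borel_measurable M" for n
    using measurable_joint[OF Vx_cont3 \<sigma>_meas X_meas v_meas] .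
  have qm: "q n \<in> borel_measurable M" for n
    unfolding q_def by (intro borel_measurable_add Fxm Vxm)
  have qb: "norm (q n t) \<le> B1 + B2" if t: "t \<in> ?I" for n t
    unfolding q_def using B1(2)[OF \<sigma>_bound[OF t] X_bound[OF t] v_bound[OF t]]
      B2(2)[OF \<sigma>_bound[OF t] X_bound[OF t] v_bound[OF t]] by (intro norm_triangle_le add_mono)
  \<comment> \<open>\<open>U n\<close> is a continuous substitute for \<open>X n\<close>, and \<open>p n\<close> is the momentum without the contribution of \<open>f\<close>.\<close>
  define U where "U n t = x0 n + integral {-T..t} (v n)" for n t
  define p where "p n t = c n + integral {-T..t} (q n)" for n t
  have Ulip: "norm (U n s - U n t) \<le> L * \<bar>s - t\<bar>" if "s \<in> ?I" "t \<in> ?I" for n s t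
    using indefinite_integral_lipschitz[OF v_meas v_bound that] by (simp add: U_def)
  have plip: "norm (p n s - p n t) \<le> (B1 + B2) * \<bar>s - t\<bar>" if "s \<in> ?I" "t \<in> ?I" for n s t
    using indefinite_integral_lipschitz[OF qm qb that] by (simp add: p_def)
  have U0: "U n (-T) = x0 n" "p n (-T) = c n" for n by (simp_all add: U_def p_def)
  define Z where "Z n t = (U n t, p n t)" for n t
  define K where "K = L + (B1 + B2)"
  have K0: "K \<ge> 0" using L0 B1(1) B2(1) by (simp add: K_def)
  have Zlip: "norm (Z n s - Z n t) \<le> K * \<bar>s - t\<bar>" if "s \<in> ?I" "t \<in> ?I" for n s t
  proof -
    have "norm (Z n s - Z n t) \<le> norm (U n s - U n t) + norm (p n s - p n t)"
      unfolding Z_def by (simp add: norm_Pair_le)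
    then show ?thesis using Ulip[OF that, of n] plip[OF that, of n] by (simp add: K_def algebra_simps)
  qed
  have Zb: "norm (Z n t) \<le> (r + C) + K * (2 * T)" if t: "t \<in> ?I" for n t
  proof -
    have "norm (Z n (-T)) \<le> r + C"
      unfolding Z_def U0 using norm_Pair_le[of "x0 n" "c n"] x0_bound[of n] c_bound[of n] by linarith
    moreover have "norm (Z n t - Z n (-T)) \<le> K * \<bar>t - (-T)\<bar>" by (rule Zlip[OF t TI(1)])
    moreover have "K * \<bar>t - (-T)\<bar> \<le> K * (2 * T)" using t K0 by (intro mult_left_mono) auto
    ultimately show ?thesis using norm_triangle_ineq2[of "Z n t" "Z n (-T)"] by linarith
  qed
  have equi: "\<exists>\<delta>. 0 < \<delta> \<and> (\<forall>n y. y \<in> ?I \<and> norm (x - y) < \<delta> \<longrightarrow> norm (Z n x - Z n y) < e)"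
    if x: "x \<in> ?I" and e: "0 < e" for x e
  proof (intro exI conjI allI impI)
    show "0 < e / (K + 1)" using e K0 by simp
    fix n y assume y: "y \<in> ?I \<and> norm (x - y) < e / (K + 1)"
    have "norm (Z n x - Z n y) \<le> K * \<bar>x - y\<bar>" using Zlip x y by blast
    also have "\<dots> \<le> (K + 1) * \<bar>x - y\<bar>" by (intro mult_right_mono) auto
    also have "\<dots> < e" using y K0 by (simp add: pos_less_divide_eq mult.commute)
    finally show "norm (Z n x - Z n y) < e" .
  qed
  obtain g k where gk: "continuous_on ?I g" "strict_mono (k :: nat \<Rightarrow> nat)"
    "\<And>e. 0 < e \<Longrightarrow> \<exists>N. \<forall>n x. n \<ge> N \<and> x \<in> ?I \<longrightarrow> norm (Z (k n) x - g x) < e"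
    using Arzela_Ascoli[OF compact_Icc Zb equi] by (metis (no_types, lifting))
  have Zl: "(\<lambda>n. Z (k n) t) \<longlonglongrightarrow> g t" if "t \<in> ?I" for t
    using gk(3) that by (intro LIMSEQ_I) blast
  define u where "u t = fst (g t)" for t
  define P where "P t = snd (g t)" for t
  have Ul: "(\<lambda>n. U (k n) t) \<longlonglongrightarrow> u t" and pl: "(\<lambda>n. p (k n) t) \<longlonglongrightarrow> P t" if "t \<in> ?I" for t
    using tendsto_fst[OF Zl[OF that]] tendsto_snd[OF Zl[OF that]] by (auto simp: Z_def u_def P_def)
  have ulip: "norm (u s - u t) \<le> L * \<bar>s - t\<bar>" if "s \<in> ?I" "t \<in> ?I" for s t
    by (rule LIMSEQ_le_const2[OF tendsto_norm[OF tendsto_diff[OF Ul Ul]]]) (use that Ulip in auto)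
  have uper: "u (-T) = u T"
  proof -
    have "U n T = U n (-T)" for n using per[of n] by (simp add: U_def)
    then show ?thesis using Ul[OF TI(1)] Ul[OF TI(2)] LIMSEQ_unique by auto
  qed
  have neg: "-T < T" using T_pos by simp
  obtain d where d: "d \<in> borel_measurable borel" "\<And>t. norm (d t) \<le> L"
    "\<And>t. t \<in> ?I \<Longrightarrow> integral {-T..t} d = u t - u (-T)"
    "AE t in M. (u has_vector_derivative d t) (at t within ?I)"
  proof (rule lipschitz_density[OF neg L0 ulip])
    fix d :: "real \<Rightarrow> 'a"
    assume "d \<in> borel_measurable borel" "\<And>t. norm (d t) \<le> L"
      "\<And>t. t \<in> ?I \<Longrightarrow> integral {-T..t} d = u t - u (-T)"
      "AE t in M. (u has_vector_derivative d t) (at t within ?I)"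
    then show thesis by (rule that)
  qed
  have dm: "d \<in> borel_measurable M"
    using d(1) by (intro measurable_restrict_space1 measurable_completion) simp
  have fi: "f integrable_on ?I"
    by (rule integrable_on_if_integrable_lebesgue_on[OF f_int order_refl order_refl])
  define w where "w t = P t + integral {-T..t} f" for t
  have uc: "continuous_on ?I u" unfolding u_def using gk(1) by (intro continuous_intros)
  have wc: "continuous_on ?I w"
    unfolding w_def P_def using gk(1) by (intro continuous_intros indefinite_integral_continuous_1 fi)
  have um: "u \<in> borel_measurable M" and wm: "w \<in> borel_measurable M"
    using uc wc by (auto intro: continuous_imp_measurable_on_sets_lebesgue)
  have "bounded (w ` ?I)" by (intro compact_imp_bounded compact_continuous_image wc compact_Icc)
  then have wb: "\<exists>B. \<forall>t\<in>?I. norm (w t) \<le> B" by (auto simp: bounded_iff)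
  have int: "h integrable_on {-T..t}" if "integrable M h" "t \<in> ?I" for h :: "real \<Rightarrow> 'a" and t
    using integrable_on_if_integrable_lebesgue_on[OF that(1), of "-T" t] that(2) by simp
  have vI: "integrable M (v n)" for n by (rule integrable_lebesgue_on_bounded[OF v_meas v_bound])
  have qI: "integrable M (q n)" for n by (rule integrable_lebesgue_on_bounded[OF qm qb])
  have dI: "integrable M d" by (rule integrable_lebesgue_on_bounded[OF dm d(2)])
  interpret A: converging_approximation T F Fx Fv V Vx f "\<lambda>n. \<sigma> (k n)" "\<lambda>n. X (k n)" "\<lambda>n. v (k n)" u d w r L
  proof
    fix t assume t: "t \<in> ?I"
    show "(\<lambda>n. \<sigma> (k n) t) \<longlonglongrightarrow> t"
      using LIMSEQ_subseq_LIMSEQ[OF \<sigma>_lim[OF t] gk(2)] by (simp add: o_def)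
    have "(\<lambda>n. X (k n) t - U (k n) t) \<longlonglongrightarrow> 0"
      using LIMSEQ_subseq_LIMSEQ[OF X_lim[OF t] gk(2)] by (simp add: o_def U_def)
    from tendsto_add[OF this Ul[OF t]] show "(\<lambda>n. X (k n) t) \<longlonglongrightarrow> u t" by simp
    have "(\<lambda>n. (U (k n) t - U (k n) (-T)) - (u t - u (-T))) \<longlonglongrightarrow> (u t - u (-T)) - (u t - u (-T))"
      by (intro tendsto_intros Ul t TI)
    moreover have "integral {-T..t} (\<lambda>s. v (k n) s - d s) = (U (k n) t - U (k n) (-T)) - (u t - u (-T))" for n
      using t by (subst Henstock_Kurzweil_Integration.integral_diff) (auto simp: d(3) U_def int vI dI)
    ultimately show "(\<lambda>n. integral {-T..t} (\<lambda>s. v (k n) s - d s)) \<longlonglongrightarrow> 0" by simp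
  next
    have "AE t in M. t \<in> ?I" using AE_space[of M] by simp
    with momentum show "AE t in M. (\<lambda>n. Fv (\<sigma> (k n) t) (X (k n) t) (v (k n) t)) \<longlonglongrightarrow> w t"
    proof eventually_elim
      case (elim t)
      have eq: "c n + integral {-T..t} (\<lambda>s. Fx (\<sigma> n s) (X n s) (v n s) + Vx (\<sigma> n s) (X n s) + f s)
          = p n t + integral {-T..t} f" for n
        using Henstock_Kurzweil_Integration.integral_add[OF int[OF qI elim(2)] int[OF f_int elim(2)], of n]
        by (simp add: p_def q_def)
      have "(\<lambda>n. Fv (\<sigma> (k n) t) (X (k n) t) (v (k n) t) - (p (k n) t + integral {-T..t} f)) \<longlonglongrightarrow> 0"
        using LIMSEQ_subseq_LIMSEQ[OF elim(1) gk(2)] by (simp add: o_def eq)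
      from tendsto_add[OF this tendsto_add[OF pl[OF elim(2)] tendsto_const[of "integral {-T..t} f"]]]
      show ?case by (simp add: w_def)
    qed
  qed (use \<sigma>_meas X_meas v_meas um dm wm \<sigma>_bound X_bound v_bound d(2) wb in auto)
  define Q where "Q t = Fx t (u t) (d t) + Vx t (u t)" for t
  have i3: "integrable M (\<lambda>t. Fx t (u t) (d t))"
    by (rule A.integrable_box[OF Fx_cont id_meas um dm _ A.u_bound d(2)]) auto
  have i4: "integrable M (\<lambda>t. Vx t (u t))"
    by (rule A.integrable_box[OF Vx_cont3 id_meas um dm _ A.u_bound d(2)]) auto
  have i4n: "integrable M (\<lambda>t. Vx (\<sigma> n t) (X n t))" for n
    by (rule A.integrable_box[OF Vx_cont3 \<sigma>_meas X_meas v_meas \<sigma>_bound X_bound v_bound])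
  have i3n: "integrable M (\<lambda>t. Fx (\<sigma> n t) (X n t) (v n t))" for n
    by (rule A.integrable_box[OF Fx_cont \<sigma>_meas X_meas v_meas \<sigma>_bound X_bound v_bound])
  have QI: "integrable M Q" unfolding Q_def by (intro Bochner_Integration.integrable_add i3 i4)
  \<comment> \<open>The equation for the limit momentum: forces converge weakly, hence so do their integrals up to \<open>t\<close>.\<close>
  have PQ: "P t = P (-T) + integral {-T..t} Q" if t: "t \<in> ?I" for t
  proof (rule euclidean_eqI)
    fix e :: 'a assume e: "e \<in> Basis"
    let ?A = "{-T..t}"
    have As: "?A \<in> sets M" using t by (auto simp: sets_restrict_space_iff)
    have conv: "integral {-T..t} h \<bullet> e = (LINT s|M. indicator ?A s * (h s \<bullet> e))" if "integrable M h" for h :: "real \<Rightarrow> 'a"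
      using inner_integral_eq_LINT_indicator[OF that] t by simp
    have add: "integral {-T..t} (\<lambda>s. h s + l s) \<bullet> e = integral {-T..t} h \<bullet> e + integral {-T..t} l \<bullet> e"
      if "integrable M h" "integrable M l" for h l :: "real \<Rightarrow> 'a"
      using Henstock_Kurzweil_Integration.integral_add[OF int[OF that(1) t] int[OF that(2) t]] by (simp add: inner_add_left)
    have l1: "(\<lambda>n. integral {-T..t} (\<lambda>t. Fx (\<sigma> (k n) t) (X (k n) t) (v (k n) t)) \<bullet> e) \<longlonglongrightarrow> integral {-T..t} (\<lambda>t. Fx t (u t) (d t)) \<bullet> e"
      unfolding conv[OF i3n] conv[OF i3] using e by (intro A.force_limit As) simp
    have "(\<lambda>n. (LINT s|M. indicator ?A s *\<^sub>R (Vx (\<sigma> (k n) s) (X (k n) s) - Vx s (u s))) \<bullet> e) \<longlonglongrightarrow> 0 \<bullet> e"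
      by (intro tendsto_inner tendsto_const A.joint_replace_integral[OF Vx_cont3 As])
    moreover have "(LINT s|M. indicator ?A s *\<^sub>R (Vx (\<sigma> n s) (X n s) - Vx s (u s))) \<bullet> e
       = integral {-T..t} (\<lambda>s. Vx (\<sigma> n s) (X n s)) \<bullet> e - integral {-T..t} (\<lambda>s. Vx s (u s)) \<bullet> e" for n
    proof -
      have dif: "integrable M (\<lambda>s. Vx (\<sigma> n s) (X n s) - Vx s (u s))"
        by (intro Bochner_Integration.integrable_diff i4 i4n)
      have "(LINT s|M. indicator ?A s *\<^sub>R (Vx (\<sigma> n s) (X n s) - Vx s (u s))) \<bullet> e
          = (LINT s|M. (indicator ?A s *\<^sub>R (Vx (\<sigma> n s) (X n s) - Vx s (u s))) \<bullet> e)"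
        by (rule integral_inner_left[symmetric]) (intro impI integrable_mult_indicator As dif)
      also have "\<dots> = integral {-T..t} (\<lambda>s. Vx (\<sigma> n s) (X n s) - Vx s (u s)) \<bullet> e"
        unfolding conv[OF dif] by simp
      also have "\<dots> = integral {-T..t} (\<lambda>s. Vx (\<sigma> n s) (X n s)) \<bullet> e - integral {-T..t} (\<lambda>s. Vx s (u s)) \<bullet> e"
        using Henstock_Kurzweil_Integration.integral_diff[OF int[OF i4n t] int[OF i4 t]] by (simp add: inner_diff_left)
      finally show ?thesis .
    qed
    ultimately have "(\<lambda>n. integral {-T..t} (\<lambda>s. Vx (\<sigma> (k n) s) (X (k n) s)) \<bullet> e - integral {-T..t} (\<lambda>s. Vx s (u s)) \<bullet> e) \<longlonglongrightarrow> 0" by simp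
    then have l2: "(\<lambda>n. integral {-T..t} (\<lambda>s. Vx (\<sigma> (k n) s) (X (k n) s)) \<bullet> e) \<longlonglongrightarrow> integral {-T..t} (\<lambda>s. Vx s (u s)) \<bullet> e"
      by (rule LIM_zero_cancel)
    have "(\<lambda>n. p (k n) (-T) \<bullet> e + (integral {-T..t} (\<lambda>t. Fx (\<sigma> (k n) t) (X (k n) t) (v (k n) t)) \<bullet> e + integral {-T..t} (\<lambda>s. Vx (\<sigma> (k n) s) (X (k n) s)) \<bullet> e))
      \<longlonglongrightarrow> P (-T) \<bullet> e + (integral {-T..t} (\<lambda>t. Fx t (u t) (d t)) \<bullet> e + integral {-T..t} (\<lambda>s. Vx s (u s)) \<bullet> e)"
      by (intro tendsto_intros l1 l2 pl TI)
    then have "(\<lambda>n. p (k n) t \<bullet> e) \<longlonglongrightarrow> (P (-T) + integral {-T..t} Q) \<bullet> e"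
      unfolding add[OF i3n i4n, symmetric] add[OF i3 i4, symmetric] U0
      by (simp add: p_def q_def[abs_def] Q_def[abs_def] inner_add_left)
    moreover have "(\<lambda>n. p (k n) t \<bullet> e) \<longlonglongrightarrow> P t \<bullet> e" by (intro tendsto_intros pl t)
    ultimately show "P t \<bullet> e = (P (-T) + integral {-T..t} Q) \<bullet> e" using LIMSEQ_unique by blast
  qed
  have QfI: "integrable M (\<lambda>t. Q t + f t)" by (intro Bochner_Integration.integrable_add QI f_int)
  have weq: "w t = P (-T) + integral {-T..t} (\<lambda>t. Q t + f t)" if t: "t \<in> ?I" for t
    unfolding w_def PQ[OF t]
    using Henstock_Kurzweil_Integration.integral_add[OF int[OF QI t] int[OF f_int t]] by simp
  have "weak_solution u d"
    unfolding weak_solution_def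
  proof (intro conjI exI[of _ w])
    show "absolutely_continuous_on ?I u"
    proof (rule indefinite_integral_absolutely_continuous)
      show "d absolutely_integrable_on ?I" using dI by (simp add: absolutely_integrable_iff_lebesgue_on)
      show "u t = u (-T) + integral {-T..t} d" if "t \<in> ?I" for t using d(3)[OF that] by simp
    qed
    show "absolutely_continuous_on ?I w"
    proof (rule indefinite_integral_absolutely_continuous)
      show "(\<lambda>t. Q t + f t) absolutely_integrable_on ?I" using QfI by (simp add: absolutely_integrable_iff_lebesgue_on)
    qed (rule weq)
    show "AE t in M. w t = Fv t (u t) (d t)" by (rule A.momentum_identified)
    have "AE t in M. t \<in> ?I" using AE_space[of M] by simp
    with lebesgue_differentiation[OF int[OF QfI TI(2)]]
    show "AE t in M. (w has_vector_derivative Fx t (u t) (d t) + Vx t (u t) + f t) (at t within ?I)"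
    proof eventually_elim
      case (elim t)
      have "((\<lambda>s. P (-T) + integral {-T..s} (\<lambda>t. Q t + f t)) has_vector_derivative (0 + (Q t + f t))) (at t within ?I)"
        by (intro has_vector_derivative_add elim(1)) (rule has_vector_derivative_const)
      from has_vector_derivative_transform[OF elim(2) _ this, of w] show ?case
        using weq by (simp add: Q_def)
    qed
  qed (use dm d uper uc in auto)
  moreover have "(\<lambda>n. LINT t|M. F (\<sigma> (k n) t) (X (k n) t) (v (k n) t) + V (\<sigma> (k n) t) (X (k n) t) + f t \<bullet> X (k n) t)
        \<longlonglongrightarrow> action u d"
  proof -
    have Fi: "integrable M (\<lambda>t. F (\<sigma> n t) (X n t) (v n t))" "integrable M (\<lambda>t. V (\<sigma> n t) (X n t))" for n
      by (rule A.integrable_box[OF F_cont \<sigma>_meas X_meas v_meas \<sigma>_bound X_bound v_bound], assumption+)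
         (rule A.integrable_box[OF V_cont3 \<sigma>_meas X_meas v_meas \<sigma>_bound X_bound v_bound])
    have Vi: "integrable M (\<lambda>t. V t (u t))"
      by (rule A.integrable_box[OF V_cont3 id_meas um dm _ A.u_bound d(2)]) auto
    have fb: "\<bar>f t \<bullet> y\<bar> \<le> r * norm (f t)" if "norm y \<le> r" for t y
      using abs_inner_le_mult[OF order_refl that, of "f t"] by (simp add: mult.commute)
    have dom: "integrable M (\<lambda>t. r * norm (f t))" using f_int by simp
    have fm: "f \<in> borel_measurable M" using f_int by simp
    have fy: "integrable M (\<lambda>t. f t \<bullet> y t)" if y: "y \<in> borel_measurable M" "\<And>t. t \<in> ?I \<Longrightarrow> norm (y t) \<le> r" for y
    proof (rule Bochner_Integration.integrable_bound[OF dom])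
      show "(\<lambda>t. f t \<bullet> y t) \<in> borel_measurable M" by (intro borel_measurable_inner fm y(1))
      show "AE t in M. norm (f t \<bullet> y t) \<le> norm (r * norm (f t))"
      proof (rule AE_I2)
        fix t assume "t \<in> space M"
        then have "\<bar>f t \<bullet> y t\<bar> \<le> r * norm (f t)" using fb y(2) by simp
        then show "norm (f t \<bullet> y t) \<le> norm (r * norm (f t))" by simp
      qed
    qed
    have fX: "integrable M (\<lambda>t. f t \<bullet> X n t)" for n by (intro fy X_meas X_bound)
    have fu: "integrable M (\<lambda>t. f t \<bullet> u t)" by (intro fy um A.u_bound)
    have 2: "(\<lambda>n. LINT t|M. V (\<sigma> (k n) t) (X (k n) t)) \<longlonglongrightarrow> (LINT t|M. V t (u t))"
    proof (rule bounded_convergence_lebesgue_on[where B=B3])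
      show "AE t in M. (\<lambda>n. V (\<sigma> (k n) t) (X (k n) t)) \<longlonglongrightarrow> V t (u t)"
      proof (rule AE_I2)
        fix t assume "t \<in> space M"
        then have "(\<lambda>n. V (\<sigma> (k n) t) (X (k n) t) - V t (u t)) \<longlonglongrightarrow> 0"
          using A.joint_replace[OF V_cont3, of t] by simp
        then show "(\<lambda>n. V (\<sigma> (k n) t) (X (k n) t)) \<longlonglongrightarrow> V t (u t)" by (rule LIM_zero_cancel)
      qed
      show "norm (V (\<sigma> (k n) t) (X (k n) t)) \<le> B3" if t: "t \<in> ?I" for n t
        by (rule B3(2)[OF \<sigma>_bound[OF t] X_bound[OF t] v_bound[OF t]])
    qed (use Fi(2) Vi in auto)
    have 3: "(\<lambda>n. LINT t|M. f t \<bullet> X (k n) t) \<longlonglongrightarrow> (LINT t|M. f t \<bullet> u t)"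
    proof (rule integral_dominated_convergence[OF _ _ dom])
      show "AE t in M. (\<lambda>n. f t \<bullet> X (k n) t) \<longlonglongrightarrow> f t \<bullet> u t"
        by (intro AE_I2 tendsto_intros A.X_lim) simp
      show "AE t in M. norm (f t \<bullet> X (k n) t) \<le> r * norm (f t)" for n
        by (intro AE_I2) (use fb X_bound in auto)
    qed (use fX fu in auto)
    have "(LINT t|M. F (\<sigma> n t) (X n t) (v n t) + V (\<sigma> n t) (X n t) + f t \<bullet> X n t)
      = (LINT t|M. F (\<sigma> n t) (X n t) (v n t)) + (LINT t|M. V (\<sigma> n t) (X n t)) + (LINT t|M. f t \<bullet> X n t)" for n
      by (simp add: Fi fX)
    moreover have "action u d = (LINT t|M. F t (u t) (d t)) + (LINT t|M. V t (u t)) + (LINT t|M. f t \<bullet> u t)"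
      unfolding action_def by (simp add: A.F_integrable(2) Vi fu)
    ultimately show ?thesis using tendsto_add[OF tendsto_add[OF A.energy_limit 2] 3] by simp
  qed
  ultimately show ?thesis using that[OF gk(2)] by blast
qed

end

section \<open>The discretised action\<close>

context lagrangian
begin

text \<open>The partial gradients determine the derivative along a joint variation because they are continuous.\<close>
lemma F_joint_derivative:
  "((\<lambda>z. F t (x + z *\<^sub>R a) (v + z *\<^sub>R c)) has_real_derivative Fx t x v \<bullet> a + Fv t x v \<bullet> c) (at 0)"
proof -
  have "((\<lambda>(y, w). F t y w) has_derivative (\<lambda>(y, w). y \<bullet> Fx t x v + blinfun_apply (blinfun_inner_right (Fv t x v)) w))
      (at (x, v) within UNIV \<times> UNIV)"
  proof (rule has_derivative_partialsI[where fy="\<lambda>y w. blinfun_inner_right (Fv t y w)"])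
    show "((\<lambda>y. F t y v) has_derivative (\<lambda>y. y \<bullet> Fx t x v)) (at x within UNIV)"
      using Fx[of t v x] by (simp add: gderiv_def)
    show "((\<lambda>w. F t y w) has_derivative blinfun_apply (blinfun_inner_right (Fv t y w))) (at w within UNIV)" for y w
    proof -
      have "(\<lambda>k. k \<bullet> Fv t y w) = (\<bullet>) (Fv t y w)" by (auto simp: inner_commute)
      then show ?thesis using Fv[of t y w] by (simp add: gderiv_def)
    qed
    have "continuous_on UNIV (\<lambda>p. Fv t (fst p) (snd p))"
      using continuous_on_compose2[OF Fv_cont, of UNIV "\<lambda>p. (t, fst p, snd p)"]
      by (simp add: continuous_intros case_prod_beta')
    then have "continuous_on UNIV (\<lambda>p. blinfun_inner_right (Fv t (fst p) (snd p)))"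
      by (intro bounded_linear.continuous_on[OF bounded_linear_blinfun_inner_right])
    then show "continuous (at (x, v) within UNIV \<times> UNIV) (\<lambda>(y, w). blinfun_inner_right (Fv t y w))"
      unfolding case_prod_beta' by (simp add: continuous_on_eq_continuous_at)
  qed auto
  then have D: "((\<lambda>p. F t (fst p) (snd p)) has_derivative (\<lambda>p. fst p \<bullet> Fx t x v + Fv t x v \<bullet> snd p)) (at (x + 0 *\<^sub>R a, v + 0 *\<^sub>R c))"
    by (simp add: case_prod_beta')
  have "((\<lambda>z::real. (x + z *\<^sub>R a, v + z *\<^sub>R c)) has_derivative (\<lambda>h. (h *\<^sub>R a, h *\<^sub>R c))) (at 0)"
    by (auto intro!: derivative_eq_intros)
  from diff_chain_at[OF this D]
  have "((\<lambda>z. F t (x + z *\<^sub>R a) (v + z *\<^sub>R c)) has_derivative (\<lambda>h. (h *\<^sub>R a) \<bullet> Fx t x v + Fv t x v \<bullet> (h *\<^sub>R c))) (at 0)"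
    by (simp add: o_def)
  moreover have "(\<lambda>h. (h *\<^sub>R a) \<bullet> Fx t x v + Fv t x v \<bullet> (h *\<^sub>R c)) = (*) (Fx t x v \<bullet> a + Fv t x v \<bullet> c)"
    by (auto simp: inner_commute algebra_simps)
  ultimately show ?thesis by (simp add: has_field_derivative_def)
qed

text \<open>Cell \<open>i\<close> is the interval from \<open>node m i\<close> to \<open>node m (Suc i)\<close>, with \<open>i < m\<close>; the point \<open>x i\<close> belongs to the left
  end of the cell. Reduction of indices modulo \<open>m\<close> encodes periodicity. In the action \<open>J\<close>, the sequence \<open>s\<close>
  provides a sample time in each cell, whereas the merely integrable \<open>f\<close> enters through its integrals
  over the cells. In \<open>grad\<close>, the index \<open>j\<close> is the cyclic predecessor of \<open>i\<close>, the second cell whose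
  velocity depends on \<open>x i\<close>.\<close>
definition mesh :: "nat \<Rightarrow> real" where "mesh m = 2 * T / real m"
definition node :: "nat \<Rightarrow> nat \<Rightarrow> real" where "node m i = -T + real i * mesh m"
definition vel :: "nat \<Rightarrow> (nat \<Rightarrow> 'a) \<Rightarrow> nat \<Rightarrow> 'a" where
  "vel m x i = (x (Suc i mod m) - x i) /\<^sub>R mesh m"
definition load :: "nat \<Rightarrow> nat \<Rightarrow> 'a" where "load m i = integral {node m i..node m (Suc i)} f"
definition J :: "nat \<Rightarrow> (nat \<Rightarrow> real) \<Rightarrow> (nat \<Rightarrow> 'a) \<Rightarrow> real" where
  "J m s x = (\<Sum>i<m. mesh m * (F (s i) (x i) (vel m x i) + V (s i) (x i)) + load m i \<bullet> x i)"
definition grad :: "nat \<Rightarrow> (nat \<Rightarrow> real) \<Rightarrow> (nat \<Rightarrow> 'a) \<Rightarrow> nat \<Rightarrow> 'a" where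
  "grad m s x i = mesh m *\<^sub>R (Fx (s i) (x i) (vel m x i) + Vx (s i) (x i)) + load m i
     - Fv (s i) (x i) (vel m x i)
     + (let j = (i + m - 1) mod m in Fv (s j) (x j) (vel m x j))"

lemma mesh_pos: "m > 0 \<Longrightarrow> mesh m > 0" using T_pos by (simp add: mesh_def)

lemma m_mesh: "m > 0 \<Longrightarrow> real m * mesh m = 2 * T" by (simp add: mesh_def)

lemma node_0: "node m 0 = -T" by (simp add: node_def)
lemma node_m: "m > 0 \<Longrightarrow> node m m = T" by (simp add: node_def m_mesh)
lemma node_Suc: "node m (Suc i) = node m i + mesh m" by (simp add: node_def algebra_simps)
lemma node_mono: "i \<le> j \<Longrightarrow> m > 0 \<Longrightarrow> node m i \<le> node m j"
  using mesh_pos[of m] by (simp add: node_def)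
lemma node_bounds: "i \<le> m \<Longrightarrow> m > 0 \<Longrightarrow> -T \<le> node m i \<and> node m i \<le> T"
  using node_mono[of 0 i m] node_mono[of i m m] by (simp add: node_0 node_m)

lemma sum_cells:
  fixes q :: "real \<Rightarrow> 'b::euclidean_space"
  assumes "integrable M q" "m > 0" "k \<le> m"
  shows "(\<Sum>i<k. integral {node m i..node m (Suc i)} q) = integral {-T..node m k} q"
  using \<open>k \<le> m\<close>
proof (induction k)
  case 0 then show ?case by (simp add: node_0)
next
  case (Suc k)
  have "q integrable_on {-T..node m (Suc k)}"
    using node_bounds[of "Suc k" m] Suc.prems assms(2)
    by (intro integrable_on_if_integrable_lebesgue_on[OF assms(1)]) auto
  then have "integral {-T..node m k} q + integral {node m k..node m (Suc k)} q = integral {-T..node m (Suc k)} q"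
    using node_bounds[of k m] node_mono[of k "Suc k" m] Suc.prems assms(2)
    by (intro Henstock_Kurzweil_Integration.integral_combine) auto
  then show ?case using Suc by simp
qed

lemma cyclic_pred:
  assumes "m > 0" "i < m" shows "(Suc i mod m + m - 1) mod m = i"
proof (cases "Suc i = m")
  case False
  then have "Suc i mod m = Suc i" using assms by simp
  then show ?thesis using assms by simp
qed (use assms in auto)

lemma bij_cyclic_Suc: "m > 0 \<Longrightarrow> bij_betw (\<lambda>i. Suc i mod m) {..<m} {..<m}"
proof (rule bij_betw_byWitness[where f'="\<lambda>i. (i + m - 1) mod m"])
  assume m: "m > 0"
  show "\<forall>i\<in>{..<m}. (Suc i mod m + m - 1) mod m = i" using cyclic_pred[OF m] by simp
  show "\<forall>i\<in>{..<m}. Suc ((i + m - 1) mod m) mod m = i"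
  proof
    fix i assume i: "i \<in> {..<m}"
    have "Suc ((i + m - 1) mod m) mod m = Suc (i + m - 1) mod m" by (simp add: mod_Suc_eq)
    also have "Suc (i + m - 1) = i + m" using m by simp
    finally show "Suc ((i + m - 1) mod m) mod m = i" using i by simp
  qed
qed auto

text \<open>Shifting the index in the terms with the predecessor collects the differences of \<open>d\<close> into the velocity
  of the variation \<open>d\<close>; nothing is left over at the ends, since the shift is cyclic.\<close>
lemma grad_summation_by_parts:
  assumes m: "m > 0"
  shows "(\<Sum>i<m. grad m s x i \<bullet> d i) = (\<Sum>i<m. mesh m * (Fx (s i) (x i) (vel m x i) \<bullet> d i
     + Fv (s i) (x i) (vel m x i) \<bullet> vel m d i + Vx (s i) (x i) \<bullet> d i) + load m i \<bullet> d i)"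
proof -
  let ?w = "\<lambda>i. Fv (s i) (x i) (vel m x i)"
  have "(\<Sum>i<m. ?w i \<bullet> d (Suc i mod m)) = (\<Sum>i<m. ?w ((Suc i mod m + m - 1) mod m) \<bullet> d (Suc i mod m))"
    using cyclic_pred[OF m] by (intro sum.cong) auto
  also have "\<dots> = (\<Sum>i<m. ?w ((i + m - 1) mod m) \<bullet> d i)"
    by (rule sum.reindex_bij_betw[OF bij_cyclic_Suc[OF m]])
  finally have shift: "(\<Sum>i<m. ?w ((i + m - 1) mod m) \<bullet> d i) = (\<Sum>i<m. ?w i \<bullet> d (Suc i mod m))" ..
  have vd: "mesh m * (?w i \<bullet> vel m d i) = ?w i \<bullet> d (Suc i mod m) - ?w i \<bullet> d i" for i
    using mesh_pos[OF m] by (simp add: vel_def inner_diff_right field_simps)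
  have "(\<Sum>i<m. grad m s x i \<bullet> d i) = (\<Sum>i<m. mesh m * (Fx (s i) (x i) (vel m x i) \<bullet> d i + Vx (s i) (x i) \<bullet> d i)
      + load m i \<bullet> d i - ?w i \<bullet> d i) + (\<Sum>i<m. ?w ((i + m - 1) mod m) \<bullet> d i)"
    by (simp add: grad_def Let_def inner_add_left inner_diff_left sum.distrib[symmetric])
  also have "\<dots> = (\<Sum>i<m. mesh m * (Fx (s i) (x i) (vel m x i) \<bullet> d i + Vx (s i) (x i) \<bullet> d i)
      + load m i \<bullet> d i + mesh m * (?w i \<bullet> vel m d i))"
    unfolding shift sum.distrib[symmetric] by (intro sum.cong) (simp_all add: vd)
  finally show ?thesis by (simp add: algebra_simps)
qed

lemma vel_add: "vel m (\<lambda>i. x i + z *\<^sub>R d i) = (\<lambda>i. vel m x i + z *\<^sub>R vel m d i)"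
  by (auto simp: vel_def algebra_simps)

lemma vel_cont: "continuous_on UNIV (\<lambda>x. vel m x i)"
  unfolding vel_def
  by (intro continuous_intros continuous_on_product_coordinates)

lemma J_gradient_system:
  assumes m: "m > 0"
  shows "gradient_system m (J m s) (grad m s)"
proof
  have cF: "continuous_on UNIV (\<lambda>x. \<phi> (s i) (x i) (vel m x i))" if "continuous_on UNIV (\<lambda>(t, x, v). \<phi> t x v)"
    for \<phi> :: "real \<Rightarrow> 'a \<Rightarrow> 'a \<Rightarrow> 'b::topological_space" and i
  proof -
    have "continuous_on UNIV (\<lambda>x::nat \<Rightarrow> 'a. (s i, x i, vel m x i))"
      by (intro continuous_intros vel_cont continuous_on_product_coordinates)
    from continuous_on_compose2[OF that this] show ?thesis by simp
  qed
  have cV: "continuous_on UNIV (\<lambda>x. V (s i) (x i))" "continuous_on UNIV (\<lambda>x. Vx (s i) (x i))" for i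
    using cF[OF V_cont3] cF[OF Vx_cont3] by auto
  show "continuous_on UNIV (J m s)" unfolding J_def[abs_def]
    by (intro continuous_intros cF[OF F_cont] cV continuous_on_product_coordinates)
  show "continuous_on UNIV (\<lambda>x. grad m s x i)" for i unfolding grad_def Let_def
    by (intro continuous_intros cF[OF Fx_cont] cF[OF Fv_cont] cV)
  fix x d :: "nat \<Rightarrow> 'a"
  have "((\<lambda>z. J m s (\<lambda>i. x i + z *\<^sub>R d i)) has_real_derivative (\<Sum>i<m. mesh m * ((Fx (s i) (x i) (vel m x i) \<bullet> d i
     + Fv (s i) (x i) (vel m x i) \<bullet> vel m d i) + Vx (s i) (x i) \<bullet> d i) + load m i \<bullet> d i)) (at 0)"
    unfolding J_def vel_add
  proof (intro DERIV_sum DERIV_add DERIV_cmult F_joint_derivative)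
    fix i
    show "((\<lambda>z. V (s i) (x i + z *\<^sub>R d i)) has_real_derivative Vx (s i) (x i) \<bullet> d i) (at 0)"
      by (rule GDERIV_line) (simp add: Vx)
    show "((\<lambda>z. load m i \<bullet> (x i + z *\<^sub>R d i)) has_real_derivative load m i \<bullet> d i) (at 0)"
      unfolding inner_add_right inner_scaleR_right by (auto intro!: derivative_eq_intros)
  qed
  then show "((\<lambda>z. J m s (\<lambda>i. x i + z *\<^sub>R d i)) has_real_derivative (\<Sum>i<m. grad m s x i \<bullet> d i)) (at 0)"
    by (simp add: grad_summation_by_parts[OF m])
qed

lemma node_difference:
  assumes "m > 0" "i \<le> j" "j < m"
  shows "x j - x i = (\<Sum>k<m. mesh m *\<^sub>R (if i \<le> k \<and> k < j then vel m x k else 0))"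
proof -
  have "mesh m *\<^sub>R vel m x k = x (Suc k) - x k" if "k \<in> {i..<j}" for k
    using that assms mesh_pos[of m] by (simp add: vel_def)
  then have "(\<Sum>k\<in>{i..<j}. mesh m *\<^sub>R vel m x k) = (\<Sum>k\<in>{i..<j}. x (Suc k) - x k)" by (intro sum.cong) auto
  also have "\<dots> = x j - x i" using assms by (simp add: sum_Suc_diff')
  finally have "x j - x i = (\<Sum>k\<in>{i..<j}. mesh m *\<^sub>R vel m x k)" ..
  also have "\<dots> = (\<Sum>k<m. if i \<le> k \<and> k < j then mesh m *\<^sub>R vel m x k else 0)"
    using assms(3) by (subst sum.inter_filter[symmetric]) (auto intro!: sum.cong)
  finally show ?thesis by (simp add: if_distrib cong: if_cong)
qed

text \<open>The discrete counterpart of the norm of \<open>W\<^sup>1\<^sup>,\<^sup>1\<close>, normalised so as to dominate the supremum norm with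
  constant \<open>1\<close>.\<close>
definition mean_size :: "nat \<Rightarrow> (nat \<Rightarrow> 'a) \<Rightarrow> real" where
  "mean_size m x = (\<Sum>i<m. mesh m * norm (x i)) / (2 * T) + (\<Sum>i<m. mesh m * norm (vel m x i))"

text \<open>Two nodes differ by at most the total variation; averaging over one of them gives the bound.\<close>
lemma norm_le_mean_size:
  assumes m: "m > 0" and j: "j < m"
  shows "norm (x j) \<le> mean_size m x"
proof -
  let ?S = "\<Sum>k<m. mesh m * norm (vel m x k)"
  have le: "norm (x j - x i) \<le> ?S" if "i \<le> j" "j < m" for i j
  proof -
    have "norm (x j - x i) \<le> (\<Sum>k<m. norm (mesh m *\<^sub>R (if i \<le> k \<and> k < j then vel m x k else 0)))"
      unfolding node_difference[OF m that, of x] by (rule norm_sum)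
    also have "\<dots> \<le> ?S" using mesh_pos[OF m] by (intro sum_mono) auto
    finally show ?thesis .
  qed
  have ij: "norm (x j - x i) \<le> ?S" if "i < m" for i
    using le[of i j] le[of j i] that j by (cases "i \<le> j") (auto simp: norm_minus_commute)
  have "norm (x j) \<le> norm (x i) + ?S" if "i < m" for i
    using ij[OF that] norm_triangle_ineq2[of "x j" "x i"] by linarith
  then have "(\<Sum>i<m. norm (x j)) \<le> (\<Sum>i<m. norm (x i) + ?S)" by (intro sum_mono) auto
  then have "mesh m * (real m * norm (x j)) \<le> mesh m * ((\<Sum>i<m. norm (x i)) + real m * ?S)"
    using mesh_pos[OF m] by (intro mult_left_mono) (auto simp: sum.distrib)
  then have "(real m * mesh m) * norm (x j) \<le> (\<Sum>i<m. mesh m * norm (x i)) + (real m * mesh m) * ?S"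
    by (simp add: algebra_simps sum_distrib_left)
  then have "2 * T * norm (x j) \<le> (\<Sum>i<m. mesh m * norm (x i)) + 2 * T * ?S" unfolding m_mesh[OF m] .
  then have "norm (x j) \<le> ((\<Sum>i<m. mesh m * norm (x i)) + 2 * T * ?S) / (2 * T)"
    using T_pos by (simp add: pos_le_divide_eq mult.commute)
  also have "\<dots> = mean_size m x" using T_pos by (simp add: mean_size_def add_divide_distrib)
  finally show ?thesis .
qed

lemma sum_load_le:
  assumes m: "m > 0"
  shows "(\<Sum>i<m. norm (load m i)) \<le> integral {-T..T} (\<lambda>t. norm (f t))"
proof -
  have nI: "integrable M (\<lambda>t. norm (f t))" using f_int by simp
  have "norm (load m i) \<le> integral {node m i..node m (Suc i)} (\<lambda>t. norm (f t))" if "i < m" for i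
  proof -
    have b: "-T \<le> node m i" "node m (Suc i) \<le> T" using node_bounds[of i m] node_bounds[of "Suc i" m] that m by auto
    have "f absolutely_integrable_on {node m i..node m (Suc i)}"
      using integrable_lebesgue_on_subinterval[OF f_int b] by (simp add: absolutely_integrable_iff_lebesgue_on)
    then show ?thesis unfolding load_def
      by (intro integral_norm_bound_integral) (auto simp: absolutely_integrable_on_def)
  qed
  then have "(\<Sum>i<m. norm (load m i)) \<le> (\<Sum>i<m. integral {node m i..node m (Suc i)} (\<lambda>t. norm (f t)))"
    by (intro sum_mono) auto
  also have "\<dots> = integral {-T..T} (\<lambda>t. norm (f t))"
    using sum_cells[OF nI m order_refl] by (simp add: node_m[OF m])
  finally show ?thesis .
qed

end

section \<open>A priori estimates for the discretised action\<close>

text \<open>The role of \<open>\<gamma>\<close> is to dominate both the function in the lower bound for \<open>V\<close> near the origin and the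
  integrable function in the growth bounds for \<open>F\<close>: thereby one choice of sample times controls the
  Riemann sums of both. The role of \<open>\<phi>\<close> is that of the conjugate of \<open>G\<close> along \<open>f\<close>. Bounds with an
  arbitrary slope \<open>\<kappa>\<close> express superlinear growth. The number \<open>4 * T\<close> is twice the length of the
  interval.\<close>
locale superquadratic = lagrangian T F Fx Fv V Vx f
  for T F Fx Fv V Vx and f :: "real \<Rightarrow> 'a::euclidean_space" +
  fixes G :: "'a \<Rightarrow> real" and \<gamma> \<phi> :: "real \<Rightarrow> real" and \<theta>F \<theta>V \<Lambda> b \<rho> :: real
  assumes T_ge: "2 * T \<ge> 1"
    and G_convex: "convex_on UNIV G" and G_nonneg: "G x \<ge> 0" and G_even: "G (- x) = G x"
    and G_0: "G 0 = 0" and G_cont: "continuous_on UNIV G"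
    and G_superlinear: "\<exists>C. \<forall>x. \<kappa> * norm x \<le> G x + C"
    and growth: "\<exists>C\<ge>0. \<exists>C'. \<forall>t\<in>{-T..T}. \<forall>x v. norm x \<le> r \<longrightarrow>
        norm (Fx t x v) \<le> C' + C * \<gamma> t + C * G v \<and> norm (Fv t x v) \<le> C' + C * \<gamma> t + C * G v"
    and \<gamma>_int: "integrable M \<gamma>" and \<phi>_int: "integrable M \<phi>"
    and F_homogeneity: "Fx t x v \<bullet> x + Fv t x v \<bullet> v \<le> \<theta>F * F t x v"
    and F_coercive: "F t x v \<ge> \<Lambda> * G v" and \<Lambda>_pos: "\<Lambda> > 0"
    and F_0: "F t x 0 = 0" and \<theta>F_pos: "\<theta>F > 0" and \<theta>_less: "\<theta>F < \<theta>V"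
    and V_superquadratic: "\<exists>C. \<forall>t x. \<theta>V * V t x - Vx t x \<bullet> x \<ge> \<kappa> * norm x - C"
    and V_negative: "\<exists>x. norm x \<ge> \<kappa> \<and> (\<forall>t. V t x \<le> - \<kappa> * norm x)"
    and V_near_0: "t \<in> {-T..T} \<Longrightarrow> G (x /\<^sub>R (4 * T)) \<le> \<rho> / 2 \<Longrightarrow> V t x \<ge> b * G x - \<gamma> t"
    and \<rho>_pos: "\<rho> > 0"
    and young: "t \<in> {-T..T} \<Longrightarrow> 0 \<le> f t \<bullet> x + G x + \<phi> t"
    and small: "integral {-T..T} (\<lambda>t. \<phi> t + \<gamma> t) < min \<Lambda> (b - 1) * \<rho>"
    and V_mean: "(LINT t|M. V t 0) = 0"
begin

text \<open>The function \<open>\<gamma>\<close> is only integrable, so its Riemann sums at arbitrary points are not controlled by its integral.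
  Sample times are therefore chosen where \<open>\<gamma>\<close> is at most its mean over the cell.\<close>
definition sampling :: "nat \<Rightarrow> (nat \<Rightarrow> real) \<Rightarrow> bool" where
  "sampling m s \<longleftrightarrow> m > 0 \<and> (\<forall>i<m. s i \<in> {node m i..node m (Suc i)} \<and>
     mesh m * \<gamma> (s i) \<le> integral {node m i..node m (Suc i)} \<gamma>)"

lemma ex_sampling:
  assumes m: "m > 0"
  obtains s where "sampling m s"
proof -
  have "\<exists>t\<in>{node m i..node m (Suc i)}. mesh m * \<gamma> t \<le> integral {node m i..node m (Suc i)} \<gamma>" if i: "i < m" for i
  proof (rule ccontr)
    let ?a = "node m i" and ?b = "node m (Suc i)"
    assume "\<not> ?thesis"
    then have less: "integral {?a..?b} \<gamma> / mesh m < \<gamma> t" if "t \<in> {?a..?b}" for t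
      using that mesh_pos[OF m] by (simp add: not_le field_simps)
    have ab: "?b - ?a = mesh m" "?a < ?b" using mesh_pos[OF m] by (auto simp: node_Suc)
    have gi: "\<gamma> integrable_on {?a..?b}"
      using i m node_bounds[of i m] node_bounds[of "Suc i" m] by (intro integrable_on_if_integrable_lebesgue_on[OF \<gamma>_int]) auto
    let ?c = "integral {?a..?b} \<gamma> / mesh m"
    have gI: "integrable (lebesgue_on {?a..?b}) (\<lambda>t. \<gamma> t - ?c)"
      using i m node_bounds[of i m] node_bounds[of "Suc i" m]
      by (intro Bochner_Integration.integrable_diff integrable_lebesgue_on_subinterval[OF \<gamma>_int]
        integrable_lebesgue_on_bounded[where B="\<bar>?c\<bar>"]) auto
    have "integral {?a..?b} (\<lambda>t. \<gamma> t - ?c) = 0"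
      using gi ab mesh_pos[OF m] by (subst Henstock_Kurzweil_Integration.integral_diff) auto
    then have "(LINT t|lebesgue_on {?a..?b}. \<gamma> t - ?c) = 0" by (simp only: LINT_eq_integral[OF gI])
    moreover have "AE t in lebesgue_on {?a..?b}. 0 \<le> \<gamma> t - ?c"
      using less by (intro AE_I2) (auto intro: less_imp_le)
    ultimately have "AE t in lebesgue_on {?a..?b}. \<gamma> t - ?c = 0"
      using integral_nonneg_eq_0_iff_AE[OF gI] by blast
    moreover have "AE t in lebesgue_on {?a..?b}. \<gamma> t - ?c \<noteq> 0"
      using less by (intro AE_I2) fastforce
    ultimately have "AE t in lebesgue_on {?a..?b}. False" by eventually_elim simp
    then have "emeasure (lebesgue_on {?a..?b}) (space (lebesgue_on {?a..?b})) = 0"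
      by (simp add: eventually_False ae_filter_eq_bot_iff)
    then show False using ab by (simp add: emeasure_restrict_space)
  qed
  then obtain s where "\<And>i. i < m \<Longrightarrow> s i \<in> {node m i..node m (Suc i)} \<and> mesh m * \<gamma> (s i) \<le> integral {node m i..node m (Suc i)} \<gamma>"
    by metis
  then show ?thesis using that m by (auto simp: sampling_def)
qed

lemma sampling_D:
  assumes "sampling m s"
  shows "m > 0" "i < m \<Longrightarrow> s i \<in> {-T..T}" "i < m \<Longrightarrow> s i \<in> {node m i..node m (Suc i)}"
    "(\<Sum>i<m. mesh m * \<gamma> (s i)) \<le> integral {-T..T} \<gamma>"
proof -
  show m: "m > 0" using assms by (simp add: sampling_def)
  show 1: "s i \<in> {node m i..node m (Suc i)}" if "i < m" for i using assms that by (simp add: sampling_def)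
  show "s i \<in> {-T..T}" if "i < m" for i
    using 1[OF that] node_bounds[of i m] node_bounds[of "Suc i" m] m that by auto
  have "(\<Sum>i<m. mesh m * \<gamma> (s i)) \<le> (\<Sum>i<m. integral {node m i..node m (Suc i)} \<gamma>)"
    using assms by (intro sum_mono) (simp add: sampling_def)
  also have "\<dots> = integral {-T..T} \<gamma>" using sum_cells[OF \<gamma>_int m order_refl] by (simp add: node_m[OF m])
  finally show "(\<Sum>i<m. mesh m * \<gamma> (s i)) \<le> integral {-T..T} \<gamma>" .
qed

text \<open>The discrete counterpart of the integral of \<open>G(u) + G(u')\<close>; its level set at height \<open>\<rho>\<close> is the barrier.\<close>
definition modular :: "nat \<Rightarrow> (nat \<Rightarrow> 'a) \<Rightarrow> real" where
  "modular m x = (\<Sum>i<m. mesh m * (G (x i) + G (vel m x i)))"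

lemma G_scale: "0 \<le> c \<Longrightarrow> c \<le> 1 \<Longrightarrow> G (c *\<^sub>R x) \<le> c * G x"
  using convex_onD[OF G_convex, of c 0 x] by (simp add: G_0)

lemma modular_cont: "continuous_on UNIV (modular m)"
  unfolding modular_def
  by (intro continuous_intros continuous_on_compose2[OF G_cont] vel_cont continuous_on_product_coordinates) auto

lemma modular_0: "modular m (\<lambda>_. 0) = 0" by (simp add: modular_def G_0 vel_def)

text \<open>The point \<open>x j /\<^sub>R (4 * T)\<close> is the midpoint of \<open>x i /\<^sub>R (2 * T)\<close> and \<open>(x j - x i) /\<^sub>R (2 * T)\<close>, the second of
  which is an average of velocities, some of them replaced by \<open>0\<close>. Convexity bounds \<open>G\<close> there by
  averages over the cells, and \<open>2 * T \<ge> 1\<close> allows averages to be replaced by sums weighted with the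
  mesh size. Finally the inequality is averaged over \<open>i\<close>.\<close>
lemma sobolev:
  assumes m: "m > 0" and j: "j < m"
  shows "G (x j /\<^sub>R (4 * T)) \<le> modular m x / 2"
proof -
  have c: "0 \<le> 1 / (2 * T)" "1 / (2 * T) \<le> 1" using T_ge by (auto simp: field_simps)
  have hm: "mesh m / (2 * T) = 1 / real m" using T_pos by (simp add: mesh_def)
  let ?S = "\<Sum>k<m. mesh m * G (vel m x k)"
  have S0: "?S \<ge> 0" using mesh_pos[OF m] by (intro sum_nonneg) (simp add: G_nonneg)
  have le: "G ((x j - x i) /\<^sub>R (2 * T)) \<le> ?S" if ij: "i \<le> j" "j < m" for i j
  proof -
    let ?v = "\<lambda>k. if i \<le> k \<and> k < j then vel m x k else 0"
    have "(x j - x i) /\<^sub>R (2 * T) = (\<Sum>k<m. (1 / real m) *\<^sub>R ?v k)"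
    proof -
      have "inverse (2 * T) * mesh m = 1 / real m" using T_pos by (simp add: mesh_def)
      then show ?thesis
        unfolding node_difference[OF m ij, of x] scaleR_sum_right scaleR_scaleR by (simp only:)
    qed
    then have "G ((x j - x i) /\<^sub>R (2 * T)) \<le> (\<Sum>k<m. (1 / real m) * G (?v k))"
      using m convex_on_sum[of "{..<m}" UNIV G "\<lambda>_. 1 / real m" ?v] G_convex by (simp add: lessThan_empty_iff)
    also have "\<dots> \<le> (\<Sum>k<m. (1 / real m) * G (vel m x k))"
      using G_nonneg by (intro sum_mono mult_left_mono) (auto simp: G_0)
    also have "\<dots> = 1 / (2 * T) * ?S" unfolding hm[symmetric] by (simp add: sum_distrib_left)
    also have "\<dots> \<le> ?S" using mult_right_mono[OF c(2) S0] by simp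
    finally show ?thesis .
  qed
  have ij: "G ((x j - x i) /\<^sub>R (2 * T)) \<le> ?S" if "i < m" for i
  proof (cases "i \<le> j")
    case False
    have "G ((x j - x i) /\<^sub>R (2 * T)) = G (- ((x i - x j) /\<^sub>R (2 * T)))" by (simp add: algebra_simps)
    also have "\<dots> \<le> ?S" unfolding G_even using le[of j i] that False by simp
    finally show ?thesis .
  qed (use le j in blast)
  let ?y = "\<lambda>i. (1/2) *\<^sub>R (x i /\<^sub>R (2 * T)) + (1/2) *\<^sub>R ((x j - x i) /\<^sub>R (2 * T))"
  have y: "?y i = x j /\<^sub>R (4 * T)" for i
  proof -
    have "?y i = (1/2) *\<^sub>R ((x i + (x j - x i)) /\<^sub>R (2 * T))" by (simp only: scaleR_add_right)
    then show ?thesis using T_pos by simp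
  qed
  have Gy: "G (x j /\<^sub>R (4 * T)) \<le> 1 / 2 * (1 / (2 * T) * G (x i)) + 1 / 2 * ?S" if "i < m" for i
  proof -
    have "G (?y i) \<le> 1 / 2 * G (x i /\<^sub>R (2 * T)) + 1 / 2 * G ((x j - x i) /\<^sub>R (2 * T))"
      using convex_onD[OF G_convex, of "1/2" "x i /\<^sub>R (2 * T)" "(x j - x i) /\<^sub>R (2 * T)"] by simp
    moreover have "G (x i /\<^sub>R (2 * T)) \<le> 1 / (2 * T) * G (x i)"
      unfolding inverse_eq_divide by (rule G_scale[OF c])
    ultimately show ?thesis using ij[OF that] unfolding y[of i] by linarith
  qed
  have "(\<Sum>i<m. mesh m * G (x j /\<^sub>R (4 * T))) \<le> (\<Sum>i<m. mesh m * (1 / 2 * (1 / (2 * T) * G (x i)) + 1 / 2 * ?S))"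
    using Gy mesh_pos[OF m] by (intro sum_mono mult_left_mono) auto
  also have "\<dots> = 1 / 2 * (1 / (2 * T)) * (\<Sum>i<m. mesh m * G (x i)) + (real m * mesh m) * (1 / 2 * ?S)"
    by (simp add: distrib_left sum.distrib sum_distrib_left algebra_simps)
  finally have "2 * T * G (x j /\<^sub>R (4 * T)) \<le> 1 / 2 * (1 / (2 * T)) * (\<Sum>i<m. mesh m * G (x i)) + 2 * T * (1 / 2 * ?S)"
    using m_mesh[OF m] by (simp add: mult.assoc[symmetric])
  also have "\<dots> \<le> 2 * T * (1 / 2 * ((\<Sum>i<m. mesh m * G (x i)) + ?S))"
  proof -
    have A: "(\<Sum>i<m. mesh m * G (x i)) \<ge> 0" using mesh_pos[OF m] by (intro sum_nonneg) (simp add: G_nonneg)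
    have "1 / (2 * T) \<le> 2 * T" using c(2) T_ge by linarith
    from mult_right_mono[OF this A] show ?thesis by (simp add: algebra_simps)
  qed
  finally have "G (x j /\<^sub>R (4 * T)) \<le> 1 / 2 * ((\<Sum>i<m. mesh m * G (x i)) + ?S)"
    by (rule mult_left_le_imp_le) (use T_pos in simp)
  also have "(\<Sum>i<m. mesh m * G (x i)) + ?S = modular m x" by (simp add: modular_def distrib_left sum.distrib)
  finally show ?thesis by simp
qed

text \<open>The height of the barrier.\<close>
definition \<alpha> where "\<alpha> = min \<Lambda> (b - 1) * \<rho> - integral {-T..T} (\<lambda>t. \<phi> t + \<gamma> t)"

lemma \<alpha>_pos: "\<alpha> > 0" using small by (simp add: \<alpha>_def)

text \<open>The Sobolev inequality puts each \<open>x i\<close> in the region of the lower bound for \<open>V\<close>, with \<open>b * G\<close>. One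
  unit of \<open>G (x i)\<close> is spent on \<open>f\<close>, by the Fenchel-Young inequality, which leaves the factor \<open>b - 1\<close>.\<close>
lemma J_barrier:
  assumes s: "sampling m s" and Rx: "modular m x = \<rho>"
  shows "J m s x \<ge> \<alpha>"
proof -
  note m = sampling_D(1)[OF s]
  let ?\<phi> = "\<lambda>i. integral {node m i..node m (Suc i)} \<phi>"
  let ?\<mu> = "min \<Lambda> (b - 1)"
  have "?\<mu> * (mesh m * (G (x i) + G (vel m x i))) - mesh m * \<gamma> (s i) - ?\<phi> i
      \<le> mesh m * (F (s i) (x i) (vel m x i) + V (s i) (x i)) + load m i \<bullet> x i" if i: "i < m" for i
  proof -
    let ?a = "node m i" and ?b = "node m (Suc i)"
    have ab: "-T \<le> ?a" "?b \<le> T" "?a \<le> ?b" "?b - ?a = mesh m"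
      using i m node_bounds[of i m] node_bounds[of "Suc i" m] mesh_pos[OF m] by (auto simp: node_Suc)
    have "V (s i) (x i) \<ge> b * G (x i) - \<gamma> (s i)"
      using sobolev[OF m i, of x] Rx sampling_D(2)[OF s i] by (intro V_near_0) auto
    moreover have "F (s i) (x i) (vel m x i) \<ge> \<Lambda> * G (vel m x i)" by (rule F_coercive)
    ultimately have "mesh m * (F (s i) (x i) (vel m x i) + V (s i) (x i)) \<ge> mesh m * (\<Lambda> * G (vel m x i) + (b * G (x i) - \<gamma> (s i)))"
      using mesh_pos[OF m] by (intro mult_left_mono) auto
    moreover have "load m i \<bullet> x i \<ge> - mesh m * G (x i) - ?\<phi> i"
    proof -
      have fi: "f integrable_on {?a..?b}" and pi: "\<phi> integrable_on {?a..?b}"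
        using integrable_on_if_integrable_lebesgue_on[OF f_int ab(1,2)] integrable_on_if_integrable_lebesgue_on[OF \<phi>_int ab(1,2)] by auto
      have fx: "((\<lambda>t. f t \<bullet> x i) has_integral load m i \<bullet> x i) {?a..?b}"
        unfolding load_def using has_integral_linear[OF integrable_integral[OF fi] bounded_linear_inner_left[of "x i"]]
        by (simp add: o_def)
      have "((\<lambda>t. G (x i) + \<phi> t) has_integral (mesh m * G (x i) + ?\<phi> i)) {?a..?b}"
        using has_integral_add[OF has_integral_const_real[of "G (x i)" ?a ?b] integrable_integral[OF pi]] ab by simp
      from has_integral_add[OF fx this] have "0 \<le> load m i \<bullet> x i + (mesh m * G (x i) + ?\<phi> i)"
      proof (rule has_integral_nonneg)
        fix t assume "t \<in> {?a..?b}"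
        then show "0 \<le> f t \<bullet> x i + (G (x i) + \<phi> t)" using young[of t "x i"] ab by (simp add: add.assoc)
      qed
      then show ?thesis by simp
    qed
    moreover have "?\<mu> * (mesh m * G (x i)) \<le> (b - 1) * (mesh m * G (x i))" "?\<mu> * (mesh m * G (vel m x i)) \<le> \<Lambda> * (mesh m * G (vel m x i))"
      using mesh_pos[OF m] G_nonneg by (auto intro!: mult_right_mono)
    ultimately show ?thesis by (simp add: algebra_simps)
  qed
  then have "(\<Sum>i<m. ?\<mu> * (mesh m * (G (x i) + G (vel m x i))) - mesh m * \<gamma> (s i) - ?\<phi> i) \<le> J m s x"
    unfolding J_def by (intro sum_mono) auto
  moreover have "(\<Sum>i<m. ?\<mu> * (mesh m * (G (x i) + G (vel m x i))) - mesh m * \<gamma> (s i) - ?\<phi> i)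
     = ?\<mu> * modular m x - (\<Sum>i<m. mesh m * \<gamma> (s i)) - integral {-T..T} \<phi>"
    using sum_cells[OF \<phi>_int m order_refl] by (simp add: sum_subtractf modular_def sum_distrib_left[symmetric] node_m[OF m])
  moreover have "integral {-T..T} (\<lambda>t. \<phi> t + \<gamma> t) = integral {-T..T} \<phi> + integral {-T..T} \<gamma>"
    by (intro Henstock_Kurzweil_Integration.integral_add integrable_on_if_integrable_lebesgue_on[OF \<phi>_int]
      integrable_on_if_integrable_lebesgue_on[OF \<gamma>_int]) auto
  ultimately show ?thesis using sampling_D(4)[OF s] Rx by (simp add: \<alpha>_def)
qed

lemma modular_bounds_nodes:
  assumes m: "m > 0"
  obtains r where "\<And>x i. modular m x \<le> \<rho> \<Longrightarrow> i < m \<Longrightarrow> norm (x i) \<le> r"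
proof -
  obtain C where C: "\<And>x. 1 * norm x \<le> G x + C" using G_superlinear[of 1] by blast
  have "norm (x i) \<le> \<rho> / mesh m + C" if "modular m x \<le> \<rho>" "i < m" for x i
  proof -
    have "mesh m * (G (x i) + G (vel m x i)) \<le> modular m x"
      unfolding modular_def using that(2) mesh_pos[OF m] G_nonneg by (intro member_le_sum) auto
    moreover have "mesh m * G (x i) \<le> mesh m * (G (x i) + G (vel m x i))"
      using mesh_pos[OF m] G_nonneg by (intro mult_left_mono) auto
    ultimately have "G (x i) \<le> \<rho> / mesh m" using that(1) mesh_pos[OF m] by (simp add: field_simps)
    then show ?thesis using C[of "x i"] by simp
  qed
  then show ?thesis using that by blast
qed

definition f_L1 where "f_L1 = integral {-T..T} (\<lambda>t. norm (f t))"

text \<open>The pointwise inequality behind the energy estimate. Terms linear in \<open>v\<close> and \<open>x\<close> with any factor can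
  be gained from superlinear growth at the price of a constant \<open>C\<close>. The factor provides for the load, which
  has norm \<open>f_L1\<close>, and leaves \<open>K\<close> times the size of \<open>x\<close>.\<close>
definition coercive :: "real \<Rightarrow> real \<Rightarrow> bool" where
  "coercive K C \<longleftrightarrow> (\<forall>t x v. (\<theta>V - \<theta>F) * (\<Lambda> * G v) + (\<theta>V * V t x - Vx t x \<bullet> x)
     \<ge> (\<theta>V - \<theta>F) * \<Lambda> / 2 * G v + (\<bar>\<theta>V - 1\<bar> * f_L1 + K) * norm v + (\<bar>\<theta>V - 1\<bar> * f_L1 + K) / (2 * T) * norm x - C)"

lemma ex_coercive: "\<exists>C. coercive K C"
proof -
  define D where "D = (\<theta>V - \<theta>F) * \<Lambda> / 2"
  define A where "A = \<bar>\<theta>V - 1\<bar> * f_L1 + K"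
  have D: "D > 0" using \<theta>_less \<Lambda>_pos by (simp add: D_def)
  obtain C1 where C1: "\<And>v. A / D * norm v \<le> G v + C1" using G_superlinear by blast
  obtain C2 where C2: "\<And>t x. \<theta>V * V t x - Vx t x \<bullet> x \<ge> A / (2 * T) * norm x - C2" using V_superquadratic by blast
  have 1: "A * norm v \<le> D * G v + D * C1" for v
  proof -
    have "D * (A / D * norm v) \<le> D * (G v + C1)" using D C1 by (intro mult_left_mono) auto
    moreover have "D * (A / D * norm v) = A * norm v" using D by simp
    ultimately show ?thesis by (simp add: distrib_left)
  qed
  have 2: "(\<theta>V - \<theta>F) * (\<Lambda> * G v) = D * G v + D * G v" for v by (simp add: D_def field_simps)
  have "coercive K (D * C1 + C2)"
    unfolding coercive_def D_def[symmetric] A_def[symmetric]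
  proof (intro allI)
    fix t x v
    show "(\<theta>V - \<theta>F) * (\<Lambda> * G v) + (\<theta>V * V t x - Vx t x \<bullet> x) \<ge> D * G v + A * norm v + A / (2 * T) * norm x - (D * C1 + C2)"
      using 1[of v] 2[of v] C2[of x t] by linarith
  qed
  then show ?thesis by blast
qed

text \<open>The homogeneity condition on \<open>F\<close> leaves \<open>(\<theta>V - \<theta>F) * F\<close> of \<open>\<theta>V * F\<close>, which controls the velocities;
  the condition on \<open>V\<close> controls the positions. No constant depends on \<open>m\<close>.\<close>
lemma energy_estimate:
  assumes s: "sampling m s" and C: "coercive K C" and K: "K \<ge> 0"
  shows "\<theta>V * J m s x - (\<Sum>i<m. grad m s x i \<bullet> x i)
    \<ge> (\<theta>V - \<theta>F) * \<Lambda> / 2 * (\<Sum>i<m. mesh m * G (vel m x i)) + K * mean_size m x - 2 * T * C"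
proof -
  note m = sampling_D(1)[OF s]
  let ?D = "(\<theta>V - \<theta>F) * \<Lambda> / 2" and ?A = "\<bar>\<theta>V - 1\<bar> * f_L1 + K"
  let ?Fi = "\<lambda>i. F (s i) (x i) (vel m x i)"
  have cell: "mesh m * (?D * G (vel m x i) + ?A * norm (vel m x i) + ?A / (2 * T) * norm (x i) - C)
     \<le> \<theta>V * (mesh m * (?Fi i + V (s i) (x i))) - mesh m * (Fx (s i) (x i) (vel m x i) \<bullet> x i
        + Fv (s i) (x i) (vel m x i) \<bullet> vel m x i + Vx (s i) (x i) \<bullet> x i)" for i
  proof -
    have F0: "?Fi i \<ge> \<Lambda> * G (vel m x i)" by (rule F_coercive)
    have "(\<theta>V - \<theta>F) * (\<Lambda> * G (vel m x i)) \<le> (\<theta>V - \<theta>F) * ?Fi i"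
      using F0 \<theta>_less by (intro mult_left_mono) auto
    then have "(\<theta>V - \<theta>F) * (\<Lambda> * G (vel m x i)) + (\<theta>V * V (s i) (x i) - Vx (s i) (x i) \<bullet> x i)
      \<le> \<theta>V * (?Fi i + V (s i) (x i)) - (Fx (s i) (x i) (vel m x i) \<bullet> x i
        + Fv (s i) (x i) (vel m x i) \<bullet> vel m x i + Vx (s i) (x i) \<bullet> x i)"
      using F_homogeneity[of "s i" "x i" "vel m x i"] by (simp add: algebra_simps)
    then have "?D * G (vel m x i) + ?A * norm (vel m x i) + ?A / (2 * T) * norm (x i) - C
      \<le> \<theta>V * (?Fi i + V (s i) (x i)) - (Fx (s i) (x i) (vel m x i) \<bullet> x i
        + Fv (s i) (x i) (vel m x i) \<bullet> vel m x i + Vx (s i) (x i) \<bullet> x i)"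
      using C unfolding coercive_def by (meson order_trans)
    from mult_left_mono[OF this less_imp_le[OF mesh_pos[OF m]]] show ?thesis by (simp add: algebra_simps)
  qed
  have "\<bar>\<Sum>i<m. load m i \<bullet> x i\<bar> \<le> (\<Sum>i<m. norm (load m i) * mean_size m x)"
    using abs_inner_le_mult[OF order_refl norm_le_mean_size[OF m]]
    by (intro order_trans[OF sum_abs] sum_mono) auto
  also have "\<dots> \<le> f_L1 * mean_size m x"
  proof -
    have "mean_size m x \<ge> 0" using order_trans[OF norm_ge_zero norm_le_mean_size[OF m, of 0 x]] m by simp
    then show ?thesis
      unfolding sum_distrib_right[symmetric] f_L1_def using sum_load_le[OF m] by (intro mult_right_mono)
  qed
  finally have L: "\<bar>\<Sum>i<m. load m i \<bullet> x i\<bar> \<le> f_L1 * mean_size m x" .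
  have L': "(\<theta>V - 1) * (\<Sum>i<m. load m i \<bullet> x i) \<ge> - (\<bar>\<theta>V - 1\<bar> * f_L1 * mean_size m x)"
  proof -
    have "\<bar>(\<theta>V - 1) * (\<Sum>i<m. load m i \<bullet> x i)\<bar> \<le> \<bar>\<theta>V - 1\<bar> * (f_L1 * mean_size m x)"
      unfolding abs_mult using L by (intro mult_left_mono) auto
    then show ?thesis by (simp add: mult.assoc)
  qed
  have eq: "(\<Sum>i<m. mesh m * (?D * G (vel m x i) + ?A * norm (vel m x i) + ?A / (2 * T) * norm (x i) - C))
     = ?D * (\<Sum>i<m. mesh m * G (vel m x i)) + ?A * mean_size m x - (real m * mesh m) * C"
    unfolding mean_size_def
    by (simp add: sum.distrib sum_subtractf distrib_left right_diff_distrib sum_distrib_left sum_divide_distrib mult_ac)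
  have "?D * (\<Sum>i<m. mesh m * G (vel m x i)) + ?A * mean_size m x - 2 * T * C
     \<le> (\<Sum>i<m. \<theta>V * (mesh m * (?Fi i + V (s i) (x i))) - mesh m * (Fx (s i) (x i) (vel m x i) \<bullet> x i
        + Fv (s i) (x i) (vel m x i) \<bullet> vel m x i + Vx (s i) (x i) \<bullet> x i))"
    unfolding eq[unfolded m_mesh[OF m], symmetric] by (intro sum_mono cell)
  also have "\<dots> = \<theta>V * J m s x - (\<Sum>i<m. grad m s x i \<bullet> x i) - (\<theta>V - 1) * (\<Sum>i<m. load m i \<bullet> x i)"
    unfolding grad_summation_by_parts[OF m] J_def
    by (simp add: sum.distrib sum_subtractf sum_distrib_left algebra_simps)
  finally show ?thesis using L' by (simp add: algebra_simps)
qed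

end

section \<open>Critical points of the discretised action\<close>

context superquadratic
begin

definition critical :: "nat \<Rightarrow> (nat \<Rightarrow> real) \<Rightarrow> (nat \<Rightarrow> 'a) \<Rightarrow> bool" where
  "critical m s x \<longleftrightarrow> (\<forall>i<m. grad m s x i = 0)"

lemma \<theta>V_pos: "\<theta>V > 0" using \<theta>F_pos \<theta>_less by linarith

lemma G_sum_nonneg: "m > 0 \<Longrightarrow> (\<Sum>i<m. mesh m * G (vel m x i)) \<ge> 0"
  using mesh_pos[of m] by (intro sum_nonneg) (simp add: G_nonneg)

lemma ex_low_critical:
  assumes s: "sampling m s" and J0: "J m s (\<lambda>_. 0) < \<alpha>"
  obtains x where "critical m s x" "J m s x \<le> J m s (\<lambda>_. 0)"
proof -
  note m = sampling_D(1)[OF s]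
  interpret gradient_system m "J m s" "grad m s" by (rule J_gradient_system[OF m])
  obtain r where r: "\<And>x i. modular m x \<le> \<rho> \<Longrightarrow> i < m \<Longrightarrow> norm (x i) \<le> r"
    using modular_bounds_nodes[OF m] by blast
  show ?thesis
  proof (rule critical_point_below[where R="modular m" and \<rho>=\<rho> and \<alpha>=\<alpha> and r=r])
    show "modular m (\<lambda>_. 0) < \<rho>" using modular_0 \<rho>_pos by simp
    fix x assume "\<And>i. i < m \<Longrightarrow> grad m s x i = 0" "J m s x \<le> J m s (\<lambda>_. 0)"
    then have "critical m s x" "J m s x \<le> J m s (\<lambda>_. 0)" by (auto simp: critical_def)
    then show thesis by (rule that)
  qed (use modular_cont r J_barrier[OF s] J0 in auto)
qed

text \<open>The mountain pass between \<open>0\<close> and a large constant. Along the segment that joins them the level is bounded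
  independently of \<open>m\<close>, as velocities vanish there. Points with gradient at most \<open>1 / m\<close> in each
  coordinate are bounded, because then the term \<open>J'(x) x\<close> of the energy estimate is at most
  \<open>mean_size m x\<close>; this is why the estimate is used with \<open>K = 2\<close>.\<close>
lemma ex_high_critical:
  obtains B where "\<And>m s. sampling m s \<Longrightarrow> J m s (\<lambda>_. 0) \<le> \<alpha> / 2 \<Longrightarrow>
    \<exists>x. critical m s x \<and> \<alpha> / 2 \<le> J m s x \<and> J m s x \<le> B"
proof -
  obtain C where C: "\<And>x. 1 * norm x \<le> G x + C" using G_superlinear[of 1] by blast
  \<comment> \<open>The first bound puts the constant \<open>y\<close> outside the barrier, the second lets \<open>V\<close> outweigh the load.\<close>
  define \<kappa> where "\<kappa> = max (\<rho> + 1 + C) (f_L1 / (2 * T))"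
  obtain y where y: "norm y \<ge> \<kappa>" "\<And>t. V t y \<le> - \<kappa> * norm y" using V_negative by blast
  obtain BV where BV: "BV \<ge> 0" "\<And>t x v. \<bar>t\<bar> \<le> T \<Longrightarrow> norm x \<le> norm y \<Longrightarrow> norm (v::'a) \<le> 0 \<Longrightarrow> norm (V t x) \<le> BV"
    using bounded_on_box[OF V_cont3] by blast
  define B where "B = 2 * T * BV + f_L1 * norm y"
  obtain Ce where Ce: "coercive 2 Ce" using ex_coercive by blast
  have main: "\<exists>x. critical m s x \<and> \<alpha> / 2 \<le> J m s x \<and> J m s x \<le> B"
    if s: "sampling m s" and J0: "J m s (\<lambda>_. 0) \<le> \<alpha> / 2" for m s
  proof -
    note m = sampling_D(1)[OF s]
    interpret gradient_system m "J m s" "grad m s" by (rule J_gradient_system[OF m])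
    define e where "e i = (if i < m then y else 0)" for i
    have eX: "e \<in> supported_below m" by (simp add: supported_below_def e_def)
    have ve: "vel m (\<lambda>i. z *\<^sub>R e i) i = 0" if "i < m" for i z
      using that m by (simp add: vel_def e_def)
    have load: "\<bar>\<Sum>i<m. load m i \<bullet> (z *\<^sub>R e i)\<bar> \<le> f_L1 * norm y" if z: "0 \<le> z" "z \<le> 1" for z
    proof -
      have "norm (z *\<^sub>R e i) \<le> norm y" for i
        using z by (auto simp: e_def mult_left_le_one_le)
      then have "\<bar>\<Sum>i<m. load m i \<bullet> (z *\<^sub>R e i)\<bar> \<le> (\<Sum>i<m. norm (load m i) * norm y)"
        by (intro order_trans[OF sum_abs] sum_mono abs_inner_le_mult) auto
      also have "\<dots> \<le> f_L1 * norm y"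
        unfolding sum_distrib_right[symmetric] f_L1_def using sum_load_le[OF m] by (intro mult_right_mono) auto
      finally show ?thesis .
    qed
    have Je: "J m s (\<lambda>i. z *\<^sub>R e i) = (\<Sum>i<m. mesh m * V (s i) (z *\<^sub>R y)) + (\<Sum>i<m. load m i \<bullet> (z *\<^sub>R e i))" for z
    proof -
      have "J m s (\<lambda>i. z *\<^sub>R e i) = (\<Sum>i<m. mesh m * V (s i) (z *\<^sub>R y) + load m i \<bullet> (z *\<^sub>R e i))"
        unfolding J_def using ve by (intro sum.cong) (auto simp: F_0 e_def)
      then show ?thesis by (simp add: sum.distrib)
    qed
    have seg: "J m s (\<lambda>i. z *\<^sub>R e i) \<le> B" if z: "0 \<le> z" "z \<le> 1" for z
    proof -
      have "V (s i) (z *\<^sub>R y) \<le> BV" if "i < m" for i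
      proof -
        have "\<bar>s i\<bar> \<le> T" using sampling_D(2)[OF s that] by auto
        then show ?thesis using BV(2)[of "s i" "z *\<^sub>R y" 0] z by (simp add: mult_left_le_one_le)
      qed
      then have "(\<Sum>i<m. mesh m * V (s i) (z *\<^sub>R y)) \<le> (\<Sum>i<m. mesh m * BV)"
        using mesh_pos[OF m] by (intro sum_mono mult_left_mono) auto
      also have "\<dots> = 2 * T * BV" using m_mesh[OF m] by (simp add: mult.assoc[symmetric])
      finally show ?thesis using load[OF z] unfolding Je B_def by linarith
    qed
    have "J m s e \<le> 0"
    proof -
      have "(\<Sum>i<m. mesh m * V (s i) (1 *\<^sub>R y)) \<le> (\<Sum>i<m. mesh m * (- \<kappa> * norm y))"
        using mesh_pos[OF m] y(2) by (intro sum_mono mult_left_mono) auto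
      also have "\<dots> = (real m * mesh m) * (- \<kappa> * norm y)" by simp
      also have "\<dots> = - (2 * T * \<kappa> * norm y)" unfolding m_mesh[OF m] by simp
      finally have "J m s e \<le> - (2 * T * \<kappa> * norm y) + f_L1 * norm y"
        using Je[of 1] load[of 1] by simp
      moreover have "f_L1 / (2 * T) \<le> \<kappa>" by (simp add: \<kappa>_def)
      then have "f_L1 \<le> 2 * T * \<kappa>" using T_pos by (simp add: pos_divide_le_eq mult.commute)
      then have "f_L1 * norm y \<le> 2 * T * \<kappa> * norm y" by (intro mult_right_mono) auto
      ultimately show ?thesis by linarith
    qed
    then have Jel: "J m s e \<le> \<alpha> / 2" using \<alpha>_pos by linarith
    have Re: "modular m e > \<rho>"
    proof -
      have "G y \<ge> \<rho> + 1" using C[of y] y(1) by (simp add: \<kappa>_def)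
      moreover have "modular m e = (\<Sum>i<m. mesh m * G y)"
      proof -
        have "G (e i) + G (vel m e i) = G y" if "i < m" for i
        proof -
          have "vel m e i = 0" using ve[OF that, of 1] by simp
          then show ?thesis using that by (simp add: G_0 e_def)
        qed
        then show ?thesis unfolding modular_def by (intro sum.cong) auto
      qed
      then have "modular m e = 2 * T * G y" using m_mesh[OF m] by (simp add: mult.assoc[symmetric])
      moreover have "1 * G y \<le> 2 * T * G y" using T_ge G_nonneg[of y] by (intro mult_right_mono) auto
      ultimately show ?thesis by linarith
    qed
    have PS: "norm (x i) \<le> \<theta>V * B + 2 * T * Ce"
      if "J m s x \<le> B" and gs: "\<And>i. i < m \<Longrightarrow> norm (grad m s x i) \<le> 1 / real m" and i: "i < m" for x i
    proof -
      have "\<bar>\<Sum>i<m. grad m s x i \<bullet> x i\<bar> \<le> (\<Sum>i<m. 1 / real m * mean_size m x)"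
        using abs_inner_le_mult[OF gs norm_le_mean_size[OF m]]
        by (intro order_trans[OF sum_abs] sum_mono) auto
      also have "\<dots> = mean_size m x" using m by simp
      finally have "\<bar>\<Sum>i<m. grad m s x i \<bullet> x i\<bar> \<le> mean_size m x" .
      moreover have "\<theta>V * J m s x \<le> \<theta>V * B" using that(1) \<theta>V_pos by (intro mult_left_mono) auto
      moreover have "(\<theta>V - \<theta>F) * \<Lambda> / 2 * (\<Sum>i<m. mesh m * G (vel m x i)) \<ge> 0"
        using \<theta>_less \<Lambda>_pos G_sum_nonneg[OF m, of x] by simp
      moreover have "a \<le> k + q" if "\<bar>c\<bar> \<le> a" "j \<le> k" "0 \<le> p" "p + 2 * a - q \<le> j - c" for a c j k p q :: real
        using that by linarith
      ultimately have "mean_size m x \<le> \<theta>V * B + 2 * T * Ce"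
        using energy_estimate[OF s Ce zero_le_numeral, of x] by blast
      then show ?thesis using norm_le_mean_size[OF m i, of x] by linarith
    qed
    have R0: "modular m (\<lambda>_. 0) < \<rho>" using modular_0 \<rho>_pos by simp
    have al: "\<alpha> / 2 < \<alpha>" using \<alpha>_pos by simp
    have mu: "1 / real m > 0" using m by simp
    show ?thesis
    proof (rule mountain_pass[where R="modular m" and \<rho>=\<rho> and \<alpha>=\<alpha> and e=e and c="\<alpha> / 2" and B=B and \<mu>\<^sub>0="1 / real m"
          and r="\<theta>V * B + 2 * T * Ce"])
      fix x assume "\<And>i. i < m \<Longrightarrow> grad m s x i = 0" "\<alpha> / 2 \<le> J m s x" "J m s x \<le> B"
      then show ?thesis by (auto simp: critical_def)
    qed (use modular_cont R0 Re eX J_barrier[OF s] J0 Jel al seg PS mu in auto)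
  qed
  then show ?thesis using that by blast
qed

text \<open>The sum of the discrete Euler-Lagrange equations at the nodes up to \<open>i\<close>; the cell before node \<open>0\<close> is the last
  one.\<close>
lemma momentum_telescope:
  assumes m: "m > 0" and crit: "critical m s x" and i: "i < m"
  shows "Fv (s i) (x i) (vel m x i) = Fv (s (m - 1)) (x (m - 1)) (vel m x (m - 1))
    + (\<Sum>j\<le>i. mesh m *\<^sub>R (Fx (s j) (x j) (vel m x j) + Vx (s j) (x j)) + load m j)"
  using i
proof (induction i)
  case 0
  have "grad m s x 0 = 0" using crit m by (simp add: critical_def)
  then show ?case using m by (simp add: grad_def Let_def algebra_simps)
next
  case (Suc i)
  have "grad m s x (Suc i) = 0" using crit Suc.prems by (simp add: critical_def)
  moreover have "(Suc i + m - 1) mod m = i" using Suc.prems by simp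
  ultimately show ?case using Suc by (simp add: grad_def Let_def algebra_simps)
qed

text \<open>The energy estimate bounds positions and the sum of \<open>G\<close> over the velocities, hence the sum of the
  forces. So momenta in different cells differ by a bounded amount, and one of them is at most the mean,
  which the growth condition bounds: all momenta are bounded by some \<open>W\<close>. The tangent to \<open>F\<close> at a velocity \<open>v\<close>,
  evaluated at \<open>0\<close> where \<open>F\<close> vanishes, gives \<open>\<Lambda> * G v \<le> W * norm v\<close> and thereby bounds \<open>v\<close>.\<close>
lemma critical_bounds:
  "\<exists>r L W. \<forall>m s x. sampling m s \<longrightarrow> critical m s x \<longrightarrow> J m s x \<le> B \<longrightarrow>
    (\<forall>i<m. norm (x i) \<le> r \<and> norm (vel m x i) \<le> L \<and> norm (Fv (s i) (x i) (vel m x i)) \<le> W)"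
proof -
  define D where "D = (\<theta>V - \<theta>F) * \<Lambda> / 2"
  have D: "D > 0" using \<theta>_less \<Lambda>_pos by (simp add: D_def)
  obtain Ce where Ce: "coercive 1 Ce" using ex_coercive by blast
  define r where "r = \<theta>V * B + 2 * T * Ce"
  define E where "E = r / D"
  obtain C C' where C: "C \<ge> 0" "\<And>t x v. t \<in> {-T..T} \<Longrightarrow> norm x \<le> r \<Longrightarrow>
        norm (Fx t x v) \<le> C' + C * \<gamma> t + C * G v \<and> norm (Fv t x v) \<le> C' + C * \<gamma> t + C * G v"
    using growth[of r] by blast
  obtain BV where BV: "BV \<ge> 0" "\<And>t x v. \<bar>t\<bar> \<le> T \<Longrightarrow> norm x \<le> r \<Longrightarrow> norm (v::'a) \<le> 0 \<Longrightarrow> norm (Vx t x) \<le> BV"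
    using bounded_on_box[OF Vx_cont3] by blast
  define C1 where "C1 = 2 * T * C' + C * integral {-T..T} \<gamma> + C * E"
  \<comment> \<open>the bound for the smallest momentum, and twice the total change along the interval, since two
    momenta are compared through the one in the last cell\<close>
  define W where "W = C1 / (2 * T) + 2 * (C1 + 2 * T * BV + f_L1)"
  obtain C3 where C3: "\<And>v. (W + 1) / \<Lambda> * norm v \<le> G v + C3" using G_superlinear by blast
  have "norm (x i) \<le> r \<and> norm (vel m x i) \<le> \<Lambda> * C3 \<and> norm (Fv (s i) (x i) (vel m x i)) \<le> W"
    if s: "sampling m s" and crit: "critical m s x" and JB: "J m s x \<le> B" and i: "i < m" for m s x i
  proof -
    note m = sampling_D(1)[OF s]
    let ?v = "vel m x"
    let ?w = "\<lambda>i. Fv (s i) (x i) (?v i)"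
    have "(\<Sum>i<m. grad m s x i \<bullet> x i) = 0" using crit by (simp add: critical_def)
    moreover have "\<theta>V * J m s x \<le> \<theta>V * B" using JB \<theta>V_pos by (intro mult_left_mono) auto
    ultimately have en: "D * (\<Sum>i<m. mesh m * G (?v i)) + mean_size m x \<le> r"
      using energy_estimate[OF s Ce zero_le_one, of x] unfolding D_def r_def by simp
    have ms: "mean_size m x \<ge> 0" using order_trans[OF norm_ge_zero norm_le_mean_size[OF m i]] .
    have xr: "norm (x j) \<le> r" if "j < m" for j
    proof -
      have "D * (\<Sum>i<m. mesh m * G (?v i)) \<ge> 0" using D G_sum_nonneg[OF m, of x] by simp
      then show ?thesis using en norm_le_mean_size[OF m that, of x] by linarith
    qed
    have GE: "(\<Sum>i<m. mesh m * G (?v i)) \<le> E"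
      using en ms D by (simp add: E_def pos_le_divide_eq mult.commute)
    have S: "(\<Sum>i<m. mesh m * (C' + C * \<gamma> (s i) + C * G (?v i))) \<le> C1"
    proof -
      have "(\<Sum>i<m. mesh m * (C' + C * \<gamma> (s i) + C * G (?v i)))
          = (real m * mesh m) * C' + C * (\<Sum>i<m. mesh m * \<gamma> (s i)) + C * (\<Sum>i<m. mesh m * G (?v i))"
        by (simp add: distrib_left sum.distrib sum_distrib_left mult_ac)
      also have "\<dots> \<le> 2 * T * C' + C * integral {-T..T} \<gamma> + C * E"
        unfolding m_mesh[OF m] using C(1) GE sampling_D(4)[OF s] by (intro add_mono mult_left_mono order_refl)
      finally show ?thesis by (simp add: C1_def)
    qed
    have Fx_b: "norm (Fx (s j) (x j) (?v j)) \<le> C' + C * \<gamma> (s j) + C * G (?v j)"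
      and Fv_b: "norm (?w j) \<le> C' + C * \<gamma> (s j) + C * G (?v j)" if "j < m" for j
      using C(2)[OF sampling_D(2)[OF s that] xr[OF that]] by auto
    let ?\<Delta> = "\<lambda>j. mesh m *\<^sub>R (Fx (s j) (x j) (?v j) + Vx (s j) (x j)) + load m j"
    have "(\<Sum>j<m. norm (?\<Delta> j)) \<le> (\<Sum>j<m. mesh m * (C' + C * \<gamma> (s j) + C * G (?v j)) + mesh m * BV + norm (load m j))"
    proof (rule sum_mono)
      fix j assume "j \<in> {..<m}"
      then have j: "j < m" by simp
      have "norm (Vx (s j) (x j)) \<le> BV" using BV(2)[of "s j" "x j" 0] sampling_D(2)[OF s j] xr[OF j] by auto
      then have "norm (Fx (s j) (x j) (?v j) + Vx (s j) (x j)) \<le> (C' + C * \<gamma> (s j) + C * G (?v j)) + BV"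
        using Fx_b[OF j] by (intro norm_triangle_le add_mono)
      then have "mesh m * norm (Fx (s j) (x j) (?v j) + Vx (s j) (x j)) \<le> mesh m * ((C' + C * \<gamma> (s j) + C * G (?v j)) + BV)"
        using mesh_pos[OF m] by (intro mult_left_mono) auto
      then show "norm (?\<Delta> j) \<le> mesh m * (C' + C * \<gamma> (s j) + C * G (?v j)) + mesh m * BV + norm (load m j)"
        using norm_triangle_ineq[of "mesh m *\<^sub>R (Fx (s j) (x j) (?v j) + Vx (s j) (x j))" "load m j"] mesh_pos[OF m]
        by (simp add: distrib_left)
    qed
    also have "\<dots> \<le> C1 + 2 * T * BV + f_L1"
    proof -
      have "(\<Sum>j<m. mesh m * BV) = 2 * T * BV" using m_mesh[OF m] by (simp add: mult.assoc[symmetric])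
      then show ?thesis using S sum_load_le[OF m] unfolding sum.distrib f_L1_def by linarith
    qed
    finally have \<Delta>: "(\<Sum>j<m. norm (?\<Delta> j)) \<le> C1 + 2 * T * BV + f_L1" .
    have dist0: "norm (?w j - ?w (m - 1)) \<le> C1 + 2 * T * BV + f_L1" if "j < m" for j
    proof -
      have "norm (?w j - ?w (m - 1)) \<le> (\<Sum>k\<le>j. norm (?\<Delta> k))"
        unfolding momentum_telescope[OF m crit that] by (simp add: norm_sum)
      also have "\<dots> \<le> (\<Sum>k<m. norm (?\<Delta> k))" using that by (intro sum_mono2) auto
      finally show ?thesis using \<Delta> by linarith
    qed
    have "\<exists>k<m. norm (?w k) \<le> C1 / (2 * T)"
    proof (rule ccontr)
      assume "\<not> ?thesis"
      then have gt: "norm (?w k) > C1 / (2 * T)" if "k < m" for k using that by (auto simp: not_le)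
      have "C1 = (\<Sum>k<m. mesh m * (C1 / (2 * T)))" using m_mesh[OF m] T_pos
        by (simp add: mult.assoc[symmetric])
      also have "\<dots> < (\<Sum>k<m. mesh m * norm (?w k))"
        using gt mesh_pos[OF m] m by (intro sum_strict_mono mult_strict_left_mono) auto
      also have "\<dots> \<le> (\<Sum>k<m. mesh m * (C' + C * \<gamma> (s k) + C * G (?v k)))"
        using Fv_b mesh_pos[OF m] by (intro sum_mono mult_left_mono) auto
      also have "\<dots> \<le> C1" by (rule S)
      finally show False by simp
    qed
    then obtain k where k: "k < m" "norm (?w k) \<le> C1 / (2 * T)" by blast
    have wW: "norm (?w i) \<le> W"
    proof -
      have "norm (?w i) \<le> norm (?w i - ?w (m - 1)) + norm (?w k - ?w (m - 1)) + norm (?w k)"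
        using norm_triangle_ineq[of "?w i - ?w (m - 1)" "?w (m - 1) - ?w k"]
          norm_triangle_ineq[of "?w i - ?w k" "?w k"] by (simp add: norm_minus_commute)
      then show ?thesis using dist0[OF i] dist0[OF k(1)] k(2) unfolding W_def mult_2 by linarith
    qed
    have "\<Lambda> * G (?v i) \<le> ?w i \<bullet> ?v i"
      using F_coercive[of "?v i" "s i" "x i"] F_tangent[of "s i" "x i" "?v i" 0] F_0[of "s i" "x i"] by simp
    also have "\<dots> \<le> W * norm (?v i)" using abs_inner_le_mult[OF wW order_refl, of "?v i"] by linarith
    finally have "\<Lambda> * G (?v i) \<le> W * norm (?v i)" .
    moreover have "\<Lambda> * ((W + 1) / \<Lambda> * norm (?v i)) \<le> \<Lambda> * (G (?v i) + C3)"
      using C3 \<Lambda>_pos by (intro mult_left_mono) auto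
    then have "(W + 1) * norm (?v i) \<le> \<Lambda> * G (?v i) + \<Lambda> * C3" using \<Lambda>_pos by (simp add: distrib_left)
    ultimately have "norm (?v i) \<le> \<Lambda> * C3" by (simp add: distrib_right)
    then show ?thesis using xr[OF i] wW by blast
  qed
  then show ?thesis by blast
qed

end

section \<open>Passage to the limit\<close>

context lagrangian
begin

text \<open>The cell that contains \<open>t\<close>. The minimum puts the right end \<open>T\<close> into the last cell.\<close>
definition idx :: "nat \<Rightarrow> real \<Rightarrow> nat" where
  "idx m t = min (m - 1) (nat \<lfloor>(t + T) / mesh m\<rfloor>)"

lemma idx_less: "m > 0 \<Longrightarrow> idx m t < m"
  by (simp add: idx_def min_less_iff_disj)

lemma idx_eq:
  assumes m: "m > 0" and i: "i < m" and t: "node m i \<le> t" "t < node m (Suc i)"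
  shows "idx m t = i"
proof -
  have "real i \<le> (t + T) / mesh m" "(t + T) / mesh m < real i + 1"
    using t mesh_pos[OF m] by (auto simp: node_def field_simps)
  then have "\<lfloor>(t + T) / mesh m\<rfloor> = int i" by (intro floor_unique) auto
  then show ?thesis using i by (simp add: idx_def)
qed

lemma idx_bounds:
  assumes m: "m > 0" and t: "t \<in> {-T..T}"
  shows "node m (idx m t) \<le> t" "t \<le> node m (Suc (idx m t))"
proof -
  let ?y = "(t + T) / mesh m"
  have y: "0 \<le> ?y" using t mesh_pos[OF m] by simp
  have tm: "t = -T + ?y * mesh m" using mesh_pos[OF m] by (simp add: field_simps)
  have fl: "real (nat \<lfloor>?y\<rfloor>) \<le> ?y" "?y < real (nat \<lfloor>?y\<rfloor>) + 1" using y by linarith+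
  have "real (idx m t) \<le> ?y" using fl(1) by (simp add: idx_def min_def)
  from mult_right_mono[OF this less_imp_le[OF mesh_pos[OF m]]]
  show "node m (idx m t) \<le> t" using tm by (simp add: node_def)
  show "t \<le> node m (Suc (idx m t))"
  proof (cases "nat \<lfloor>?y\<rfloor> \<le> m - 1")
    case True
    then have "?y \<le> real (Suc (idx m t))" using fl(2) by (simp add: idx_def)
    from mult_right_mono[OF this less_imp_le[OF mesh_pos[OF m]]]
    show ?thesis using tm by (simp add: node_def)
  next
    case False
    then have "Suc (idx m t) = m" using m by (simp add: idx_def)
    then show ?thesis using node_m[OF m] t by simp
  qed
qed

lemma cell_in: "m > 0 \<Longrightarrow> i < m \<Longrightarrow> -T \<le> node m i \<and> node m (Suc i) \<le> T \<and> node m i \<le> node m (Suc i)"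
  using node_bounds[of i m] node_bounds[of "Suc i" m] node_mono[of i "Suc i" m] by auto

lemma step_measurable: "(\<lambda>t. y (idx m t)) \<in> borel_measurable M" for y :: "nat \<Rightarrow> 'b::topological_space"
proof -
  have "(\<lambda>t. (t + T) / mesh m) \<in> borel_measurable M" using id_meas by measurable
  then have "(\<lambda>t. \<lfloor>(t + T) / mesh m\<rfloor>) \<in> measurable M (count_space UNIV)" by measurable
  then have "(\<lambda>t. min (m - 1) (nat \<lfloor>(t + T) / mesh m\<rfloor>)) \<in> measurable M (count_space UNIV)"
    by (rule measurable_compose) simp
  then have "idx m \<in> measurable M (count_space UNIV)" by (simp add: idx_def[abs_def])
  then show ?thesis by (rule measurable_compose) simp
qed

lemma step_integrable:
  fixes y :: "nat \<Rightarrow> 'b::euclidean_space"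
  assumes m: "m > 0"
  shows "integrable M (\<lambda>t. y (idx m t))"
proof (rule integrable_lebesgue_on_bounded[OF step_measurable])
  show "norm (y (idx m t)) \<le> (\<Sum>i<m. norm (y i))" for t
    using idx_less[OF m] by (intro member_le_sum) auto
qed

lemma cell_integral:
  fixes q :: "real \<Rightarrow> nat \<Rightarrow> 'b::euclidean_space"
  assumes m: "m > 0" and i: "i < m" and t: "node m i \<le> t" "t \<le> node m (Suc i)"
  shows "integral {node m i..t} (\<lambda>\<tau>. q \<tau> (idx m \<tau>)) = integral {node m i..t} (\<lambda>\<tau>. q \<tau> i)"
proof (rule integral_spike[of "{node m (Suc i)}"])
  fix \<tau> assume "\<tau> \<in> {node m i..t} - {node m (Suc i)}"
  then have "idx m \<tau> = i" using t by (intro idx_eq[OF m i]) auto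
  then show "q \<tau> i = q \<tau> (idx m \<tau>)" by simp
qed simp

lemma step_integral_node:
  fixes y :: "nat \<Rightarrow> 'b::euclidean_space"
  assumes m: "m > 0" and k: "k \<le> m"
  shows "integral {-T..node m k} (\<lambda>t. y (idx m t)) = (\<Sum>i<k. mesh m *\<^sub>R y i)"
proof -
  have "integral {node m i..node m (Suc i)} (\<lambda>t. y (idx m t)) = mesh m *\<^sub>R y i" if "i < m" for i
    using cell_integral[OF m that _ order_refl, of "\<lambda>_. y"] cell_in[OF m that] by (simp add: node_Suc)
  then show ?thesis
    unfolding sum_cells[OF step_integrable[OF m] m k, symmetric] using k by (intro sum.cong) auto
qed

lemma step_integral:
  fixes y :: "nat \<Rightarrow> 'b::euclidean_space"
  assumes m: "m > 0" and t: "t \<in> {-T..T}"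
  defines "i \<equiv> idx m t"
  shows "integral {-T..t} (\<lambda>t. y (idx m t)) = (\<Sum>j<i. mesh m *\<^sub>R y j) + (t - node m i) *\<^sub>R y i"
proof -
  have i: "i < m" using idx_less[OF m] by (simp add: i_def)
  have b: "node m i \<le> t" "t \<le> node m (Suc i)" using idx_bounds[OF m t] by (simp_all add: i_def)
  have "integral {-T..node m i} (\<lambda>t. y (idx m t)) + integral {node m i..t} (\<lambda>t. y (idx m t)) = integral {-T..t} (\<lambda>t. y (idx m t))"
  proof (rule Henstock_Kurzweil_Integration.integral_combine)
    show "(\<lambda>t. y (idx m t)) integrable_on {-T..t}"
      using t by (intro integrable_on_if_integrable_lebesgue_on[OF step_integrable[OF m]]) auto
  qed (use b cell_in[OF m i] in auto)
  moreover have "integral {node m i..t} (\<lambda>t. y (idx m t)) = (t - node m i) *\<^sub>R y i"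
    using cell_integral[OF m i b, of "\<lambda>_. y"] b by simp
  ultimately show ?thesis using step_integral_node[OF m, of i y] i by simp
qed

lemma J_eq_integral:
  assumes m: "m > 0"
  shows "J m s x = (LINT t|M. F (s (idx m t)) (x (idx m t)) (vel m x (idx m t)) + V (s (idx m t)) (x (idx m t)) + f t \<bullet> x (idx m t))"
proof -
  let ?a = "\<lambda>i. F (s i) (x i) (vel m x i) + V (s i) (x i)"
  let ?q = "\<lambda>t i. ?a i + f t \<bullet> x i"
  have fx: "integrable M (\<lambda>t. f t \<bullet> x (idx m t))"
  proof (rule Bochner_Integration.integrable_bound)
    show "integrable M (\<lambda>t. norm (f t) * (\<Sum>i<m. norm (x i)))" using f_int by simp
    show "(\<lambda>t. f t \<bullet> x (idx m t)) \<in> borel_measurable M"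
      using f_int by (intro borel_measurable_inner step_measurable) simp
    have "norm (x (idx m t)) \<le> (\<Sum>i<m. norm (x i))" for t
      using idx_less[OF m] by (intro member_le_sum) auto
    then show "AE t in M. norm (f t \<bullet> x (idx m t)) \<le> norm (norm (f t) * (\<Sum>i<m. norm (x i)))"
      using abs_inner_le_mult[OF order_refl] by (intro AE_I2) (fastforce intro: order_trans[OF _ abs_ge_self])
  qed
  have qI: "integrable M (\<lambda>t. ?q t (idx m t))"
    by (intro Bochner_Integration.integrable_add fx step_integrable[OF m, of ?a])
  have "integral {node m i..node m (Suc i)} (\<lambda>t. ?q t (idx m t)) = mesh m * ?a i + load m i \<bullet> x i" if i: "i < m" for i
  proof -
    note c = cell_in[OF m i]
    have fi: "f integrable_on {node m i..node m (Suc i)}"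
      using c by (intro integrable_on_if_integrable_lebesgue_on[OF f_int]) auto
    have "((\<lambda>t. f t \<bullet> x i) has_integral load m i \<bullet> x i) {node m i..node m (Suc i)}"
      unfolding load_def using has_integral_linear[OF integrable_integral[OF fi] bounded_linear_inner_left[of "x i"]]
      by (simp add: o_def)
    from has_integral_add[OF has_integral_const_real[of "?a i" "node m i" "node m (Suc i)"] this]
    have "integral {node m i..node m (Suc i)} (\<lambda>t. ?q t i) = mesh m * ?a i + load m i \<bullet> x i"
      using c by (intro integral_unique) (simp add: node_Suc)
    then show ?thesis using cell_integral[OF m i _ order_refl, of ?q] c by simp
  qed
  then have "J m s x = (\<Sum>i<m. integral {node m i..node m (Suc i)} (\<lambda>t. ?q t (idx m t)))"
    unfolding J_def by (intro sum.cong) auto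
  also have "\<dots> = integral {-T..T} (\<lambda>t. ?q t (idx m t))"
    using sum_cells[OF qI m order_refl] by (simp add: node_m[OF m])
  also have "\<dots> = (LINT t|M. ?q t (idx m t))" by (rule LINT_eq_integral[OF qI, symmetric])
  finally show ?thesis .
qed

lemma mesh_tendsto_0:
  assumes "filterlim m at_top sequentially"
  shows "(\<lambda>n. mesh (m n)) \<longlonglongrightarrow> 0"
proof -
  have "filterlim (\<lambda>n. real (m n)) at_top sequentially"
    using assms by (rule filterlim_compose[OF filterlim_real_sequentially])
  then show ?thesis unfolding mesh_def by (rule tendsto_divide_0[OF tendsto_const filterlim_at_top_imp_at_infinity])
qed

text \<open>Whatever lies in the cell of \<open>t\<close> is within one mesh size of \<open>t\<close>; sample times and nodes are used in this
  way.\<close>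
lemma near_idx_tendsto:
  assumes m: "\<And>n. m n > 0" "filterlim m at_top sequentially" and t: "t \<in> {-T..T}"
    and p: "\<And>n. node (m n) (idx (m n) t) \<le> p n" "\<And>n. p n \<le> node (m n) (Suc (idx (m n) t))"
  shows "p \<longlonglongrightarrow> t"
proof -
  have "(\<lambda>n. p n - t) \<longlonglongrightarrow> 0"
  proof (rule Lim_null_comparison[OF _ mesh_tendsto_0[OF m(2)]])
    have "norm (p n - t) \<le> mesh (m n)" for n
      using idx_bounds[OF m(1) t, of n] p[of n] by (simp add: node_Suc abs_le_iff)
    then show "\<forall>\<^sub>F n in sequentially. norm (p n - t) \<le> mesh (m n)" by simp
  qed
  then show ?thesis by (rule LIM_zero_cancel)
qed

end

context superquadratic
begin

text \<open>Discrete critical points below a level are step functions of time that satisfy the hypotheses for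
  convergence of approximate solutions: the telescoped equation is the integrated Euler-Lagrange
  equation with the integral taken up to the right end of the cell of \<open>t\<close> instead of \<open>t\<close>.\<close>
lemma solution_from_critical_points:
  assumes m_lim: "filterlim m at_top sequentially"
    and s: "\<And>n. sampling (m n) (s n)" and crit: "\<And>n. critical (m n) (s n) (x n)"
    and JB: "\<And>n. J (m n) (s n) (x n) \<le> B"
  obtains k u d where "strict_mono (k :: nat \<Rightarrow> nat)" "weak_solution u d"
    "(\<lambda>n. J (m (k n)) (s (k n)) (x (k n))) \<longlonglongrightarrow> action u d"
proof -
  note m = sampling_D(1)[OF s]
  obtain r L W where bd: "\<And>m s x i. sampling m s \<Longrightarrow> critical m s x \<Longrightarrow> J m s x \<le> B \<Longrightarrow> i < m \<Longrightarrow>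
      norm (x i) \<le> r \<and> norm (vel m x i) \<le> L \<and> norm (Fv (s i) (x i) (vel m x i)) \<le> W"
    using critical_bounds[of B] by blast
  have b: "norm (x n i) \<le> r" "norm (vel (m n) (x n) i) \<le> L" "norm (Fv (s n i) (x n i) (vel (m n) (x n) i)) \<le> W" if "i < m n" for n i
    using bd[OF s crit JB that] by auto
  obtain B1 where B1: "B1 \<ge> 0" "\<And>t x v. \<bar>t\<bar> \<le> T \<Longrightarrow> norm x \<le> r \<Longrightarrow> norm v \<le> L \<Longrightarrow> norm (Fx t x v) \<le> B1"
    using bounded_on_box[OF Fx_cont] by blast
  obtain B2 where B2: "B2 \<ge> 0" "\<And>t x v. \<bar>t\<bar> \<le> T \<Longrightarrow> norm x \<le> r \<Longrightarrow> norm (v::'a) \<le> L \<Longrightarrow> norm (Vx t x) \<le> B2"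
    using bounded_on_box[OF Vx_cont3] by blast
  define j where "j n t = idx (m n) t" for n t
  have jm: "j n t < m n" for n t using idx_less[OF m] by (simp add: j_def)
  have sT: "\<bar>s n i\<bar> \<le> T" if "i < m n" for n i using sampling_D(2)[OF s that] by auto
  let ?\<sigma> = "\<lambda>n t. s n (j n t)" and ?X = "\<lambda>n t. x n (j n t)" and ?v = "\<lambda>n t. vel (m n) (x n) (j n t)"
  define q where "q n i = Fx (s n i) (x n i) (vel (m n) (x n) i) + Vx (s n i) (x n i)" for n i
  have qb: "norm (q n i) \<le> B1 + B2" if i: "i < m n" for n i
    unfolding q_def using B1(2)[OF sT[OF i] b(1,2)[OF i]] B2(2)[OF sT[OF i] b(1,2)[OF i]]
    by (intro norm_triangle_le add_mono)
  define c where "c n = Fv (s n (m n - 1)) (x n (m n - 1)) (vel (m n) (x n) (m n - 1))" for n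
  have vel_sum: "x n 0 + (\<Sum>k<i. mesh (m n) *\<^sub>R vel (m n) (x n) k) = x n i" if "i < m n" for n i
    using that
  proof (induction i)
    case (Suc i)
    have "mesh (m n) *\<^sub>R vel (m n) (x n) i = x n (Suc i) - x n i"
      using Suc.prems mesh_pos[OF m, of n] by (simp add: vel_def)
    then show ?case using Suc by (simp add: add.assoc[symmetric])
  qed simp
  obtain k u d where "strict_mono (k :: nat \<Rightarrow> nat)" "weak_solution u d"
    "(\<lambda>n. LINT t|M. F (?\<sigma> (k n) t) (?X (k n) t) (?v (k n) t) + V (?\<sigma> (k n) t) (?X (k n) t) + f t \<bullet> ?X (k n) t)
        \<longlonglongrightarrow> action u d"
  proof (rule approximate_solutions_converge[of ?\<sigma> ?X ?v r L "\<lambda>n. x n 0" c W])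
    show "?\<sigma> n \<in> borel_measurable M" "?X n \<in> borel_measurable M" "?v n \<in> borel_measurable M" for n
      unfolding j_def by (rule step_measurable)+
    show "\<bar>?\<sigma> n t\<bar> \<le> T" "norm (?X n t) \<le> r" "norm (?v n t) \<le> L" for n t
      using sT[OF jm] b[OF jm] by auto
    show "norm (x n 0) \<le> r" "norm (c n) \<le> W" for n
      using b(1)[of 0 n] b(3)[of "m n - 1" n] m[of n] by (auto simp: c_def)
    show "integral {-T..T} (?v n) = 0" for n
    proof -
      have "integral {-T..node (m n) (m n)} (?v n) = (\<Sum>i<m n. mesh (m n) *\<^sub>R vel (m n) (x n) i)"
        unfolding j_def by (rule step_integral_node[OF m order_refl])
      also have "\<dots> = (\<Sum>i<m n. x n (Suc i mod m n) - x n i)"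
        using mesh_pos[OF m, of n] by (simp add: vel_def)
      also have "\<dots> = 0"
        using sum.reindex_bij_betw[OF bij_cyclic_Suc[OF m], of "x n" n] by (simp add: sum_subtractf)
      finally show ?thesis by (simp add: node_m[OF m])
    qed
    fix t assume t: "t \<in> {-T..T}"
    show "(\<lambda>n. ?\<sigma> n t) \<longlonglongrightarrow> t"
    proof (rule near_idx_tendsto[OF m m_lim t])
      show "node (m n) (idx (m n) t) \<le> ?\<sigma> n t" "?\<sigma> n t \<le> node (m n) (Suc (idx (m n) t))" for n
        using sampling_D(3)[OF s jm, of n t] by (auto simp: j_def)
    qed
    show "(\<lambda>n. ?X n t - (x n 0 + integral {-T..t} (?v n))) \<longlonglongrightarrow> 0"
    proof (rule Lim_null_comparison)
      have "norm (?X n t - (x n 0 + integral {-T..t} (?v n))) \<le> mesh (m n) * L" for n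
      proof -
        have "x n 0 + integral {-T..t} (?v n) = ?X n t + (t - node (m n) (j n t)) *\<^sub>R ?v n t"
          using step_integral[OF m t, of "vel (m n) (x n)" n] vel_sum[OF jm, of n t]
          by (simp add: j_def add.assoc[symmetric])
        moreover have "\<bar>t - node (m n) (j n t)\<bar> \<le> mesh (m n)"
          using idx_bounds[OF m t, of n] by (simp add: node_Suc j_def abs_le_iff)
        then have "\<bar>t - node (m n) (j n t)\<bar> * norm (?v n t) \<le> mesh (m n) * L"
          using b(2)[OF jm, of n t] by (intro mult_mono) auto
        ultimately show ?thesis by simp
      qed
      then show "\<forall>\<^sub>F n in sequentially. norm (?X n t - (x n 0 + integral {-T..t} (?v n))) \<le> mesh (m n) * L" by simp
      show "(\<lambda>n. mesh (m n) * L) \<longlonglongrightarrow> 0"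
        using tendsto_mult[OF mesh_tendsto_0[OF m_lim] tendsto_const[of L]] by simp
    qed
  next
    define \<Phi> where "\<Phi> t = integral {-T..t} f" for t
    have \<Phi>c: "continuous_on {-T..T} \<Phi>"
      unfolding \<Phi>_def by (intro indefinite_integral_continuous_1 integrable_on_if_integrable_lebesgue_on[OF f_int]) auto
    show "AE t in M. (\<lambda>n. Fv (?\<sigma> n t) (?X n t) (?v n t) - (c n + integral {-T..t}
        (\<lambda>s. Fx (?\<sigma> n s) (?X n s) (?v n s) + Vx (?\<sigma> n s) (?X n s) + f s))) \<longlonglongrightarrow> 0"
    proof (rule AE_I2)
      fix t assume "t \<in> space M"
      then have t: "t \<in> {-T..T}" by simp
      let ?e = "\<lambda>n. node (m n) (Suc (j n t))"
      have eT: "?e n \<in> {-T..T}" for n using node_bounds[of "Suc (j n t)" "m n"] jm[of n t] m[of n] by auto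
      have el: "?e \<longlonglongrightarrow> t"
        by (rule near_idx_tendsto[OF m m_lim t]) (simp_all add: j_def node_mono m)
      have split: "integral {-T..y} (\<lambda>s. q n (j n s) + f s) = integral {-T..y} (\<lambda>s. q n (j n s)) + \<Phi> y"
        if "y \<in> {-T..T}" for n y
        unfolding \<Phi>_def j_def using that
        by (intro Henstock_Kurzweil_Integration.integral_add integrable_on_if_integrable_lebesgue_on[OF step_integrable[OF m]]
          integrable_on_if_integrable_lebesgue_on[OF f_int]) auto
      have mom: "Fv (?\<sigma> n t) (?X n t) (?v n t) = c n + (integral {-T..?e n} (\<lambda>s. q n (j n s)) + \<Phi> (?e n))" for n
      proof -
        have "\<Phi> (?e n) = (\<Sum>i<Suc (j n t). load (m n) i)"
          unfolding \<Phi>_def load_def using jm[of n t] by (intro sum_cells[OF f_int m, symmetric]) simp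
        moreover have "integral {-T..?e n} (\<lambda>s. q n (j n s)) = (\<Sum>i<Suc (j n t). mesh (m n) *\<^sub>R q n i)"
          unfolding j_def using jm[of n t] by (intro step_integral_node[OF m]) (simp add: j_def)
        ultimately show ?thesis
          unfolding momentum_telescope[OF m crit jm] c_def
          by (simp add: q_def sum.distrib[symmetric] lessThan_Suc_atMost)
      qed
      have "(\<lambda>n. Fv (?\<sigma> n t) (?X n t) (?v n t) - (c n + integral {-T..t} (\<lambda>s. q n (j n s) + f s))) \<longlonglongrightarrow> 0"
      proof (rule Lim_null_comparison)
        show "(\<lambda>n. (B1 + B2) * \<bar>?e n - t\<bar> + norm (\<Phi> (?e n) - \<Phi> t)) \<longlonglongrightarrow> 0"
        proof -
          have "(\<lambda>n. \<Phi> (?e n)) \<longlonglongrightarrow> \<Phi> t"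
            using eT by (intro continuous_on_tendsto_compose[OF \<Phi>c el t]) auto
          then have "(\<lambda>n. (B1 + B2) * \<bar>?e n - t\<bar> + norm (\<Phi> (?e n) - \<Phi> t)) \<longlonglongrightarrow> (B1 + B2) * \<bar>t - t\<bar> + norm (\<Phi> t - \<Phi> t)"
            by (intro tendsto_intros el)
          then show ?thesis by simp
        qed
        have "norm (Fv (?\<sigma> n t) (?X n t) (?v n t) - (c n + integral {-T..t} (\<lambda>s. q n (j n s) + f s)))
            \<le> (B1 + B2) * \<bar>?e n - t\<bar> + norm (\<Phi> (?e n) - \<Phi> t)" for n
        proof -
          have "norm (integral {-T..?e n} (\<lambda>s. q n (j n s)) - integral {-T..t} (\<lambda>s. q n (j n s))) \<le> (B1 + B2) * \<bar>?e n - t\<bar>"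
            by (rule indefinite_integral_lipschitz[OF _ _ eT t]) (auto simp: j_def intro: step_measurable qb idx_less m)
          moreover have "Fv (?\<sigma> n t) (?X n t) (?v n t) - (c n + integral {-T..t} (\<lambda>s. q n (j n s) + f s))
            = (integral {-T..?e n} (\<lambda>s. q n (j n s)) - integral {-T..t} (\<lambda>s. q n (j n s))) + (\<Phi> (?e n) - \<Phi> t)"
            unfolding mom split[OF t] by simp
          ultimately show ?thesis by (simp only:) (intro norm_triangle_le add_mono order_refl)
        qed
        then show "\<forall>\<^sub>F n in sequentially. norm (Fv (?\<sigma> n t) (?X n t) (?v n t) - (c n + integral {-T..t} (\<lambda>s. q n (j n s) + f s)))
            \<le> (B1 + B2) * \<bar>?e n - t\<bar> + norm (\<Phi> (?e n) - \<Phi> t)" by simp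
      qed
      then show "(\<lambda>n. Fv (?\<sigma> n t) (?X n t) (?v n t) - (c n + integral {-T..t}
        (\<lambda>s. Fx (?\<sigma> n s) (?X n s) (?v n s) + Vx (?\<sigma> n s) (?X n s) + f s))) \<longlonglongrightarrow> 0"
        by (simp only: q_def)
    qed
  next
    fix k :: "nat \<Rightarrow> nat" and u d
    assume "strict_mono k" "weak_solution u d"
      "(\<lambda>n. LINT t|M. F (?\<sigma> (k n) t) (?X (k n) t) (?v (k n) t) + V (?\<sigma> (k n) t) (?X (k n) t) + f t \<bullet> ?X (k n) t)
        \<longlonglongrightarrow> action u d"
    then show thesis by (rule that)
  qed
  then show ?thesis using that by (simp add: J_eq_integral[OF m] j_def)
qed

text \<open>The discrete action at \<open>0\<close> is a Riemann sum of \<open>V t 0\<close>, whose integral is \<open>0\<close>.\<close>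
lemma J_zero_tendsto:
  assumes m_lim: "filterlim m at_top sequentially" and s: "\<And>n. sampling (m n) (s n)"
  shows "(\<lambda>n. J (m n) (s n) (\<lambda>_. 0)) \<longlonglongrightarrow> 0"
proof -
  note m = sampling_D(1)[OF s]
  have v0: "vel (m n) (\<lambda>_. 0) i = 0" for n i by (simp add: vel_def)
  obtain BV where BV: "BV \<ge> 0" "\<And>t x v. \<bar>t\<bar> \<le> T \<Longrightarrow> norm x \<le> 0 \<Longrightarrow> norm (v::'a) \<le> 0 \<Longrightarrow> norm (V t x) \<le> BV"
    using bounded_on_box[OF V_cont3] by blast
  have Vc: "continuous_on UNIV (\<lambda>t. V t 0)"
    using continuous_on_compose2[OF V_cont, of UNIV "\<lambda>t. (t, 0)"] by (simp add: continuous_intros)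
  have "(\<lambda>n. LINT t|M. V (s n (idx (m n) t)) 0) \<longlonglongrightarrow> (LINT t|M. V t 0)"
  proof (rule bounded_convergence_lebesgue_on[where B=BV])
    show "(\<lambda>t. V (s n (idx (m n) t)) 0) \<in> borel_measurable M" for n
      using step_measurable[of "\<lambda>i. V (s n i) 0" "m n"] .
    show "(\<lambda>t. V t 0) \<in> borel_measurable M"
      using Vc by (intro continuous_imp_measurable_on_sets_lebesgue) (auto intro: continuous_on_subset)
    show "norm (V (s n (idx (m n) t)) 0) \<le> BV" for n t
    proof -
      have "s n (idx (m n) t) \<in> {-T..T}" by (rule sampling_D(2)[OF s idx_less[OF m]])
      then show ?thesis by (intro BV(2)[of _ 0 0]) auto
    qed
    show "AE t in M. (\<lambda>n. V (s n (idx (m n) t)) 0) \<longlonglongrightarrow> V t 0"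
    proof (rule AE_I2)
      fix t assume "t \<in> space M"
      then have t: "t \<in> {-T..T}" by simp
      have "(\<lambda>n. s n (idx (m n) t)) \<longlonglongrightarrow> t"
        using sampling_D(3)[OF s idx_less[OF m]] by (intro near_idx_tendsto[OF m m_lim t]) auto
      then show "(\<lambda>n. V (s n (idx (m n) t)) 0) \<longlonglongrightarrow> V t 0"
        by (intro continuous_on_tendsto_compose[OF Vc]) auto
    qed
  qed
  then show ?thesis using V_mean by (simp add: J_eq_integral[OF m] v0 F_0)
qed

text \<open>The minima have levels at most \<open>J m s (\<lambda>_. 0)\<close>, which tends to \<open>0\<close>, and the mountain pass points have levels at least
  \<open>\<alpha> / 2\<close>. Actions are limits of levels, so the two limits have different actions.\<close>
lemma two_weak_solutions:
  obtains u\<^sub>1 d\<^sub>1 u\<^sub>2 d\<^sub>2 where "weak_solution u\<^sub>1 d\<^sub>1" "weak_solution u\<^sub>2 d\<^sub>2" "action u\<^sub>1 d\<^sub>1 < action u\<^sub>2 d\<^sub>2"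
proof -
  have "\<exists>s. sampling (Suc n) s" for n using ex_sampling[of "Suc n"] by blast
  then obtain S where S: "\<And>n. sampling (Suc n) (S n)" by metis
  have "(\<lambda>n. J (Suc n) (S n) (\<lambda>_. 0)) \<longlonglongrightarrow> 0"
    by (rule J_zero_tendsto[OF filterlim_Suc S])
  then have "\<forall>\<^sub>F n in sequentially. J (Suc n) (S n) (\<lambda>_. 0) < \<alpha> / 2"
    using \<alpha>_pos by (intro order_tendstoD(2)[of _ 0]) auto
  then obtain N where N: "\<And>n. n \<ge> N \<Longrightarrow> J (Suc n) (S n) (\<lambda>_. 0) < \<alpha> / 2"
    unfolding eventually_sequentially by blast
  define m where "m n = Suc (n + N)" for n
  define s where "s n = S (n + N)" for n
  have s: "sampling (m n) (s n)" for n using S by (simp add: m_def s_def)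
  have m_lim: "filterlim m at_top sequentially"
    unfolding m_def using filterlim_compose[OF filterlim_Suc filterlim_add_const_nat_at_top[of N]] by simp
  have J0: "J (m n) (s n) (\<lambda>_. 0) < \<alpha> / 2" for n using N[of "n + N"] by (simp add: m_def s_def)
  have J0_lim: "(\<lambda>n. J (m n) (s n) (\<lambda>_. 0)) \<longlonglongrightarrow> 0" by (rule J_zero_tendsto[OF m_lim s])
  have "\<exists>x. critical (m n) (s n) x \<and> J (m n) (s n) x \<le> J (m n) (s n) (\<lambda>_. 0)" for n
  proof -
    have "J (m n) (s n) (\<lambda>_. 0) < \<alpha>" using J0[of n] \<alpha>_pos by linarith
    from ex_low_critical[OF s this] show ?thesis by blast
  qed
  then obtain x where x: "\<And>n. critical (m n) (s n) (x n)" "\<And>n. J (m n) (s n) (x n) \<le> J (m n) (s n) (\<lambda>_. 0)" by metis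
  obtain B where B: "\<And>m s. sampling m s \<Longrightarrow> J m s (\<lambda>_. 0) \<le> \<alpha> / 2 \<Longrightarrow>
    \<exists>x. critical m s x \<and> \<alpha> / 2 \<le> J m s x \<and> J m s x \<le> B"
    using ex_high_critical by blast
  have "\<exists>y. critical (m n) (s n) y \<and> \<alpha> / 2 \<le> J (m n) (s n) y \<and> J (m n) (s n) y \<le> B" for n
    using B[OF s] J0[of n] by simp
  then obtain y where y: "\<And>n. critical (m n) (s n) (y n)" "\<And>n. \<alpha> / 2 \<le> J (m n) (s n) (y n)" "\<And>n. J (m n) (s n) (y n) \<le> B" by metis
  have "J (m n) (s n) (x n) \<le> \<alpha> / 2" for n using x(2)[of n] J0[of n] by linarith
  from solution_from_critical_points[OF m_lim s x(1) this]
  obtain k1 u1 d1 where 1: "strict_mono (k1 :: nat \<Rightarrow> nat)" "weak_solution u1 d1"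
    "(\<lambda>n. J (m (k1 n)) (s (k1 n)) (x (k1 n))) \<longlonglongrightarrow> action u1 d1" by blast
  from solution_from_critical_points[OF m_lim s y(1) y(3)]
  obtain k2 u2 d2 where 2: "strict_mono (k2 :: nat \<Rightarrow> nat)" "weak_solution u2 d2"
    "(\<lambda>n. J (m (k2 n)) (s (k2 n)) (y (k2 n))) \<longlonglongrightarrow> action u2 d2" by blast
  have "(\<lambda>n. J (m (k1 n)) (s (k1 n)) (\<lambda>_. 0)) \<longlonglongrightarrow> 0"
    using LIMSEQ_subseq_LIMSEQ[OF J0_lim 1(1)] by (simp add: o_def)
  then have "action u1 d1 \<le> 0" using x(2) by (intro LIMSEQ_le[OF 1(3)]) auto
  moreover have "\<alpha> / 2 \<le> action u2 d2" using y(2) by (intro LIMSEQ_le_const[OF 2(3)]) auto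
  ultimately show ?thesis using that[OF 1(2) 2(2)] \<alpha>_pos by linarith
qed

end

section \<open>Gradients of continuously differentiable functions\<close>

lemma has_derivative_imp_GDERIV:
  fixes \<phi> :: "'b::euclidean_space \<Rightarrow> real"
  assumes "(\<phi> has_derivative D) (at x)"
  shows "GDERIV \<phi> x :> (\<Sum>b\<in>Basis. D b *\<^sub>R b)"
proof -
  have lin: "linear D" using assms has_derivative_linear by blast
  have "D = (\<lambda>k. k \<bullet> (\<Sum>b\<in>Basis. D b *\<^sub>R b))"
  proof
    fix k
    have "D k = D (\<Sum>b\<in>Basis. (k \<bullet> b) *\<^sub>R b)" by (simp add: euclidean_representation)
    also have "\<dots> = (\<Sum>b\<in>Basis. (k \<bullet> b) * D b)" by (simp add: linear_sum[OF lin] linear_scale[OF lin])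
    finally show "D k = k \<bullet> (\<Sum>b\<in>Basis. D b *\<^sub>R b)" by (simp add: inner_sum_right mult.commute)
  qed
  then show ?thesis using assms unfolding gderiv_def by simp
qed

text \<open>Differentiability within \<open>S \<times> UNIV\<close> is full differentiability in the second variable, even where
  \<open>t\<close> is on the boundary of \<open>S\<close>.\<close>
lemma C1_on_Times_UNIV_gradient:
  fixes \<phi> :: "'c::real_normed_vector \<times> 'b::euclidean_space \<Rightarrow> real"
  assumes "C1_on (S \<times> UNIV) \<phi>"
  obtains g where "continuous_on (S \<times> UNIV) \<phi>" "continuous_on (S \<times> UNIV) g"
    "\<And>t y. t \<in> S \<Longrightarrow> GDERIV (\<lambda>y. \<phi> (t, y)) y :> g (t, y)"
proof -
  obtain D where D: "\<And>p. p \<in> S \<times> UNIV \<Longrightarrow> (\<phi> has_derivative blinfun_apply (D p)) (at p within S \<times> UNIV)"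
    "continuous_on (S \<times> UNIV) D"
    using assms unfolding C1_on_def by blast
  define g where "g p = (\<Sum>b\<in>Basis. D p (0, b) *\<^sub>R b)" for p
  have "continuous_on (S \<times> UNIV) \<phi>" using D(1) by (rule has_derivative_continuous_on)
  moreover have "continuous_on (S \<times> UNIV) g" unfolding g_def by (intro continuous_intros D(2))
  moreover have "GDERIV (\<lambda>y. \<phi> (t, y)) y :> g (t, y)" if t: "t \<in> S" for t y
  proof -
    have "((\<lambda>y. (t, y)) has_derivative (\<lambda>k. (0, k))) (at y)" by (auto intro!: derivative_eq_intros)
    moreover have "(\<phi> has_derivative blinfun_apply (D (t, y))) (at (t, y) within range (\<lambda>y. (t, y)))"
      using D(1)[of "(t, y)"] t by (rule_tac has_derivative_subset[where s="S \<times> UNIV"]) auto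
    ultimately have "((\<lambda>y. \<phi> (t, y)) has_derivative (\<lambda>k. D (t, y) (0, k))) (at y)"
      using has_derivative_in_compose[of "\<lambda>y. (t, y)" _ y UNIV \<phi>] by simp
    from has_derivative_imp_GDERIV[OF this] show ?thesis by (simp add: g_def)
  qed
  ultimately show ?thesis using that by blast
qed

lemma GDERIV_fst_snd:
  fixes \<phi> :: "'a::real_inner \<times> 'b::real_inner \<Rightarrow> real"
  assumes "GDERIV \<phi> (x, v) :> D"
  shows "GDERIV (\<lambda>y. \<phi> (y, v)) x :> fst D" "GDERIV (\<lambda>w. \<phi> (x, w)) v :> snd D"
proof -
  have D: "(\<phi> has_derivative (\<lambda>h. h \<bullet> D)) (at (x, v))" using assms by (simp add: gderiv_def)
  have "((\<lambda>y. (y, v)) has_derivative (\<lambda>k. (k, 0))) (at x)" "((\<lambda>w. (x, w)) has_derivative (\<lambda>k. (0, k))) (at v)"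
    by (auto intro!: derivative_eq_intros)
  from diff_chain_at[OF this(1) D] diff_chain_at[OF this(2) D]
  show "GDERIV (\<lambda>y. \<phi> (y, v)) x :> fst D" "GDERIV (\<lambda>w. \<phi> (x, w)) v :> snd D"
    by (simp_all add: gderiv_def o_def inner_prod_def)
qed

section \<open>G-functions and their conjugates\<close>

lemma continuous_bounded_on_cball:
  fixes G :: "'a::euclidean_space \<Rightarrow> real"
  assumes "continuous_on UNIV G"
  obtains B where "\<And>x. norm x \<le> r \<Longrightarrow> \<bar>G x\<bar> \<le> B"
proof -
  have "bounded (G ` cball 0 r)"
    using assms by (intro compact_imp_bounded compact_continuous_image) (auto intro: continuous_on_subset)
  then obtain B where B: "\<forall>z\<in>G ` cball 0 r. norm z \<le> B" unfolding bounded_iff by blast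
  have "\<bar>G x\<bar> \<le> B" if "norm x \<le> r" for x
  proof -
    have "x \<in> cball 0 r" using that by simp
    then show ?thesis using B by (metis imageI real_norm_def)
  qed
  then show ?thesis using that by blast
qed

lemma G_function_superlinear:
  assumes "G_function G"
  shows "\<exists>C. \<forall>x. \<kappa> * norm x \<le> G x + C"
proof -
  have nn: "G x \<ge> 0" for x using assms by (simp add: G_function_def)
  have "\<forall>\<^sub>F x in at_infinity. \<bar>\<kappa>\<bar> \<le> G x / norm x"
    using assms unfolding G_function_def filterlim_at_top by blast
  then obtain R where R: "\<And>x. norm x \<ge> R \<Longrightarrow> \<bar>\<kappa>\<bar> \<le> G x / norm x"
    unfolding eventually_at_infinity by blast
  have "\<kappa> * norm x \<le> G x + \<bar>\<kappa>\<bar> * \<bar>R\<bar>" for x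
  proof -
    have le: "\<kappa> * norm x \<le> \<bar>\<kappa>\<bar> * norm x" by (intro mult_right_mono) auto
    show ?thesis
    proof (cases "norm x \<ge> R \<and> x \<noteq> 0")
      case True
      then have "\<bar>\<kappa>\<bar> * norm x \<le> G x" using R[of x] by (simp add: pos_le_divide_eq)
      moreover have "0 \<le> \<bar>\<kappa>\<bar> * \<bar>R\<bar>" by simp
      ultimately show ?thesis using le by linarith
    next
      case False
      then have "norm x \<le> \<bar>R\<bar>" by auto
      then have "\<bar>\<kappa>\<bar> * norm x \<le> \<bar>\<kappa>\<bar> * \<bar>R\<bar>" by (intro mult_left_mono) auto
      then show ?thesis using le nn[of x] by linarith
    qed
  qed
  then show ?thesis by blast
qed

lemma fenchel_young:
  assumes "G_function G"
  shows "x \<bullet> y \<le> G x + fenchel_conjugate G y"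
proof -
  obtain C where C: "\<And>x. norm y * norm x \<le> G x + C" using G_function_superlinear[OF assms] by blast
  have "bdd_above (range (\<lambda>x. x \<bullet> y - G x))"
  proof (rule bdd_aboveI2)
    fix x
    show "x \<bullet> y - G x \<le> C" using norm_cauchy_schwarz[of x y] C[of x] by (simp add: mult.commute)
  qed
  from cSUP_upper[OF UNIV_I this, of x] show ?thesis by (simp add: fenchel_conjugate_def)
qed

text \<open>The supremum defining the conjugate is tested with the unit vector in direction \<open>y\<close>.\<close>
lemma fenchel_conjugate_ge_norm:
  assumes G: "G_function G" "continuous_on UNIV G"
  obtains C where "\<And>y. norm y \<le> fenchel_conjugate G y + C"
proof -
  obtain C where C: "\<And>x. norm x \<le> 1 \<Longrightarrow> \<bar>G x\<bar> \<le> C"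
    using continuous_bounded_on_cball[OF G(2)] by blast
  have "norm y \<le> fenchel_conjugate G y + C" for y
  proof -
    have s: "sgn y \<bullet> y = norm y"
      by (cases "y = 0") (simp_all add: sgn_div_norm dot_square_norm power2_eq_square)
    have "\<bar>G (sgn y)\<bar> \<le> C" by (rule C) (simp add: norm_sgn)
    then show ?thesis using fenchel_young[OF G(1), of "sgn y" y] s by linarith
  qed
  then show ?thesis using that by blast
qed

text \<open>The tangent at \<open>v\<close> bounds \<open>x \<bullet> D - G x\<close> by \<open>D \<bullet> v - G v\<close>, and evaluated at \<open>2 *\<^sub>R v\<close> it bounds \<open>D \<bullet> v\<close> by
  \<open>G (2 *\<^sub>R v) - G v\<close>.\<close>
lemma fenchel_conjugate_gradient_le:
  assumes G: "G_function G" and D: "GDERIV G v :> D"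
  shows "fenchel_conjugate G D \<le> G (2 *\<^sub>R v)"
  unfolding fenchel_conjugate_def
proof (rule cSUP_least)
  fix x
  have conv: "convex_on UNIV G" and nn: "G v \<ge> 0" using G by (auto simp: G_function_def)
  have "G x \<ge> G v + D \<bullet> (x - v)" "G (2 *\<^sub>R v) \<ge> G v + D \<bullet> (2 *\<^sub>R v - v)"
    by (rule convex_above_tangent_GDERIV[OF conv D])+
  moreover have "2 *\<^sub>R v - v = v" by (simp add: scaleR_2)
  ultimately show "x \<bullet> D - G x \<le> G (2 *\<^sub>R v)"
    using nn by (simp add: inner_diff_right inner_commute)
qed simp

text \<open>The constant \<open>C'\<close> accounts for the ball on which the doubling condition is not assumed.\<close>
lemma Delta2_global:
  assumes "G_function G" "continuous_on UNIV G" "Delta2_at_infinity G"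
  obtains C C' where "C \<ge> 0" "\<And>x. G (2 *\<^sub>R x) \<le> C * G x + C'"
proof -
  obtain C R where C: "C > 0" "\<And>x. norm x \<ge> R \<Longrightarrow> G (2 *\<^sub>R x) \<le> C * G x"
    using assms(3) unfolding Delta2_at_infinity_def by blast
  obtain C' where C': "\<And>x. norm x \<le> 2 * R \<Longrightarrow> \<bar>G x\<bar> \<le> C'"
    using continuous_bounded_on_cball[OF assms(2)] by blast
  have nn: "G x \<ge> 0" for x using assms(1) by (simp add: G_function_def)
  have "G (2 *\<^sub>R x) \<le> C * G x + \<bar>C'\<bar>" for x
  proof (cases "norm x \<ge> R")
    case False
    then have "\<bar>G (2 *\<^sub>R x)\<bar> \<le> C'" by (intro C') simp
    moreover have "C * G x \<ge> 0" using C(1) nn by simp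
    ultimately show ?thesis by linarith
  qed (use C(2)[of x] in simp)
  then show ?thesis using that[of C "\<bar>C'\<bar>"] C(1) by simp
qed

section \<open>Superquadratic potentials\<close>

lemma powr_superlinear:
  fixes p \<kappa> :: real
  assumes p: "p > 1"
  obtains C where "\<And>y. y \<ge> 0 \<Longrightarrow> \<kappa> * y \<le> y powr p + C"
proof -
  define Y where "Y = \<bar>\<kappa>\<bar> powr (1 / (p - 1))"
  have "\<kappa> * y \<le> y powr p + \<bar>\<kappa>\<bar> * Y" if y: "y \<ge> 0" for y
  proof -
    have le: "\<kappa> * y \<le> \<bar>\<kappa>\<bar> * y" using y by (intro mult_right_mono) auto
    have Y: "Y \<ge> 0" by (simp add: Y_def)
    show ?thesis
    proof (cases "y \<ge> Y \<and> y > 0")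
      case True
      have "Y powr (p - 1) = \<bar>\<kappa>\<bar>" using p by (simp add: Y_def powr_powr)
      then have "\<bar>\<kappa>\<bar> \<le> y powr (p - 1)" using True Y p powr_mono2[of "p - 1" Y y] by simp
      then have "\<bar>\<kappa>\<bar> * y \<le> y powr (p - 1) * y" using y by (rule mult_right_mono)
      also have "\<dots> = y powr p" using True powr_mult_base[of y "p - 1"] by (simp add: mult.commute)
      finally show ?thesis using le Y by (smt (verit) mult_nonneg_nonneg)
    next
      case False
      then have "y \<le> Y" using y Y by auto
      then have "\<bar>\<kappa>\<bar> * y \<le> \<bar>\<kappa>\<bar> * Y" by (intro mult_left_mono) auto
      then show ?thesis using le powr_ge_zero[of y p] by linarith
    qed
  qed
  then show ?thesis using that by blast
qed

text \<open>The hypothesis \<open>hom\<close> says that \<open>\<phi> (z *\<^sub>R e) * z powr (- \<theta>)\<close> has a nonpositive derivative in \<open>z\<close>.\<close>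
lemma superquadratic_decay:
  fixes \<phi> :: "'a::euclidean_space \<Rightarrow> real"
  assumes D: "\<And>x. GDERIV \<phi> x :> D x" and s0: "s0 > 0" "s0 \<le> s"
    and hom: "\<And>z. s0 \<le> z \<Longrightarrow> D (z *\<^sub>R e) \<bullet> (z *\<^sub>R e) \<le> \<theta> * \<phi> (z *\<^sub>R e)"
  shows "\<phi> (s *\<^sub>R e) \<le> (s / s0) powr \<theta> * \<phi> (s0 *\<^sub>R e)"
proof -
  let ?f = "\<lambda>z. \<phi> (z *\<^sub>R e) * z powr (- \<theta>)"
  have "?f s \<le> ?f s0"
  proof (rule DERIV_nonpos_imp_nonincreasing[OF s0(2)])
    fix z assume z: "s0 \<le> z" "z \<le> s"
    then have z0: "z > 0" using s0 by simp
    have "((\<lambda>z. \<phi> (0 + z *\<^sub>R e)) has_real_derivative D (z *\<^sub>R e) \<bullet> e) (at z)"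
      using D[of "0 + z *\<^sub>R e"] GDERIV_line[of \<phi> 0 z e] by simp
    then have d1: "((\<lambda>z. \<phi> (z *\<^sub>R e)) has_real_derivative D (z *\<^sub>R e) \<bullet> e) (at z)" by simp
    have "(?f has_real_derivative (D (z *\<^sub>R e) \<bullet> e) * z powr (- \<theta>) + \<phi> (z *\<^sub>R e) * (- \<theta> * z powr (- \<theta> - 1))) (at z)"
      using z0 by (auto intro!: derivative_eq_intros d1 simp: field_simps)
    moreover have "(D (z *\<^sub>R e) \<bullet> e) * z powr (- \<theta>) + \<phi> (z *\<^sub>R e) * (- \<theta> * z powr (- \<theta> - 1))
        = z powr (- \<theta> - 1) * (D (z *\<^sub>R e) \<bullet> (z *\<^sub>R e) - \<theta> * \<phi> (z *\<^sub>R e))"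
    proof -
      have "z powr (- \<theta>) = z * z powr (- \<theta> - 1)" using powr_mult_base[of z "- \<theta> - 1"] z0 by simp
      then show ?thesis by (simp add: algebra_simps)
    qed
    moreover have "z powr (- \<theta> - 1) * (D (z *\<^sub>R e) \<bullet> (z *\<^sub>R e) - \<theta> * \<phi> (z *\<^sub>R e)) \<le> 0"
      using hom[OF z(1)] by (intro mult_nonneg_nonpos) auto
    ultimately show "\<exists>y. (?f has_real_derivative y) (at z) \<and> y \<le> 0" by auto
  qed
  then have "?f s * s powr \<theta> \<le> ?f s0 * s powr \<theta>" by (intro mult_right_mono) auto
  then show ?thesis using s0 by (simp add: powr_minus powr_divide field_simps)
qed

section \<open>Two periodic solutions\<close>

text \<open>Bounded velocities make \<open>u\<close> and its derivative elements of every Orlicz space of a continuous \<open>G\<close>. The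
  functions \<open>F0\<close>, \<open>V0\<close> are given on \<open>{-T..T}\<close> only; \<open>F\<close>, \<open>V\<close> extend them to all times.\<close>
lemma weak_solution_imp_periodic_solution:
  assumes lag: "lagrangian T F Fx Fv V Vx f"
    and sol: "lagrangian.weak_solution T Fx Fv Vx f u d"
    and G: "continuous_on UNIV G"
    and eq: "\<And>t x v. t \<in> {-T..T} \<Longrightarrow> F0 t x v = F t x v" "\<And>t x. t \<in> {-T..T} \<Longrightarrow> V0 t x = V t x"
  shows "periodic_solution G T (\<lambda>t x v. F0 t x v + V0 t x + f t \<bullet> x) u"
    and "AE t in lebesgue_on {-T..T}. time_derivative {-T..T} u t = d t"
proof -
  interpret lagrangian T F Fx Fv V Vx f by (rule lag)
  let ?I = "{-T..T}"
  have s: "absolutely_continuous_on ?I u" "continuous_on ?I u" "u (-T) = u T" "d \<in> borel_measurable M"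
    "AE t in M. (u has_vector_derivative d t) (at t within ?I)"
    using sol unfolding weak_solution_def by auto
  obtain L where L: "\<And>t. norm (d t) \<le> L" using sol unfolding weak_solution_def by blast
  obtain w where w: "absolutely_continuous_on ?I w" "AE t in M. w t = Fv t (u t) (d t)"
    "AE t in M. (w has_vector_derivative Fx t (u t) (d t) + Vx t (u t) + f t) (at t within ?I)"
    using sol unfolding weak_solution_def by blast
  have AEI: "AE t in M. t \<in> ?I" using AE_space[of M] by simp
  show der: "AE t in M. time_derivative ?I u t = d t"
    using s(5) AEI
  proof eventually_elim
    case (elim t)
    then show ?case using vector_derivative_within_closed_interval[of "-T" T t u "d t"] T_pos by simp
  qed
  have dm: "time_derivative ?I u \<in> borel_measurable M"
  proof -
    have "(\<lambda>t. if t \<in> ?I then d t else 0) \<in> borel_measurable lebesgue"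
      using s(4) by (subst borel_measurable_if) auto
    moreover have "AE t in lebesgue. (if t \<in> ?I then d t else 0) = (if t \<in> ?I then time_derivative ?I u t else 0)"
      using der by (simp add: AE_restrict_space_iff) (auto elim!: eventually_mono)
    ultimately have "(\<lambda>t. if t \<in> ?I then time_derivative ?I u t else 0) \<in> borel_measurable lebesgue"
      by (rule borel_measurable_AE)
    then show ?thesis by (subst (asm) borel_measurable_if) auto
  qed
  have um: "u \<in> borel_measurable M" using s(2) by (intro continuous_imp_measurable_on_sets_lebesgue) auto
  have Gm: "(\<lambda>t. G (y t)) \<in> borel_measurable M" if "y \<in> borel_measurable M" for y
    using borel_measurable_continuous_on[OF G that] .
  have Gb: "\<exists>B. \<forall>x. norm x \<le> r \<longrightarrow> norm (G x) \<le> B" for r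
    using continuous_bounded_on_cball[OF G, of r] by (metis real_norm_def)
  have uO: "u \<in> orlicz_space G ?I"
  proof -
    have "bounded (u ` ?I)" by (intro compact_imp_bounded compact_continuous_image s(2) compact_Icc)
    then obtain r where r: "\<And>t. t \<in> ?I \<Longrightarrow> norm (u t) \<le> r" unfolding bounded_iff by blast
    obtain B where B: "\<And>x. norm x \<le> r \<Longrightarrow> norm (G x) \<le> B" using Gb by blast
    have "integrable M (\<lambda>t. G (u t))"
      by (rule integrable_lebesgue_on_bounded[where B=B]) (use Gm[OF um] B r in auto)
    then show ?thesis using um by (simp add: orlicz_space_def)
  qed
  have dO: "time_derivative ?I u \<in> orlicz_space G ?I"
  proof -
    obtain B where B: "\<And>x. norm x \<le> L \<Longrightarrow> norm (G x) \<le> B" using Gb by blast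
    have "integrable M (\<lambda>t. G (d t))"
      by (rule integrable_lebesgue_on_bounded[where B=B]) (use Gm[OF s(4)] B L in auto)
    then have "integrable M (\<lambda>t. G (time_derivative ?I u t))"
      by (rule integrable_cong_AE_imp[OF _ Gm[OF dm]]) (use der in \<open>auto elim!: eventually_mono\<close>)
    then show ?thesis using dm by (simp add: orlicz_space_def)
  qed
  have gv: "gradient (\<lambda>v. F0 t x v + V0 t x + f t \<bullet> x) v = Fv t x v" if "t \<in> ?I" for t x v
  proof -
    have "(\<lambda>v. F0 t x v + V0 t x + f t \<bullet> x) = (\<lambda>v. F t x v + (V t x + f t \<bullet> x))"
      using eq that by auto
    moreover have "GDERIV (\<lambda>v. F t x v + (V t x + f t \<bullet> x)) v :> Fv t x v + 0"
      by (intro GDERIV_add Fv GDERIV_const)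
    ultimately show ?thesis by (intro gradient_eqI) simp
  qed
  have gx: "gradient (\<lambda>x. F0 t x v + V0 t x + f t \<bullet> x) x = Fx t x v + Vx t x + f t" if "t \<in> ?I" for t x v
  proof -
    have "(\<lambda>x. F0 t x v + V0 t x + f t \<bullet> x) = (\<lambda>x. F t x v + V t x + f t \<bullet> x)"
      using eq that by auto
    moreover have "GDERIV (\<lambda>x. f t \<bullet> x) x :> f t"
      unfolding gderiv_def by (auto intro!: derivative_eq_intros simp: inner_commute)
    then have "GDERIV (\<lambda>x. F t x v + V t x + f t \<bullet> x) x :> Fx t x v + Vx t x + f t"
      by (intro GDERIV_add Fx Vx)
    ultimately show ?thesis by (intro gradient_eqI) simp
  qed
  show "periodic_solution G T (\<lambda>t x v. F0 t x v + V0 t x + f t \<bullet> x) u"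
    unfolding periodic_solution_def
  proof (intro conjI exI[of _ w])
    show "u \<in> periodic_orlicz_sobolev_space G T"
      using s(1,3) uO dO by (simp add: periodic_orlicz_sobolev_space_def orlicz_sobolev_space_def)
    show "AE t in M. w t = gradient (\<lambda>v. F0 t (u t) v + V0 t (u t) + f t \<bullet> u t) (time_derivative ?I u t)"
      using w(2) der AEI by eventually_elim (simp add: gv)
    show "AE t in M. (w has_vector_derivative gradient (\<lambda>x. F0 t x (time_derivative ?I u t) + V0 t x + f t \<bullet> x) (u t)) (at t within ?I)"
      using w(3) der AEI by eventually_elim (simp add: gx)
  qed (rule w(1))
qed

theorem theorem4p2:
  fixes T :: real
    and G :: "real ^ 'n \<Rightarrow> real"
    and F :: "real \<Rightarrow> real ^ 'n \<Rightarrow> real ^ 'n \<Rightarrow> real"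
    and V K W :: "real \<Rightarrow> real ^ 'n \<Rightarrow> real"
    and f :: "real \<Rightarrow> real ^ 'n"
    and a \<beta> g :: "real \<Rightarrow> real"
    and \<theta>\<^sub>F \<Lambda> M \<epsilon>\<^sub>V \<theta>\<^sub>V p\<^sub>K \<rho> b :: real
  defines "I \<equiv> {-T..T}"
  assumes T: "T > 0" "2 * T \<ge> 1"
    and G: "G_function G" "C1_on UNIV G" "Delta2_at_infinity G" "Nabla2_at_infinity G"
    and F_C1: "C1_on (I \<times> UNIV \<times> UNIV) (\<lambda>(t, x, v). F t x v)"
    and V_C1: "C1_on (I \<times> UNIV) (\<lambda>(t, x). V t x)"
    and f_space: "f \<in> orlicz_space (fenchel_conjugate G) I"
    and f_nonzero: "\<not> (AE t in lebesgue_on I. f t = 0)"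
    and F1: "\<And>t x. t \<in> I \<Longrightarrow> convex_on UNIV (\<lambda>v. F t x v)"
    and F2_data: "continuous_on {0..} a" "\<And>r. r \<ge> 0 \<Longrightarrow> a r \<ge> 0"
      "integrable (lebesgue_on I) \<beta>" "\<And>t. t \<in> I \<Longrightarrow> \<beta> t \<ge> 0"
    and F2: "\<And>t x v. t \<in> I \<Longrightarrow> \<bar>F t x v\<bar> \<le> a (norm x) * (\<beta> t + G v)"
      "\<And>t x v. t \<in> I \<Longrightarrow>
        norm (gradient (\<lambda>y. F t y v) x) \<le> a (norm x) * (\<beta> t + G v)"
      "\<And>t x v. t \<in> I \<Longrightarrow>
        fenchel_conjugate G (gradient (\<lambda>y. F t x y) v)
          \<le> a (norm x) * (\<beta> t + fenchel_conjugate G (gradient G v))"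
    and F3: "\<theta>\<^sub>F > 0"
      "\<And>t x v. t \<in> I \<Longrightarrow>
        gradient (\<lambda>y. F t y v) x \<bullet> x + gradient (\<lambda>y. F t x y) v \<bullet> v \<le> \<theta>\<^sub>F * F t x v"
    and F4: "\<Lambda> > 0" "\<And>t x v. t \<in> I \<Longrightarrow> F t x v \<ge> \<Lambda> * G v"
    and F5: "\<And>t x. t \<in> I \<Longrightarrow> F t x 0 = 0"
      "\<And>t x. t \<in> I \<Longrightarrow> gradient (\<lambda>v. F t x v) 0 = 0"
    and V1: "\<And>t x. t \<in> I \<Longrightarrow> V t x = K t x - W t x"
    and V2_data: "M > 0" "\<epsilon>\<^sub>V > 0" "\<theta>\<^sub>V > \<theta>\<^sub>F" "1 < p\<^sub>K" "p\<^sub>K \<le> \<theta>\<^sub>V - \<epsilon>\<^sub>V"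
    and V2: "\<And>t x. t \<in> I \<Longrightarrow> norm x > M \<Longrightarrow>
        gradient (\<lambda>y. V t y) x \<bullet> x \<le> (\<theta>\<^sub>V - \<epsilon>\<^sub>V) * K t x - \<theta>\<^sub>V * W t x"
      "\<And>t x. t \<in> I \<Longrightarrow> norm x > M \<Longrightarrow> W t x > K t x"
      "\<And>t x. t \<in> I \<Longrightarrow> norm x > M \<Longrightarrow> K t x > norm x powr p\<^sub>K"
    and V3_data: "\<rho> > 0" "b > 1" "integrable (lebesgue_on I) g"
    and V3: "\<And>t x. t \<in> I \<Longrightarrow> G (x /\<^sub>R (2 * (2 * T))) \<le> \<rho> / 2 \<Longrightarrow> V t x \<ge> b * G x - g t"
    and V4: "(LINT t | lebesgue_on I. V t 0) = 0"
    and f: "(LINT t | lebesgue_on I. fenchel_conjugate G (f t) + g t) < min \<Lambda> (b - 1) * \<rho>"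
  shows "\<exists>u\<^sub>1 u\<^sub>2.
    periodic_solution G T (\<lambda>t x v. F t x v + V t x + f t \<bullet> x) u\<^sub>1 \<and>
    periodic_solution G T (\<lambda>t x v. F t x v + V t x + f t \<bullet> x) u\<^sub>2 \<and>
    (\<exists>t\<in>I. u\<^sub>1 t \<noteq> u\<^sub>2 t)"
proof -
  \<comment> \<open>Freezing time outside \<open>I\<close> extends \<open>F\<close> and \<open>V\<close> to all times without losing continuity.\<close>
  define c where "c t = max (- T) (min T t)" for t :: real
  have cI: "c t \<in> I" for t using T(1) by (auto simp: c_def I_def)
  have c_id: "c t = t" if "t \<in> I" for t using that by (auto simp: c_def I_def)
  have c_cont: "continuous_on UNIV c" unfolding c_def by (intro continuous_intros)
  obtain DF where DF: "continuous_on (I \<times> UNIV) (\<lambda>(t, x, v). F t x v)" "continuous_on (I \<times> UNIV) DF"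
    "\<And>t p. t \<in> I \<Longrightarrow> GDERIV (\<lambda>p. (\<lambda>(t, x, v). F t x v) (t, p)) p :> DF (t, p)"
    using C1_on_Times_UNIV_gradient[of I "\<lambda>(t, x, v). F t x v"] F_C1 unfolding UNIV_Times_UNIV by blast
  obtain DV where DV: "continuous_on (I \<times> UNIV) (\<lambda>(t, x). V t x)" "continuous_on (I \<times> UNIV) DV"
    "\<And>t x. t \<in> I \<Longrightarrow> GDERIV (\<lambda>x. (\<lambda>(t, x). V t x) (t, x)) x :> DV (t, x)"
    using C1_on_Times_UNIV_gradient[OF V_C1] by blast
  obtain G' where G': "\<And>v. (G has_derivative blinfun_apply (G' v)) (at v)"
    using G(2) unfolding C1_on_def by auto
  have G_cont: "continuous_on UNIV G"
    using G' by (intro has_derivative_continuous_on[of UNIV G]) auto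
  have G_grad: "GDERIV G v :> gradient G v" for v
    using has_derivative_imp_GDERIV[OF G'[of v]] gradient_eqI by metis
  define Fc where "Fc t x v = F (c t) x v" for t x v
  define Fxc where "Fxc t x v = fst (DF (c t, x, v))" for t x v
  define Fvc where "Fvc t x v = snd (DF (c t, x, v))" for t x v
  define Vc where "Vc t x = V (c t) x" for t x
  define Vxc where "Vxc t x = DV (c t, x)" for t x
  have GF: "GDERIV (\<lambda>y. F t y v) x :> fst (DF (t, x, v))" "GDERIV (\<lambda>w. F t x w) v :> snd (DF (t, x, v))"
    if "t \<in> I" for t x v
    using GDERIV_fst_snd[OF DF(3)[OF that, of "(x, v)"]] by simp_all
  have GV: "GDERIV (V t) x :> DV (t, x)" if "t \<in> I" for t x
    using DV(3)[OF that, of x] by simp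
  note gradF = gradient_eqI[OF GF(1)] gradient_eqI[OF GF(2)] and gradV = gradient_eqI[OF GV]
  have ct_cont: "continuous_on UNIV (\<lambda>(t, x, v). \<phi> (c t, x, v))"
    if "continuous_on (I \<times> UNIV) \<phi>" for \<phi> :: "real \<times> (real^'n) \<times> (real^'n) \<Rightarrow> 'z::topological_space"
  proof -
    have "continuous_on UNIV (\<lambda>p :: real \<times> (real^'n) \<times> (real^'n). (c (fst p), snd p))"
      by (intro continuous_intros continuous_on_compose2[OF c_cont]) auto
    then have "continuous_on UNIV (\<lambda>p. \<phi> (c (fst p), snd p))"
      by (rule continuous_on_compose2[OF that]) (use cI in auto)
    then show ?thesis by (simp add: case_prod_beta')
  qed
  have ct_cont2: "continuous_on UNIV (\<lambda>(t, x). \<phi> (c t, x))"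
    if "continuous_on (I \<times> UNIV) \<phi>" for \<phi> :: "real \<times> (real^'n) \<Rightarrow> 'z::topological_space"
  proof -
    have "continuous_on UNIV (\<lambda>p :: real \<times> (real^'n). (c (fst p), snd p))"
      by (intro continuous_intros continuous_on_compose2[OF c_cont]) auto
    then have "continuous_on UNIV (\<lambda>p. \<phi> (c (fst p), snd p))"
      by (rule continuous_on_compose2[OF that]) (use cI in auto)
    then show ?thesis by (simp add: case_prod_beta')
  qed
  let ?G = "fenchel_conjugate G"
  have G_nn: "G x \<ge> 0" and G_0: "G 0 = 0" and G_even: "G (- x) = G x" for x
    using G(1) by (auto simp: G_function_def)
  have G_sl: "\<exists>C. \<forall>x. \<kappa> * norm x \<le> G x + C" for \<kappa> by (rule G_function_superlinear[OF G(1)])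
  obtain C1 where C1: "\<And>y. norm y \<le> ?G y + C1" using fenchel_conjugate_ge_norm[OF G(1) G_cont] by blast
  obtain C2 C2' where C2: "C2 \<ge> 0" "\<And>x. G (2 *\<^sub>R x) \<le> C2 * G x + C2'"
    using Delta2_global[OF G(1) G_cont G(3)] by blast
  have fm: "f \<in> borel_measurable (lebesgue_on I)" and fG: "integrable (lebesgue_on I) (\<lambda>t. ?G (f t))"
    using f_space by (auto simp: orlicz_space_def)
  have cI': "integrable (lebesgue_on I) (\<lambda>t. k)" for k :: real
    unfolding I_def by (rule integrable_lebesgue_on_bounded[where B="\<bar>k\<bar>"]) auto
  have f_int: "integrable (lebesgue_on I) f"
  proof (rule Bochner_Integration.integrable_bound[OF Bochner_Integration.integrable_add[OF fG cI'[of C1]] fm])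
    show "AE t in lebesgue_on I. norm (f t) \<le> norm (?G (f t) + C1)"
      using C1 by (intro AE_I2) (metis abs_ge_self order_trans real_norm_def)
  qed
  have lag: "lagrangian T Fc Fxc Fvc Vc Vxc f"
  proof
    show "continuous_on UNIV (\<lambda>(t, x, v). Fc t x v)"
      using ct_cont[OF DF(1)] by (simp add: Fc_def)
    show "continuous_on UNIV (\<lambda>(t, x, v). Fxc t x v)"
      using ct_cont[OF continuous_on_fst[OF DF(2)]] by (simp add: Fxc_def)
    show "continuous_on UNIV (\<lambda>(t, x, v). Fvc t x v)"
      using ct_cont[OF continuous_on_snd[OF DF(2)]] by (simp add: Fvc_def)
    show "continuous_on UNIV (\<lambda>(t, x). Vc t x)" using ct_cont2[OF DV(1)] by (simp add: Vc_def)
    show "continuous_on UNIV (\<lambda>(t, x). Vxc t x)" using ct_cont2[OF DV(2)] by (simp add: Vxc_def)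
    show "GDERIV (\<lambda>y. Fc t y v) x :> Fxc t x v" for t x v
      unfolding Fc_def Fxc_def by (rule GF(1)[OF cI])
    show "GDERIV (Fc t x) v :> Fvc t x v" for t x v
      using GF(2)[OF cI] by (simp add: Fc_def[abs_def] Fvc_def)
    show "GDERIV (Vc t) x :> Vxc t x" for t x
      using GV[OF cI] by (simp add: Vc_def[abs_def] Vxc_def)
    show "convex_on UNIV (Fc t x)" for t x using F1[OF cI] by (simp add: Fc_def[abs_def])
    show "integrable (lebesgue_on {-T..T}) f" using f_int by (simp add: I_def)
  qed (rule T(1))
  interpret L: lagrangian T Fc Fxc Fvc Vc Vxc f by (rule lag)
  \<comment> \<open>The lower bound for \<open>V\<close> at \<open>x = 0\<close> bounds \<open>g\<close> from below. This makes \<open>\<beta>\<close> controllable by \<open>g + \<kappa> * \<beta>\<close>.\<close>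
  obtain C0 where C0: "\<And>t x v. \<bar>t\<bar> \<le> T \<Longrightarrow> norm x \<le> 0 \<Longrightarrow> norm (v :: real^'n) \<le> 0 \<Longrightarrow> norm (Vc t x) \<le> C0"
    using L.bounded_on_box[OF L.V_cont3] by blast
  have g_lower: "g t \<ge> - C0" if "t \<in> I" for t
  proof -
    have "V t 0 \<ge> b * G 0 - g t" using V3_data(1) by (intro V3 that) (simp add: G_0)
    moreover have "\<bar>V t 0\<bar> \<le> C0" using C0[of t 0 0] that c_id[OF that] by (auto simp: Vc_def I_def)
    ultimately show ?thesis by (simp add: G_0)
  qed
  \<comment> \<open>The strict inequality assumed for \<open>f\<close> and \<open>g\<close> leaves room for adding a small multiple of \<open>\<beta>\<close> to \<open>g\<close>.\<close>
  define gap where "gap = min \<Lambda> (b - 1) * \<rho> - (LINT t | lebesgue_on I. ?G (f t) + g t)"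
  define S where "S = (LINT t | lebesgue_on I. \<beta> t)"
  define \<kappa> where "\<kappa> = gap / (2 * (S + 1))"
  have gap: "gap > 0" using f by (simp add: gap_def)
  have S: "S \<ge> 0" unfolding S_def using F2_data(4) by (intro integral_nonneg_AE AE_I2) (simp add: I_def)
  have \<kappa>: "\<kappa> > 0" "\<kappa> * S < gap"
  proof -
    show k: "\<kappa> > 0" using gap S by (simp add: \<kappa>_def)
    have "\<kappa> * (S + 1) = gap / 2"
      using S by (intro nonzero_eq_divide_eq[THEN iffD1]) (auto simp: \<kappa>_def)
    then show "\<kappa> * S < gap" using k gap by (simp add: distrib_left)
  qed
  define \<gamma> where "\<gamma> t = g t + \<kappa> * \<beta> t" for t
  have \<gamma>_int: "integrable (lebesgue_on I) \<gamma>"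
    unfolding \<gamma>_def by (intro Bochner_Integration.integrable_add integrable_mult_right V3_data(3) F2_data(3))
  have \<beta>_le: "\<beta> t \<le> (\<gamma> t + C0) / \<kappa>" if "t \<in> I" for t
    using g_lower[OF that] \<kappa>(1) by (simp add: \<gamma>_def field_simps)
  have \<gamma>_ge: "g t \<le> \<gamma> t" if "t \<in> I" for t using F2_data(4)[OF that] \<kappa>(1) by (simp add: \<gamma>_def)
  have V_hom: "DV (t, x) \<bullet> x \<le> \<theta>\<^sub>V * V t x - \<epsilon>\<^sub>V * norm x powr p\<^sub>K" "V t x < 0" if "t \<in> I" "norm x > M" for t x
  proof -
    have "DV (t, x) \<bullet> x \<le> (\<theta>\<^sub>V - \<epsilon>\<^sub>V) * K t x - \<theta>\<^sub>V * W t x"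
      using V2(1)[OF that] gradV[OF that(1)] by simp
    moreover have "\<epsilon>\<^sub>V * (norm x powr p\<^sub>K) \<le> \<epsilon>\<^sub>V * K t x" using V2(3)[OF that] V2_data(2) by simp
    ultimately show "DV (t, x) \<bullet> x \<le> \<theta>\<^sub>V * V t x - \<epsilon>\<^sub>V * norm x powr p\<^sub>K"
      unfolding V1[OF that(1)] by (simp add: left_diff_distrib right_diff_distrib)
    show "V t x < 0" using V2(2)[OF that] V1[OF that(1)] by simp
  qed
  interpret superquadratic T Fc Fxc Fvc Vc Vxc f G \<gamma> "\<lambda>t. ?G (f t)" \<theta>\<^sub>F \<theta>\<^sub>V \<Lambda> b \<rho>
  proof
    show "2 * T \<ge> 1" by (rule T(2))
    show "convex_on UNIV G" using G(1) by (simp add: G_function_def)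
    show "\<exists>C. \<forall>x. \<kappa> * norm x \<le> G x + C" for \<kappa> by (rule G_sl)
    show "integrable (lebesgue_on {-T..T}) \<gamma>" "integrable (lebesgue_on {-T..T}) (\<lambda>t. ?G (f t))"
      using \<gamma>_int fG by (simp_all add: I_def)
    show "Fxc t x v \<bullet> x + Fvc t x v \<bullet> v \<le> \<theta>\<^sub>F * Fc t x v" for t x v
      using F3(2)[OF cI, of t v x] by (simp add: gradF[OF cI] Fxc_def Fvc_def Fc_def)
    show "0 \<le> f t \<bullet> x + G x + ?G (f t)" for t x
      using fenchel_young[OF G(1), of "- x" "f t"] by (simp add: G_even inner_commute)
    show "(LINT t|lebesgue_on {-T..T}. Vc t 0) = 0"
    proof -
      have "(LINT t|lebesgue_on {-T..T}. Vc t 0) = (LINT t|lebesgue_on I. V t 0)"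
        unfolding I_def by (rule Bochner_Integration.integral_cong) (auto simp: Vc_def c_id I_def)
      then show ?thesis using V4 by simp
    qed
    show "Vc t x \<ge> b * G x - \<gamma> t" if "t \<in> {-T..T}" "G (x /\<^sub>R (4 * T)) \<le> \<rho> / 2" for t x
    proof -
      have t: "t \<in> I" using that(1) by (simp add: I_def)
      have "V t x \<ge> b * G x - g t" using that(2) by (intro V3 t) (simp add: mult.assoc[symmetric])
      then show ?thesis using \<gamma>_ge[OF t] c_id[OF t] by (simp add: Vc_def)
    qed
    show "integral {-T..T} (\<lambda>t. ?G (f t) + \<gamma> t) < min \<Lambda> (b - 1) * \<rho>"
    proof -
      have i1: "integrable (lebesgue_on I) (\<lambda>t. ?G (f t) + g t)"
        by (intro Bochner_Integration.integrable_add fG V3_data(3))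
      have "integral {-T..T} (\<lambda>t. ?G (f t) + \<gamma> t) = (LINT t|lebesgue_on I. ?G (f t) + \<gamma> t)"
        unfolding I_def using fG \<gamma>_int
        by (intro LINT_eq_integral[symmetric] Bochner_Integration.integrable_add) (simp_all add: I_def)
      also have "\<dots> = (LINT t|lebesgue_on I. (?G (f t) + g t) + \<kappa> * \<beta> t)"
        by (simp add: \<gamma>_def add.assoc)
      also have "\<dots> = (LINT t|lebesgue_on I. ?G (f t) + g t) + \<kappa> * S"
        unfolding S_def using i1 F2_data(3) by (subst Bochner_Integration.integral_add) auto
      finally show ?thesis using \<kappa>(2) by (simp add: gap_def)
    qed
    show "\<exists>C\<ge>0. \<exists>C'. \<forall>t\<in>{-T..T}. \<forall>x v. norm x \<le> r \<longrightarrow>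
        norm (Fxc t x v) \<le> C' + C * \<gamma> t + C * G v \<and> norm (Fvc t x v) \<le> C' + C * \<gamma> t + C * G v" for r
    proof -
      have "bounded (a ` {0..\<bar>r\<bar>})"
        using F2_data(1) by (intro compact_imp_bounded compact_continuous_image) (auto intro: continuous_on_subset)
      then obtain A where A: "\<forall>y\<in>a ` {0..\<bar>r\<bar>}. norm y \<le> A" unfolding bounded_iff by blast
      have a_le: "a (norm x) \<le> A" if "norm x \<le> r" for x :: "real^'n"
      proof -
        have "norm x \<in> {0..\<bar>r\<bar>}" using that by simp
        then have "norm (a (norm x)) \<le> A" using A by blast
        then show ?thesis by simp
      qed
      \<comment> \<open>\<open>Q\<close> bounds the function \<open>a\<close> up to radius \<open>r\<close>. The bound for the velocity gradient uses
        \<open>norm y \<le> G\<^sup>* y + C1\<close> and \<open>G\<^sup>* (gradient G v) \<le> G (2 *\<^sub>R v) \<le> C2 * G v + C2'\<close>.\<close>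
      define Q where "Q = max A 0"
      define C where "C = Q / \<kappa> + Q + Q * C2"
      define C' where "C' = C * C0 + Q * \<bar>C2'\<bar> + \<bar>C1\<bar>"
      have Q: "Q \<ge> 0" by (simp add: Q_def)
      have Ck: "0 \<le> Q / \<kappa>" "0 \<le> Q * C2" using Q \<kappa>(1) C2(1) by auto
      have C: "C \<ge> 0" using Q Ck by (simp add: C_def)
      have "norm (Fxc t x v) \<le> C' + C * \<gamma> t + C * G v \<and> norm (Fvc t x v) \<le> C' + C * \<gamma> t + C * G v"
        if t: "t \<in> {-T..T}" and x: "norm x \<le> r" for t x v
      proof -
        have tI: "t \<in> I" using t by (simp add: I_def)
        have aQ: "a (norm x) \<le> Q" using a_le[OF x] by (simp add: Q_def)
        have \<beta>0: "\<beta> t \<ge> 0" by (rule F2_data(4)[OF tI])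
        have \<gamma>0: "\<gamma> t + C0 \<ge> 0" using g_lower[OF tI] \<gamma>_ge[OF tI] by linarith
        have Q\<beta>: "Q * \<beta> t \<le> C * (\<gamma> t + C0)"
        proof -
          have "Q * \<beta> t \<le> Q * ((\<gamma> t + C0) / \<kappa>)" using \<beta>_le[OF tI] Q by (rule mult_left_mono)
          also have "\<dots> = Q / \<kappa> * (\<gamma> t + C0)" by simp
          also have "\<dots> \<le> C * (\<gamma> t + C0)" using \<gamma>0 Q Ck by (intro mult_right_mono) (auto simp: C_def)
          finally show ?thesis .
        qed
        have QG: "Q * G v \<le> C * G v" "Q * C2 * G v \<le> C * G v"
          using G_nn[of v] Q Ck by (auto intro!: mult_right_mono simp: C_def)
        have C'1: "C' \<ge> C * C0" "C' \<ge> C * C0 + Q * C2' + C1"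
        proof -
          have "Q * C2' \<le> Q * \<bar>C2'\<bar>" "0 \<le> Q * \<bar>C2'\<bar>" using Q by (auto intro: mult_left_mono)
          then show "C' \<ge> C * C0" "C' \<ge> C * C0 + Q * C2' + C1" by (auto simp: C'_def)
        qed
        have "norm (Fxc t x v) \<le> a (norm x) * (\<beta> t + G v)"
          using F2(2)[OF tI, of v x] gradF(1)[OF tI] c_id[OF tI] by (simp add: Fxc_def)
        also have "\<dots> \<le> Q * (\<beta> t + G v)" using aQ \<beta>0 G_nn[of v] by (intro mult_right_mono) auto
        also have "\<dots> \<le> C' + C * \<gamma> t + C * G v"
          using Q\<beta> QG(1) C'1(1) by (simp add: distrib_left)
        finally have 1: "norm (Fxc t x v) \<le> C' + C * \<gamma> t + C * G v" .
        have G2: "?G (gradient G v) \<le> C2 * G v + C2'"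
          using fenchel_conjugate_gradient_le[OF G(1) G_grad, of v] C2(2)[of v] by linarith
        have Gs0: "?G y \<ge> 0" for y using fenchel_young[OF G(1), of 0 y] by (simp add: G_0)
        have "norm (Fvc t x v) \<le> ?G (Fvc t x v) + C1" by (rule C1)
        also have "?G (Fvc t x v) \<le> a (norm x) * (\<beta> t + ?G (gradient G v))"
          using F2(3)[OF tI, of x v] gradF(2)[OF tI] c_id[OF tI] by (simp add: Fvc_def)
        also have "\<dots> \<le> Q * (\<beta> t + ?G (gradient G v))" using aQ \<beta>0 Gs0 by (intro mult_right_mono) auto
        also have "\<dots> \<le> Q * (\<beta> t + (C2 * G v + C2'))" using G2 Q by (intro mult_left_mono) auto
        finally have 2: "norm (Fvc t x v) \<le> C' + C * \<gamma> t + C * G v"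
          using Q\<beta> QG(2) C'1(2) by (simp add: distrib_left mult.assoc)
        show ?thesis using 1 2 by blast
      qed
      then show ?thesis using C by blast
    qed
    show "\<exists>C. \<forall>t x. \<theta>\<^sub>V * Vc t x - Vxc t x \<bullet> x \<ge> \<kappa> * norm x - C" for \<kappa>
    proof -
      \<comment> \<open>Outside the ball of radius \<open>M\<close> the surplus \<open>\<epsilon>\<^sub>V * norm x powr p\<^sub>K\<close> is superlinear; inside, everything
        is bounded by compactness.\<close>
      obtain Ca where Ca: "\<And>y. y \<ge> 0 \<Longrightarrow> \<kappa> / \<epsilon>\<^sub>V * y \<le> y powr p\<^sub>K + Ca"
        using powr_superlinear[OF V2_data(4)] by blast
      obtain Cb where Cb: "\<And>t x v. \<bar>t\<bar> \<le> T \<Longrightarrow> norm x \<le> M \<Longrightarrow> norm (v :: real^'n) \<le> 0 \<Longrightarrow> norm (Vc t x) \<le> Cb"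
        using L.bounded_on_box[OF L.V_cont3] by blast
      obtain Cc where Cc: "\<And>t x v. \<bar>t\<bar> \<le> T \<Longrightarrow> norm x \<le> M \<Longrightarrow> norm (v :: real^'n) \<le> 0 \<Longrightarrow> norm (Vxc t x) \<le> Cc"
        using L.bounded_on_box[OF L.Vx_cont3] by blast
      have "\<theta>\<^sub>V * Vc t x - Vxc t x \<bullet> x \<ge> \<kappa> * norm x - (\<bar>\<epsilon>\<^sub>V * Ca\<bar> + (\<bar>\<kappa>\<bar> * M + \<bar>\<theta>\<^sub>V\<bar> * Cb + Cc * M))" for t x
      proof -
        have ct: "\<bar>c t\<bar> \<le> T" "Vc t x = Vc (c t) x" "Vxc t x = Vxc (c t) x"
          using cI[of t] c_id[OF cI[of t]] by (auto simp: I_def Vc_def Vxc_def)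
        have nn: "0 \<le> \<bar>\<kappa>\<bar> * M + \<bar>\<theta>\<^sub>V\<bar> * Cb + Cc * M"
          using order_trans[OF norm_ge_zero Cb[of 0 0 0]] order_trans[OF norm_ge_zero Cc[of 0 0 0]] V2_data(1) T(1)
          by (auto intro!: add_nonneg_nonneg mult_nonneg_nonneg)
        show ?thesis
        proof (cases "norm x > M")
          case True
          have "\<epsilon>\<^sub>V * (\<kappa> / \<epsilon>\<^sub>V * norm x) \<le> \<epsilon>\<^sub>V * (norm x powr p\<^sub>K + Ca)"
            using Ca[of "norm x"] V2_data(2) by (intro mult_left_mono) auto
          then have "\<kappa> * norm x \<le> \<epsilon>\<^sub>V * norm x powr p\<^sub>K + \<epsilon>\<^sub>V * Ca"
            using V2_data(2) by (simp add: distrib_left)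
          moreover have "\<epsilon>\<^sub>V * norm x powr p\<^sub>K \<le> \<theta>\<^sub>V * Vc t x - Vxc t x \<bullet> x"
            using V_hom(1)[OF cI True, of t] by (simp add: Vc_def Vxc_def)
          ultimately show ?thesis using nn by linarith
        next
          case False
          then have x: "norm x \<le> M" by simp
          have "\<kappa> * norm x \<le> \<bar>\<kappa>\<bar> * M" using x by (intro mult_mono) auto
          moreover have "\<bar>\<theta>\<^sub>V * Vc t x\<bar> \<le> \<bar>\<theta>\<^sub>V\<bar> * Cb"
            unfolding abs_mult using Cb[OF ct(1) x, of 0] ct(2) by (intro mult_left_mono) auto
          moreover have "\<bar>Vxc t x \<bullet> x\<bar> \<le> Cc * M"
            using Cc[OF ct(1) x, of 0] ct(3) x by (intro abs_inner_le_mult) auto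
          ultimately show ?thesis by linarith
        qed
      qed
      then show ?thesis by blast
    qed
    show "\<exists>x. norm x \<ge> \<kappa> \<and> (\<forall>t. Vc t x \<le> - \<kappa> * norm x)" for \<kappa>
    proof -
      \<comment> \<open>Along a ray \<open>V\<close> decreases at least like \<open>- \<eta> * s powr \<theta>\<^sub>V\<close> with \<open>\<theta>\<^sub>V > 1\<close>, where \<open>\<eta>\<close> comes from the
        largest value of \<open>V\<close> at the starting point \<open>s0 *\<^sub>R e\<close>, which is negative.\<close>
      obtain e :: "real^'n" where e: "norm e = 1" using vector_choose_size[of 1] by auto
      define s0 where "s0 = M + 1"
      have s0: "s0 > 0" "s0 > M" using V2_data(1) by (auto simp: s0_def)
      have "continuous_on I (\<lambda>t. V t (s0 *\<^sub>R e))"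
        using continuous_on_compose2[OF DV(1), of I "\<lambda>t. (t, s0 *\<^sub>R e)"]
        by (simp add: continuous_intros image_subset_iff)
      then obtain t0 where t0: "t0 \<in> I" "\<And>t. t \<in> I \<Longrightarrow> V t (s0 *\<^sub>R e) \<le> V t0 (s0 *\<^sub>R e)"
        using continuous_attains_sup[of I "\<lambda>t. V t (s0 *\<^sub>R e)"] T(1) by (auto simp: I_def)
      define \<eta> where "\<eta> = - V t0 (s0 *\<^sub>R e) / s0 powr \<theta>\<^sub>V"
      have \<eta>: "\<eta> > 0" using V_hom(2)[OF t0(1), of "s0 *\<^sub>R e"] s0 e by (auto simp: \<eta>_def intro!: divide_neg_pos)
      have \<theta>1: "\<theta>\<^sub>V > 1" using V2_data by linarith
      obtain Ca where Ca: "\<And>y. y \<ge> 0 \<Longrightarrow> (\<bar>\<kappa>\<bar> + 1) / \<eta> * y \<le> y powr \<theta>\<^sub>V + Ca"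
        using powr_superlinear[OF \<theta>1] by blast
      define s where "s = max s0 (max \<bar>\<kappa>\<bar> (\<eta> * Ca))"
      have s: "s \<ge> s0" "s \<ge> \<kappa>" "s \<ge> \<eta> * Ca" "s > 0" using s0 by (auto simp: s_def)
      have "Vc t (s *\<^sub>R e) \<le> - \<kappa> * norm (s *\<^sub>R e)" for t
      proof -
        have ct: "c t \<in> I" by (rule cI)
        have "V (c t) (s *\<^sub>R e) \<le> (s / s0) powr \<theta>\<^sub>V * V (c t) (s0 *\<^sub>R e)"
        proof (rule superquadratic_decay[OF GV[OF ct] s0(1) s(1)])
          fix z assume z: "s0 \<le> z"
          have "norm (z *\<^sub>R e) > M" using z s0 e by simp
          from V_hom(1)[OF ct this] show "DV (c t, z *\<^sub>R e) \<bullet> (z *\<^sub>R e) \<le> \<theta>\<^sub>V * V (c t) (z *\<^sub>R e)"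
            using V2_data(2) by (smt (verit) powr_ge_zero mult_nonneg_nonneg)
        qed
        also have "\<dots> \<le> (s / s0) powr \<theta>\<^sub>V * V t0 (s0 *\<^sub>R e)"
          using t0(2)[OF ct] by (intro mult_left_mono) auto
        also have "\<dots> = - (\<eta> * s powr \<theta>\<^sub>V)"
          using s0 s(4) by (simp add: \<eta>_def powr_divide)
        also have "\<dots> \<le> - \<kappa> * s"
        proof -
          have "\<eta> * ((\<bar>\<kappa>\<bar> + 1) / \<eta> * s) \<le> \<eta> * (s powr \<theta>\<^sub>V + Ca)"
            using Ca[of s] s(4) \<eta> by (intro mult_left_mono) auto
          moreover have "\<eta> * ((\<bar>\<kappa>\<bar> + 1) / \<eta> * s) = \<bar>\<kappa>\<bar> * s + s" using \<eta> by (simp add: distrib_right)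
          ultimately have "\<bar>\<kappa>\<bar> * s + s \<le> \<eta> * s powr \<theta>\<^sub>V + \<eta> * Ca" by (simp add: distrib_left)
          moreover have "\<kappa> * s \<le> \<bar>\<kappa>\<bar> * s" using s(4) by (intro mult_right_mono) auto
          ultimately show ?thesis using s(3) by simp
        qed
        finally show ?thesis using e s(4) by (simp add: Vc_def)
      qed
      then show ?thesis using e s(2,4) by (intro exI[of _ "s *\<^sub>R e"]) auto
    qed
  qed (use G_nn G_0 G_even G_cont F4 F5(1) cI F3(1) V2_data(3) V3_data in \<open>auto simp: Fc_def\<close>)
  obtain u\<^sub>1 d\<^sub>1 u\<^sub>2 d\<^sub>2 where ud: "L.weak_solution u\<^sub>1 d\<^sub>1" "L.weak_solution u\<^sub>2 d\<^sub>2" "L.action u\<^sub>1 d\<^sub>1 < L.action u\<^sub>2 d\<^sub>2"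
    using two_weak_solutions by blast
  have eq: "F t x v = Fc t x v" "V t x = Vc t x" if "t \<in> {-T..T}" for t x v
    using c_id[of t] that by (simp_all add: Fc_def Vc_def I_def)
  have ps: "periodic_solution G T (\<lambda>t x v. F t x v + V t x + f t \<bullet> x) u"
    "AE t in lebesgue_on {-T..T}. time_derivative {-T..T} u t = d t" if "L.weak_solution u d" for u d
    using weak_solution_imp_periodic_solution[OF lag that G_cont, of F V] eq by blast+
  \<comment> \<open>If the solutions agreed on \<open>I\<close>, so would their derivatives there, and hence their actions.\<close>
  have "\<exists>t\<in>I. u\<^sub>1 t \<noteq> u\<^sub>2 t"
  proof (rule ccontr)
    assume "\<not> ?thesis"
    then have same: "u\<^sub>1 t = u\<^sub>2 t" if "t \<in> {-T..T}" for t using that by (auto simp: I_def)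
    have td: "time_derivative {-T..T} u\<^sub>1 t = time_derivative {-T..T} u\<^sub>2 t" if "t \<in> {-T..T}" for t
    proof -
      have "(u\<^sub>1 has_vector_derivative D) (at t within {-T..T}) \<longleftrightarrow> (u\<^sub>2 has_vector_derivative D) (at t within {-T..T})" for D
        using same that has_vector_derivative_transform[of t "{-T..T}" u\<^sub>1 u\<^sub>2 D] has_vector_derivative_transform[of t "{-T..T}" u\<^sub>2 u\<^sub>1 D]
        by auto
      then show ?thesis by (simp add: vector_derivative_def)
    qed
    have AEI: "AE t in lebesgue_on {-T..T}. t \<in> {-T..T}"
      using AE_space[of "lebesgue_on {-T..T}"] by simp
    from ps(2)[OF ud(1)] ps(2)[OF ud(2)] AEI have "AE t in lebesgue_on {-T..T}. Fc t (u\<^sub>1 t) (d\<^sub>1 t) + Vc t (u\<^sub>1 t) + f t \<bullet> u\<^sub>1 t = Fc t (u\<^sub>2 t) (d\<^sub>2 t) + Vc t (u\<^sub>2 t) + f t \<bullet> u\<^sub>2 t"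
    proof eventually_elim
      case (elim t)
      then show ?case using td[OF elim(3)] same[OF elim(3)] by simp
    qed
    moreover have meas: "(\<lambda>t. Fc t (u t) (d t) + Vc t (u t) + f t \<bullet> u t) \<in> borel_measurable L.M"
      if "L.weak_solution u d" for u d
    proof -
      have um: "u \<in> borel_measurable L.M" and dm: "d \<in> borel_measurable L.M"
        using that unfolding L.weak_solution_def by (auto intro: continuous_imp_measurable_on_sets_lebesgue)
      show ?thesis
        using fm by (intro borel_measurable_add borel_measurable_inner L.measurable_joint[OF L.F_cont L.id_meas um dm]
          L.measurable_joint[OF L.V_cont3 L.id_meas um dm] um) (simp add: I_def)
    qed
    ultimately have "L.action u\<^sub>1 d\<^sub>1 = L.action u\<^sub>2 d\<^sub>2"
      unfolding L.action_def by (intro integral_cong_AE meas ud)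
    then show False using ud(3) by simp
  qed
  then show ?thesis using ps(1)[OF ud(1)] ps(1)[OF ud(2)] by blast
qed

end
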